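(* Let $\lambda_1=\dots=\lambda_d=1$, let $Z=(Z_1,\dots,Z_d)$ be the ordered exponential random walk started from $Z(0)=x=(x_1,\dots,x_d)\in W^d$, let $1\le n_1<\dots<n_m$ be integers and $\xi_1,\dots,\xi_m\in\mathbb{R}$. (Largest particle.) Suppose $n_1\ge d-1$. Let $A=(A_{kl})_{k,l=1}^d$ have entries $$A_{kl}=\int_{x_k}^\infty f_{n_m-d+k}(z-x_k)z^{l-1}dz=\mathbb{E}\big[(x_k+\zeta_{n_m-d+k})^{l-1}\big],\qquad \zeta_r\sim\mathrm{Gamma}(r,1).$$ Then $A$ is invertible and $$\mathbb{P}_x\big(Z_d(n_1)\le\xi_1,\dots,Z_d(n_m)\le\xi_m\big)=\det\big(I-\bar\chi_\xi K\bar\chi_\xi\big)_{L^2(\{n_1,\dots,n_m\}\times\mathbb{R})},$$ where $\bar\chi_\xi(n_j,y)=1_{\{y>\xi_j\}}$ and $$K(n_i,y;n_j,z)=-f_{n_j-n_i}(z-y)1_{\{i<j\}}+\sum_{k,l=1}^d\Big(\int_y^\infty f_{n_m-n_i}(u-y)u^{k-1}du\Big)(A^{-1})_{kl}\,f_{n_j-d+l}(z-x_l).$$ (Smallest particle.) Suppose $n_m-n_{m-1}\ge d-1$ (with $n_0:=0$). Let $B=(B_{kl})_{k,l=1}^d$ have entries $$B_{kl}=\int_{x_k}^\infty f_{n_m-1+k}(z-x_k)z^{l-1}dz=\mathbb{E}\big[(x_k+\zeta_{n_m-1+k})^{l-1}\big].$$ Then $B$ is invertible and $$\mathbb{P}_x\big(Z_1(n_1)\ge\xi_1,\dots,Z_1(n_m)\ge\xi_m\big)=\det\big(I-\chi_\xi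 K\chi_\xi\big)_{L^2(\{n_1,\dots,n_m\}\times\mathbb{R})},$$ where $\chi_\xi(n_j,y)=1_{\{y<\xi_j\}}$ and $$K(n_i,y;n_j,z)=-f_{n_j-n_i}(z-y)1_{\{i<j\}}+\sum_{k,l=1}^d\Big(\int_y^\infty f_{n_m-n_i}(u-y)u^{k-1}du\Big)(B^{-1})_{kl}\,f_{n_j-1+l}(z-x_l).$$
   Context: Let $W^d=\{x\in\mathbb{R}^d:x_1\le\dots\le x_d\}$, $\Delta(x)=\prod_{1\le i<j\le d}(x_j-x_i)$. Let $(X_{ij})_{i\ge1,1\le j\le d}$ be independent exponential random variables of rate $1$ and $S_j(n)=x_j+\sum_{i=1}^nX_{ij}$, $S(0)=x\in W^d$; $\tau=\inf\{n\ge1:S(n)\notin W^d\}$. Let $h(x)=\mathbb{E}[\Delta(x_1+\eta_1,\dots,x_d+\eta_d)]$ with $\eta_1=0$ and $\eta_j\sim\mathrm{Gamma}(j-1,1)$, $2\le j\le d$, independent. The function $h$ is strictly positive on $W^d$ and satisfies $\mathbb{E}_x[h(S(1))1_{\{\tau>1\}}]=h(x)$. The ordered exponential random walk $(Z(n))_{n\ge0}$ is the Doob $h$-transform of $S$ killed at $\tau$: for bounded measurable $F$, $\mathbb{E}_x[F(Z(k):0\le k\le n)]=\mathbb{E}_x\big[\frac{h(S(n))}{h(x)}F(S(k):0\le k\le n)1_{\{\tau>n\}}\big]$. For $r\ge1$, $f_r(u)=\frac{u^{r-1}}{(r-1)!}e^{-u}1_{\{u>0\}}$ is the $\mathrm{Gamma}(r,1)$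 density; $f_r=0$ for $r<0$; $f_0$ is interpreted as the unit point mass at $0$ (the $\mathrm{Gamma}(0,1)$ law), so that $\int_y^\infty f_0(u-y)u^{k-1}du=y^{k-1}$, and $f_0(z-x_l)\,dz$ is the unit mass at $z=x_l$. The Fredholm determinant of a kernel $K$ restricted by an indicator $\chi$ is given by the Fredholm series $$\det(I-\chi K\chi)=1+\sum_{k\ge1}\frac{(-1)^k}{k!}\sum_{i_1,\dots,i_k=1}^m\int_{\mathbb{R}^k}\prod_{r=1}^k\chi(n_{i_r},y_r)\,\det\big(K(n_{i_r},y_r;n_{i_s},y_s)\big)_{r,s=1}^k\,dy_1\cdots dy_k .$$ *)

theory Defs
  imports
    "HOL-Probability.Probability"
    "HOL-Library.Extended_Nat"
    "Jordan_Normal_Form.Determinant"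
    "Jordan_Normal_Form.Gauss_Jordan_Elimination"
begin

text \<open>
  Points of $d$-dimensional space are functions \<^typ>\<open>nat \<Rightarrow> real\<close> of which only the coordinates
  $1, \dots, d$ matter. Matrices of Jordan Normal Form are indexed from 0, so that the entry
  $(k, l)$ with $1 \le k, l \le d$ is found at position $(k - 1, l - 1)$.
\<close>

section \<open>The ordered exponential random walk\<close>

definition weyl_chamber :: "nat \<Rightarrow> (nat \<Rightarrow> real) set" where
  "weyl_chamber d = {x. mono_on {1..d} x}"

definition vandermonde :: "nat \<Rightarrow> (nat \<Rightarrow> real) \<Rightarrow> real" where
  "vandermonde d x = (\<Prod>j=1..d. \<Prod>i\<in>{1..<j}. x j - x i)"

text \<open>
  The value at \<open>r = 0\<close> is the density of the unit mass at 0 with respect to any measure that gives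
  mass 1 to the point 0; see \<open>atomic_lborel\<close> below.
\<close>

definition gamma_density :: "int \<Rightarrow> real \<Rightarrow> real" where
  "gamma_density r u =
     (if r < 0 then 0
      else if r = 0 then indicator {0} u
      else u ^ nat (r - 1) / fact (nat (r - 1)) * exp (- u) * indicator {0<..} u)"

text \<open>The measure $f_r(u - y)\,du$, that is, the law of $y + \zeta$ with $\zeta \sim \mathrm{Gamma}(r, 1)$.\<close>

definition gamma_measure :: "int \<Rightarrow> real \<Rightarrow> real measure" where
  "gamma_measure r y =
     (if r = 0 then return borel y
      else density lborel (\<lambda>u. ennreal (gamma_density r (u - y))))"

definition h_fun :: "nat \<Rightarrow> (nat \<Rightarrow> real) \<Rightarrow> real" where
  "h_fun d x = (\<integral>\<eta>. vandermonde d (\<lambda>j. x j + \<eta> j) \<partial>(\<Pi>\<^sub>M j\<in>{1..d}. gamma_measure (int j - 1) 0))"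

definition iid_exponential :: "'a measure \<Rightarrow> nat \<Rightarrow> (nat \<Rightarrow> nat \<Rightarrow> 'a \<Rightarrow> real) \<Rightarrow> bool" where
  "iid_exponential M d X \<longleftrightarrow>
     prob_space M \<and>
     prob_space.indep_vars M (\<lambda>_. borel) (\<lambda>(i, j). X i j) ({1..} \<times> {1..d}) \<and>
     (\<forall>i\<ge>1. \<forall>j\<in>{1..d}. distributed M lborel (X i j) (exponential_density 1))"

definition walk :: "(nat \<Rightarrow> nat \<Rightarrow> 'a \<Rightarrow> real) \<Rightarrow> (nat \<Rightarrow> real) \<Rightarrow> nat \<Rightarrow> 'a \<Rightarrow> nat \<Rightarrow> real" where
  "walk X x n \<omega> j = x j + (\<Sum>i=1..n. X i j \<omega>)"

definition exit_time :: "nat \<Rightarrow> (nat \<Rightarrow> 'a \<Rightarrow> nat \<Rightarrow> real) \<Rightarrow> 'a \<Rightarrow> enat" where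
  "exit_time d S \<omega> = Inf {enat n | n. 1 \<le> n \<and> S n \<omega> \<notin> weyl_chamber d}"

definition path_space :: "nat \<Rightarrow> nat \<Rightarrow> (nat \<Rightarrow> nat \<Rightarrow> real) measure" where
  "path_space d n = (\<Pi>\<^sub>M k\<in>{0..n}. \<Pi>\<^sub>M j\<in>{1..d}. borel)"

definition trajectory :: "nat \<Rightarrow> nat \<Rightarrow> (nat \<Rightarrow> 'a \<Rightarrow> nat \<Rightarrow> real) \<Rightarrow> 'a \<Rightarrow> nat \<Rightarrow> nat \<Rightarrow> real" where
  "trajectory d n S \<omega> = (\<lambda>k\<in>{0..n}. \<lambda>j\<in>{1..d}. S k \<omega> j)"

text \<open>
  The process \<open>Z\<close>, on a probability space \<open>N\<close> of its own, is the Doob $h$-transform of the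
  walk started at \<open>x\<close> and killed on leaving the chamber.
\<close>

definition ordered_exponential_walk ::
    "'a measure \<Rightarrow> (nat \<Rightarrow> nat \<Rightarrow> 'a \<Rightarrow> real) \<Rightarrow> nat \<Rightarrow> (nat \<Rightarrow> real) \<Rightarrow>
     'b measure \<Rightarrow> (nat \<Rightarrow> 'b \<Rightarrow> nat \<Rightarrow> real) \<Rightarrow> bool" where
  "ordered_exponential_walk M X d x N Z \<longleftrightarrow>
     prob_space N \<and>
     (\<forall>k. \<forall>j\<in>{1..d}. (\<lambda>\<omega>. Z k \<omega> j) \<in> borel_measurable N) \<and>
     (\<forall>n. \<forall>F :: (nat \<Rightarrow> nat \<Rightarrow> real) \<Rightarrow> real.
        F \<in> borel_measurable (path_space d n) \<longrightarrow> bounded (F ` space (path_space d n)) \<longrightarrow>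
        (\<integral>\<omega>. F (trajectory d n Z \<omega>) \<partial>N) =
        (\<integral>\<omega>. h_fun d (walk X x n \<omega>) / h_fun d x * F (trajectory d n (walk X x) \<omega>) *
              indicator {\<omega>. enat n < exit_time d (walk X x) \<omega>} \<omega> \<partial>M))"


section \<open>Fredholm determinants\<close>

text \<open>
  The kernel \<open>K\<close> acts on $m$ copies of the line; the copies are labelled by $1, \dots, m$ and the
  \<open>j\<close>-th one carries the measure \<open>\<rho> j\<close>. For \<open>\<rho> j = lborel\<close> this is the usual Fredholm series.
  A kernel $K(i, y; j, dz)$ whose measure part in \<open>z\<close> has atoms is covered by adding the atoms to
  \<open>\<rho> j\<close> and passing to the density with respect to \<open>\<rho> j\<close>.
\<close>

definition fredholm_integrand ::
    "(nat \<Rightarrow> real \<Rightarrow> real) \<Rightarrow> (nat \<Rightarrow> real \<Rightarrow> nat \<Rightarrow> real \<Rightarrow> real) \<Rightarrow> nat \<Rightarrow> (nat \<Rightarrow> nat) \<Rightarrow>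
     (nat \<Rightarrow> real) \<Rightarrow> real" where
  "fredholm_integrand \<theta> K k i y =
     (\<Prod>r<k. \<theta> (i r) (y r)) *
     Determinant.det (Matrix.mat k k (\<lambda>(r, s). K (i r) (y r) (i s) (y s)))"

definition fredholm_term ::
    "nat \<Rightarrow> (nat \<Rightarrow> real measure) \<Rightarrow> (nat \<Rightarrow> real \<Rightarrow> real) \<Rightarrow>
     (nat \<Rightarrow> real \<Rightarrow> nat \<Rightarrow> real \<Rightarrow> real) \<Rightarrow> nat \<Rightarrow> real" where
  "fredholm_term m \<rho> \<theta> K k =
     (- 1) ^ k / fact k *
     (\<Sum>i\<in>{..<k} \<rightarrow>\<^sub>E {1..m}.
        \<integral>y. fredholm_integrand \<theta> K k i y \<partial>(\<Pi>\<^sub>M r\<in>{..<k}. \<rho> (i r)))"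

definition fredholm_det ::
    "nat \<Rightarrow> (nat \<Rightarrow> real measure) \<Rightarrow> (nat \<Rightarrow> real \<Rightarrow> real) \<Rightarrow>
     (nat \<Rightarrow> real \<Rightarrow> nat \<Rightarrow> real \<Rightarrow> real) \<Rightarrow> real" where
  "fredholm_det m \<rho> \<theta> K = 1 + (\<Sum>k. fredholm_term m \<rho> \<theta> K (Suc k))"

text \<open>Rules out the default values of divergent integrals and series.\<close>

definition fredholm_convergent ::
    "nat \<Rightarrow> (nat \<Rightarrow> real measure) \<Rightarrow> (nat \<Rightarrow> real \<Rightarrow> real) \<Rightarrow>
     (nat \<Rightarrow> real \<Rightarrow> nat \<Rightarrow> real \<Rightarrow> real) \<Rightarrow> bool" where
  "fredholm_convergent m \<rho> \<theta> K \<longleftrightarrow>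
     (\<forall>k. \<forall>i\<in>{..<k} \<rightarrow>\<^sub>E {1..m}.
        integrable (\<Pi>\<^sub>M r\<in>{..<k}. \<rho> (i r)) (fredholm_integrand \<theta> K k i)) \<and>
     summable (fredholm_term m \<rho> \<theta> K)"


section \<open>The kernels\<close>

text \<open>$\int_y^\infty f_r(u - y)\, u^p\, du$, which is $y^p$ for $r = 0$\<close>

definition gamma_moment :: "int \<Rightarrow> real \<Rightarrow> nat \<Rightarrow> real" where
  "gamma_moment r y p = (\<integral>u. u ^ p \<partial>gamma_measure r y)"

text \<open>
  The matrices and kernels of the largest and the smallest particle differ only in the
  label \<open>c\<close> of the particle: \<open>c = d\<close> and \<open>c = 1\<close>, respectively.
\<close>

definition moment_mat :: "nat \<Rightarrow> nat \<Rightarrow> nat \<Rightarrow> (nat \<Rightarrow> real) \<Rightarrow> real mat" where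
  "moment_mat c d n x =
     Matrix.mat d d (\<lambda>(k, l). gamma_moment (int n - int c + int (Suc k)) (x (Suc k)) l)"

definition walk_kernel ::
    "nat \<Rightarrow> nat \<Rightarrow> nat \<Rightarrow> (nat \<Rightarrow> nat) \<Rightarrow> (nat \<Rightarrow> real) \<Rightarrow>
     nat \<Rightarrow> real \<Rightarrow> nat \<Rightarrow> real \<Rightarrow> real" where
  "walk_kernel c d m n x i y j z =
     - (gamma_density (int (n j) - int (n i)) (z - y) * of_bool (i < j)) +
     (\<Sum>k=1..d. \<Sum>l=1..d.
        gamma_moment (int (n m) - int (n i)) y (k - 1) *
        the (mat_inverse (moment_mat c d (n m) x)) $$ (k - 1, l - 1) *
        gamma_density (int (n j) - int c + int l) (z - x l))"

definition atomic_lborel :: "real set \<Rightarrow> real measure" where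
  "atomic_lborel P =
     measure_of UNIV (sets borel) (\<lambda>B. emeasure lborel B + (\<Sum>a\<in>P. indicator B a))"

lemma sets_atomic_lborel [simp, measurable_cong]: "sets (atomic_lborel P) = sets borel"
  unfolding atomic_lborel_def
  by (subst sets_measure_of) (simp_all add: sets.sigma_sets_eq[of borel, simplified])

lemma space_atomic_lborel [simp]: "space (atomic_lborel P) = UNIV"
  unfolding atomic_lborel_def by (simp add: space_measure_of_conv)

lemma emeasure_atomic_lborel:
  assumes "B \<in> sets borel"
  shows "emeasure (atomic_lborel P) B = emeasure lborel B + (\<Sum>a\<in>P. indicator B a)"
proof (rule emeasure_measure_of[OF atomic_lborel_def])
  show "countably_additive (sets (atomic_lborel P))
          (\<lambda>B. emeasure lborel B + (\<Sum>a\<in>P. indicator B a))"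
  proof (rule countably_additiveI)
    fix A :: "nat \<Rightarrow> real set"
    assume A: "range A \<subseteq> sets (atomic_lborel P)" "disjoint_family A"
    have "(\<Sum>i. emeasure lborel (A i) + (\<Sum>a\<in>P. indicator (A i) a)) =
          (\<Sum>i. emeasure lborel (A i)) + (\<Sum>i. \<Sum>a\<in>P. indicator (A i) a :: ennreal)"
      by (rule suminf_add[symmetric]) auto
    also have "(\<Sum>i. emeasure lborel (A i)) = emeasure lborel (\<Union>i. A i)"
      using A by (intro suminf_emeasure) auto
    also have "(\<Sum>i. \<Sum>a\<in>P. indicator (A i) a :: ennreal) = (\<Sum>a\<in>P. \<Sum>i. indicator (A i) a)"
      by (rule suminf_sum) auto
    also have "\<dots> = (\<Sum>a\<in>P. indicator (\<Union>i. A i) a)"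
      using A(2) by (simp add: suminf_indicator)
    finally show "(\<Sum>i. emeasure lborel (A i) + (\<Sum>a\<in>P. indicator (A i) a)) =
        emeasure lborel (\<Union>i. A i) + (\<Sum>a\<in>P. indicator (\<Union>i. A i) a)" .
  qed
qed (use assms in \<open>auto simp: positive_def\<close>)

text \<open>
  In the kernel of the largest particle, $f_0(z - x_l)\,dz$ is the unit mass at $x_l$. It occurs at
  time \<open>n\<close> only if \<open>n = d - l\<close>. As $n_1 \ge d - 1$, the only possible case is that of
  \<open>l = 1\<close> at time $n_1 = d - 1$. The function \<open>walk_kernel d d m n x i y 1\<close> is
  then the density with respect to \<open>largest_measure d x (n 1)\<close>: the other summands have no mass at
  $x_1$, and indeed their densities $f_{l-1}(z - x_l)$ with $l \ge 2$ and $x_1 \le x_l$ vanish at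
  $z = x_1$, while the term with \<open>i < j\<close> is absent for \<open>j = 1\<close>.
\<close>

definition largest_measure :: "nat \<Rightarrow> (nat \<Rightarrow> real) \<Rightarrow> nat \<Rightarrow> real measure" where
  "largest_measure d x n = atomic_lborel (x ` {l\<in>{1..d}. int n - int d + int l = 0})"

end

theory Submission
  imports Defs
begin

text \<open>
  Write $P$ for the average of a function over one exponential step, so that $P^r v(y)$ is the mean
  of $v(y + \zeta_r)$ with $\zeta_r \sim \mathrm{Gamma}(r, 1)$. Everything rests on functions of the
  form $V(z) = \det (v_{kl}(z_k))$.

  The killed walk. The average of such a $V$ over one step, on the event that the order is kept, is a
  determinant of the same form if $v_{k+1,l} = P v_{k,l}$. Integrate out the particles from the
  lowest to the highest. The integral over $z_k$ stops at $z_{k+1}$. As an exponential variable has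
  no memory, the missing part is a multiple of $v_{k+1,l}(z_{k+1})$, which is row $k + 1$, and the
  determinant does not see it (\<open>one_step_determinant\<close>). The function $h$ has this form too:
  $h(y) = \det (P^{k-1} u^{l-1} (y_k))$, by the Vandermonde determinant (\<open>h_fun_eq_pdet\<close>). So the
  expectation of $h(S(n))$ on the event in question is found by going back in time from $h$. If the
  largest particle has to stay below the levels, each step moves row $k + 1$ to row $k$, and only the
  new last row sees the constraint (\<open>largest_walk_determinant\<close>). If the smallest particle has to stay
  above them, all particles do, and row operations that are valid on ordered points bring the
  determinant back to its form (\<open>smallest_walk_determinant\<close>). In both cases $h(x)$ times the
  probability is a determinant $\det \tilde A$. It arises from the matrix $A$ (or $B$) of moments if
  the indicators of the constraint are inserted into the integrals over the positions at the times
  $n_1, \dots, n_m$. Without constraint it is $\det A = h(x)$ (\<open>det_moment_mat\<close>), which is not zero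
  because the transformed process has total mass 1.

  The Fredholm series. Write $K = - U + \sum \psi_k (A^{-1})_{kl} \phi_l$, where $U$ only leads to
  later times. By a Schur complement (\<open>schur_bordered\<close>), $\det A \cdot \det(- K(e_r, e_s))$ is the
  determinant of $A$ bordered by the columns $\phi(e_s)$, the rows $\psi(e_r)$ and the block
  $U(e_r, e_s)$. Expand it along one of the first $d$ rows. A term that uses the column of a point
  amounts to the removal of this point: its row takes the place of the expanded row, averaged over
  the position of the point (\<open>bordered_total_reduce\<close>). Each removal leads to later times, so after
  finitely many removals no columns of points are left. Hence the series is a finite sum, and it
  equals $\det (A - \int \phi (\psi - U \psi + U U \psi - \dots)) / \det A$
  (\<open>bordered_total_expansion\<close>). By inclusion and exclusion over the times (\<open>Q_expansion\<close>) the
  alternating sum restores the indicators of the constraint, and the numerator is $\det \tilde A$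
  (\<open>fredholm_det_walk_kernel\<close>).
\<close>

section \<open>Determinants over finite index sets\<close>

text \<open>
  The determinant is taken over an arbitrary finite set of indices, because rows and columns of single
  points will be removed from the middle of a matrix.
\<close>

definition pdet :: "nat set \<Rightarrow> (nat \<Rightarrow> nat \<Rightarrow> real) \<Rightarrow> real" where
  "pdet I M = (\<Sum>p | p permutes I. of_int (sign p) * (\<Prod>i\<in>I. M i (p i)))"

lemma pdet_cong:
  assumes "\<And>i j. i \<in> I \<Longrightarrow> j \<in> I \<Longrightarrow> M i j = M' i j"
  shows "pdet I M = pdet I M'"
  unfolding pdet_def using assms
  by (intro sum.cong refl arg_cong2[where f="(*)"] prod.cong) (auto simp: permutes_in_image)

lemma pdet_empty [simp]: "pdet {} M = 1"
  by (simp add: pdet_def)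

lemma prod_row_split:
  assumes "finite I" "r \<in> I"
  shows "(\<Prod>i\<in>I. (M(r := u)) i (p i)) = u (p r) * (\<Prod>i\<in>I - {r}. M i (p i) :: real)"
proof -
  have "(\<Prod>i\<in>I. (M(r := u)) i (p i)) = (M(r := u)) r (p r) * (\<Prod>i\<in>I - {r}. (M(r := u)) i (p i))"
    using assms by (rule prod.remove)
  also have "(\<Prod>i\<in>I - {r}. (M(r := u)) i (p i)) = (\<Prod>i\<in>I - {r}. M i (p i))"
    by (intro prod.cong) auto
  finally show ?thesis by simp
qed

lemma pdet_row_sum:
  assumes "finite I" "r \<in> I"
  shows "pdet I (M(r := \<lambda>j. \<Sum>s\<in>S. c s * u s j)) = (\<Sum>s\<in>S. c s * pdet I (M(r := u s)))"
proof -
  have "pdet I (M(r := \<lambda>j. \<Sum>s\<in>S. c s * u s j)) =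
      (\<Sum>p | p permutes I. \<Sum>s\<in>S. c s * (of_int (sign p) * (u s (p r) * (\<Prod>i\<in>I - {r}. M i (p i)))))"
    unfolding pdet_def prod_row_split[OF assms]
    by (simp add: sum_distrib_left sum_distrib_right mult_ac)
  also have "\<dots> = (\<Sum>s\<in>S. c s * pdet I (M(r := u s)))"
    unfolding pdet_def prod_row_split[OF assms]
    by (subst sum.swap) (simp add: sum_distrib_left)
  finally show ?thesis .
qed

lemma pdet_row_lincomb:
  assumes "finite I" "r \<in> I"
  shows "pdet I (M(r := \<lambda>j. u j + c * v j)) = pdet I (M(r := u)) + c * pdet I (M(r := v))"
proof -
  have "pdet I (M(r := \<lambda>j. \<Sum>s\<in>{0, 1 :: nat}. (if s = 0 then 1 else c) * (if s = 0 then u else v) j)) =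
      (\<Sum>s\<in>{0, 1 :: nat}. (if s = 0 then 1 else c) * pdet I (M(r := (if s = 0 then u else v))))"
    by (rule pdet_row_sum[OF assms])
  then show ?thesis by simp
qed

lemma pdet_row_expand_finite:
  assumes "finite I" "r \<in> I"
  shows "pdet I (M(r := u)) = (\<Sum>l\<in>I. u l * pdet I (M(r := \<lambda>j. of_bool (j = l))))"
proof -
  have "pdet I (M(r := u)) = pdet I (M(r := \<lambda>j. \<Sum>l\<in>I. u l * of_bool (j = l)))"
    using assms(1) by (intro pdet_cong) auto
  also have "\<dots> = (\<Sum>l\<in>I. u l * pdet I (M(r := \<lambda>j. of_bool (j = l))))"
    using assms by (intro pdet_row_sum) auto
  finally show ?thesis .
qed

lemma pdet_row_expand:
  assumes "r < d"
  shows "pdet {..<d} (M(r := u)) = (\<Sum>l<d. u l * pdet {..<d} (M(r := \<lambda>j. of_bool (j = l))))"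
  using assms by (intro pdet_row_expand_finite) auto

lemma pdet_row_scale:
  assumes "finite I" "r \<in> I"
  shows "pdet I (M(r := \<lambda>j. t * u j)) = t * pdet I (M(r := u))"
proof -
  have "pdet I (M(r := \<lambda>j. \<Sum>s\<in>{()}. t * u j)) = (\<Sum>s\<in>{()}. t * pdet I (M(r := u)))"
    by (rule pdet_row_sum[OF assms])
  then show ?thesis by simp
qed

lemma pdet_scale:
  assumes "finite I"
  shows "pdet I (\<lambda>r c. f r * M r c * g c) = (\<Prod>r\<in>I. f r) * (\<Prod>c\<in>I. g c) * pdet I M"
proof -
  have "(\<Prod>r\<in>I. f r * M r (p r) * g (p r)) = (\<Prod>r\<in>I. f r) * (\<Prod>c\<in>I. g c) * (\<Prod>r\<in>I. M r (p r))"
    if "p permutes I" for p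
    using prod.reindex_bij_betw[OF permutes_imp_bij[OF that], of g] by (simp add: prod.distrib)
  then show ?thesis unfolding pdet_def sum_distrib_left by (intro sum.cong refl) simp
qed

lemma pdet_column_zero:
  assumes "finite I" "c \<in> I" "\<And>r. r \<in> I \<Longrightarrow> M r c = 0"
  shows "pdet I M = 0"
  unfolding pdet_def
proof (intro sum.neutral ballI)
  fix p assume "p \<in> {p. p permutes I}"
  then have p: "p permutes I" by simp
  have "c \<in> p ` I" using assms(2) by (simp add: permutes_image[OF p])
  then obtain r where "r \<in> I" "p r = c" by blast
  then have "(\<Prod>i\<in>I. M i (p i)) = 0" using assms by (intro prod_zero) auto
  then show "of_int (sign p) * (\<Prod>i\<in>I. M i (p i)) = 0" by simp
qed

lemma pdet_row_zero:
  assumes "finite I" "r \<in> I" "\<And>j. j \<in> I \<Longrightarrow> M r j = 0"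
  shows "pdet I M = 0"
  unfolding pdet_def
proof (intro sum.neutral ballI)
  fix p assume "p \<in> {p. p permutes I}"
  then have "M r (p r) = 0" using assms by (simp add: permutes_in_image)
  then have "(\<Prod>i\<in>I. M i (p i)) = 0" using assms(1,2) by (intro prod_zero) auto
  then show "of_int (sign p) * (\<Prod>i\<in>I. M i (p i)) = 0" by simp
qed

lemma pdet_swap_rows:
  assumes "finite I" "r \<in> I" "s \<in> I" "r \<noteq> s"
  shows "pdet I (M(r := M s, s := M r)) = - pdet I M"
proof -
  let ?t = "Transposition.transpose r s"
  have t: "?t permutes I" using assms by (intro permutes_swap_id)
  have M: "M(r := M s, s := M r) = (\<lambda>i. M (?t i))"
    by (auto simp: fun_eq_iff Transposition.transpose_def)
  have "pdet I (\<lambda>i. M (?t i)) =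
      (\<Sum>p | p permutes I. of_int (sign (p \<circ> ?t)) * (\<Prod>i\<in>I. M (?t i) ((p \<circ> ?t) i)))"
    unfolding pdet_def
    by (rule sum.reindex_bij_witness[where i="\<lambda>p. p \<circ> ?t" and j="\<lambda>p. p \<circ> ?t"])
       (use t in \<open>auto simp: comp_assoc intro: permutes_compose\<close>)
  also have "\<dots> = (\<Sum>p | p permutes I. - (of_int (sign p) * (\<Prod>i\<in>I. M i (p i))))"
  proof (intro sum.cong refl)
    fix p assume "p \<in> {p. p permutes I}"
    then have p: "p permutes I" by simp
    have "sign (p \<circ> ?t) = sign p * sign ?t"
      using p t assms(1) by (intro sign_compose) (auto simp: permutation_permutes)
    moreover have "sign ?t = - 1" using assms(4) by (simp add: sign_swap_id)
    moreover have "(\<Prod>i\<in>I. M (?t i) ((p \<circ> ?t) i)) = (\<Prod>i\<in>I. M i (p i))"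
      using prod.reindex_bij_betw[OF permutes_imp_bij[OF t], of "\<lambda>i. M i (p i)"] by simp
    ultimately show "of_int (sign (p \<circ> ?t)) * (\<Prod>i\<in>I. M (?t i) ((p \<circ> ?t) i)) =
        - (of_int (sign p) * (\<Prod>i\<in>I. M i (p i)))" by simp
  qed
  finally show ?thesis unfolding M by (simp add: pdet_def sum_negf)
qed

lemma pdet_equal_rows:
  assumes "finite I" "r \<in> I" "s \<in> I" "r \<noteq> s" "\<And>j. j \<in> I \<Longrightarrow> M r j = M s j"
  shows "pdet I M = 0"
proof -
  have "pdet I M = pdet I (M(r := M s, s := M r))"
    using assms by (intro pdet_cong) auto
  also have "\<dots> = - pdet I M" by (rule pdet_swap_rows[OF assms(1-4)])
  finally show ?thesis by simp
qed

lemma pdet_add_row: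
  assumes "finite I" "r \<in> I" "s \<in> I" "r \<noteq> s"
  shows "pdet I (M(r := \<lambda>j. M r j + c * M s j)) = pdet I M"
proof -
  have "pdet I (M(r := M s)) = 0" using assms by (intro pdet_equal_rows[of I r s]) auto
  then show ?thesis by (subst pdet_row_lincomb[OF assms(1,2)]) simp
qed

text \<open>
  Only the permutations that fix \<open>s\<close> contribute.
\<close>

lemma pdet_unit_row:
  assumes "finite I" "s \<notin> I" "M s s = 1" "\<And>j. j \<in> I \<Longrightarrow> M s j = 0"
  shows "pdet (insert s I) M = pdet I M"
proof -
  let ?f = "\<lambda>p. of_int (sign p) * (\<Prod>i\<in>insert s I. M i (p i))"
  have fin: "finite {p. p permutes insert s I}" using assms(1) by (intro finite_permutations) auto
  have "pdet (insert s I) M = (\<Sum>p | p permutes I. ?f p)"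
    unfolding pdet_def
  proof (rule sum.mono_neutral_right[OF fin])
    show "{p. p permutes I} \<subseteq> {p. p permutes insert s I}" by (auto intro: permutes_subset)
    show "\<forall>p\<in>{p. p permutes insert s I} - {p. p permutes I}. ?f p = 0"
    proof
      fix p assume "p \<in> {p. p permutes insert s I} - {p. p permutes I}"
      then have p: "p permutes insert s I" "\<not> p permutes I" by auto
      have "p s \<noteq> s"
      proof
        assume "p s = s"
        have "p permutes insert s I - {s}"
          by (rule permutes_superset[OF p(1)]) (use \<open>p s = s\<close> in auto)
        then show False using p(2) assms(2) by simp
      qed
      then have "p s \<in> I" using p(1) permutes_in_image[OF p(1), of s] by auto
      then show "?f p = 0" using assms by simp
    qed
  qed
  also have "\<dots> = pdet I M" unfolding pdet_def
  proof (intro sum.cong refl)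
    fix p assume "p \<in> {p. p permutes I}"
    then have "p s = s" using assms(2) permutes_not_in by fastforce
    then show "?f p = of_int (sign p) * (\<Prod>i\<in>I. M i (p i))" using assms by simp
  qed
  finally show ?thesis .
qed

lemma det_mat_eq_pdet: "Determinant.det (Matrix.mat n n (\<lambda>(i, j). M i j)) = pdet {..<n} M"
proof -
  have "Determinant.det (Matrix.mat n n (\<lambda>(i, j). M i j)) =
     (\<Sum>p | p permutes {0..<n}. signof p * (\<Prod>i = 0..<n. M i (p i)))"
    unfolding det_def'[OF mat_carrier]
    by (intro sum.cong refl arg_cong2[where f="(*)"] prod.cong) (auto simp: permutes_in_image)
  then show ?thesis by (simp add: pdet_def atLeast0LessThan)
qed

lemma pdet_bound:
  assumes "finite I" "\<And>i j. i \<in> I \<Longrightarrow> j \<in> I \<Longrightarrow> \<bar>M i j\<bar> \<le> a i * b j" 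
    "\<And>i. i \<in> I \<Longrightarrow> 0 \<le> a i" "\<And>i. i \<in> I \<Longrightarrow> 0 \<le> b i"
  shows "\<bar>pdet I M\<bar> \<le> fact (card I) * (\<Prod>i\<in>I. a i * b i)"
proof -
  have "\<bar>pdet I M\<bar> \<le> (\<Sum>p | p permutes I. \<bar>of_int (sign p) * (\<Prod>i\<in>I. M i (p i))\<bar>)"
    unfolding pdet_def by (rule sum_abs)
  also have "\<dots> \<le> (\<Sum>p | p permutes I. \<Prod>i\<in>I. a i * b i)"
  proof (intro sum_mono)
    fix p assume "p \<in> {p. p permutes I}"
    then have p: "p permutes I" by simp
    have "\<bar>of_int (sign p) * (\<Prod>i\<in>I. M i (p i))\<bar> = (\<Prod>i\<in>I. \<bar>M i (p i)\<bar>)"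
      by (simp add: abs_mult abs_prod sign_def)
    also have "\<dots> \<le> (\<Prod>i\<in>I. a i * b (p i))"
      using p assms by (intro prod_mono) (auto simp: permutes_in_image)
    also have "\<dots> = (\<Prod>i\<in>I. a i) * (\<Prod>i\<in>I. b (p i))" by (simp add: prod.distrib)
    also have "(\<Prod>i\<in>I. b (p i)) = (\<Prod>i\<in>I. b i)"
      by (rule prod.reindex_bij_betw[OF permutes_imp_bij[OF p]])
    finally show "\<bar>of_int (sign p) * (\<Prod>i\<in>I. M i (p i))\<bar> \<le> (\<Prod>i\<in>I. a i * b i)"
      by (simp add: prod.distrib)
  qed
  also have "\<dots> = fact (card I) * (\<Prod>i\<in>I. a i * b i)"
    using assms(1) by (simp add: card_permutations[OF refl])
  finally show ?thesis .
qed

lemma pdet_triangular: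
  assumes "\<And>i j. i < j \<Longrightarrow> j < n \<Longrightarrow> M i j = 0"
  shows "pdet {..<n} M = (\<Prod>i<n. M i i)"
proof -
  have "Determinant.det (Matrix.mat n n (\<lambda>(i, j). M i j)) = prod_list (diag_mat (Matrix.mat n n (\<lambda>(i, j). M i j)))"
    using assms by (intro det_lower_triangular[of n]) auto
  also have "\<dots> = (\<Prod>i<n. M i i)"
    by (simp add: prod_list_diag_prod atLeast0LessThan)
  finally show ?thesis by (simp add: det_mat_eq_pdet)
qed

lemma pdet_mult: "pdet {..<n} (\<lambda>i j. \<Sum>k<n. A i k * B k j) = pdet {..<n} A * pdet {..<n} B"
proof -
  have "Matrix.mat n n (\<lambda>(i, j). \<Sum>k<n. A i k * B k j) =
      Matrix.mat n n (\<lambda>(i, j). A i j) * Matrix.mat n n (\<lambda>(i, j). B i j)"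
    by (rule eq_matI) (auto simp: scalar_prod_def atLeast0LessThan)
  then have "Determinant.det (Matrix.mat n n (\<lambda>(i, j). \<Sum>k<n. A i k * B k j)) =
     Determinant.det (Matrix.mat n n (\<lambda>(i, j). A i j)) * Determinant.det (Matrix.mat n n (\<lambda>(i, j). B i j))"
    by (simp only: det_mult[OF mat_carrier mat_carrier])
  then show ?thesis by (simp add: det_mat_eq_pdet)
qed

lemma pdet_transpose: "pdet {..<n} (\<lambda>i j. M j i) = pdet {..<n} M"
proof -
  have "Matrix.mat n n (\<lambda>(i, j). M j i) = transpose_mat (Matrix.mat n n (\<lambda>(i, j). M i j))"
    by (rule eq_matI) auto
  then have "Determinant.det (Matrix.mat n n (\<lambda>(i, j). M j i)) = Determinant.det (Matrix.mat n n (\<lambda>(i, j). M i j))"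
    by (simp only: det_transpose[OF mat_carrier])
  then show ?thesis by (simp add: det_mat_eq_pdet)
qed

text \<open>
  Both the passage between bases of monic polynomials and the row operations on ordered points are
  multiplications by a unitriangular matrix.
\<close>

lemma pdet_unitriangular_rows:
  assumes "\<And>i j. i < n \<Longrightarrow> j < n \<Longrightarrow> M' i j = (\<Sum>k\<le>i. L i k * M k j)" and "\<And>i. i < n \<Longrightarrow> L i i = 1"
  shows "pdet {..<n} M' = pdet {..<n} M"
proof -
  let ?L = "\<lambda>i k. if k \<le> i then L i k else 0"
  have "pdet {..<n} M' = pdet {..<n} (\<lambda>i j. \<Sum>k<n. ?L i k * M k j)"
  proof (rule pdet_cong)
    fix i j assume "i \<in> {..<n}" "j \<in> {..<n}"
    then have "(\<Sum>k<n. ?L i k * M k j) = (\<Sum>k\<le>i. ?L i k * M k j)"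
      by (intro sum.mono_neutral_right) auto
    then show "M' i j = (\<Sum>k<n. ?L i k * M k j)"
      using assms(1) \<open>i \<in> _\<close> \<open>j \<in> _\<close> by simp
  qed
  also have "\<dots> = pdet {..<n} ?L * pdet {..<n} M" by (rule pdet_mult)
  also have "pdet {..<n} ?L = (\<Prod>i<n. ?L i i)" by (rule pdet_triangular) auto
  finally show ?thesis using assms(2) by simp
qed

lemma pdet_unitriangular_columns:
  assumes "\<And>i j. i < n \<Longrightarrow> j < n \<Longrightarrow> M' i j = (\<Sum>k\<le>j. c j k * M i k)" and "\<And>j. j < n \<Longrightarrow> c j j = 1"
  shows "pdet {..<n} M' = pdet {..<n} M"
proof -
  have "pdet {..<n} (\<lambda>i j. M' j i) = pdet {..<n} (\<lambda>i j. M j i)"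
    using assms by (intro pdet_unitriangular_rows[of n _ c]) auto
  then show ?thesis by (simp only: pdet_transpose[of n M] pdet_transpose[of n M'])
qed

text \<open>
  The monomials may be replaced by the Newton polynomials $\prod_{i<l} (t - x_i)$, which are monic and
  make the matrix triangular.
\<close>

lemma vandermonde_eq_pdet:
  "vandermonde d x = pdet {..<d} (\<lambda>k l. x (Suc k) ^ l)"
proof -
  define q :: "nat \<Rightarrow> real poly" where "q l = (\<Prod>i<l. [:- x (Suc i), 1:])" for l
  have deg: "degree (q l) = l" for l
    unfolding q_def by (subst degree_prod_eq_sum_degree) auto
  have lead: "coeff (q l) l = 1" for l
  proof -
    have "lead_coeff (q l) = 1" unfolding q_def by (simp add: lead_coeff_prod)
    then show ?thesis by (simp add: deg)
  qed
  have poly: "poly (q l) t = (\<Prod>i<l. t - x (Suc i))" for l t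
    by (simp add: q_def poly_prod)
  have "pdet {..<d} (\<lambda>k l. poly (q l) (x (Suc k))) = pdet {..<d} (\<lambda>k l. x (Suc k) ^ l)"
    by (rule pdet_unitriangular_columns[where c="\<lambda>l i. coeff (q l) i"])
       (simp_all only: poly_altdef deg lead)
  moreover have "pdet {..<d} (\<lambda>k l. poly (q l) (x (Suc k))) = (\<Prod>k<d. poly (q k) (x (Suc k)))"
    by (rule pdet_triangular) (auto simp: poly)
  moreover have "(\<Prod>k<d. poly (q k) (x (Suc k))) = vandermonde d x"
  proof -
    have "vandermonde d x = (\<Prod>k<d. \<Prod>i\<in>{1..<Suc k}. x (Suc k) - x i)"
      unfolding vandermonde_def
      by (rule prod.reindex_bij_witness[where i="Suc" and j="\<lambda>j. j - 1"]) auto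
    also have "\<dots> = (\<Prod>k<d. poly (q k) (x (Suc k)))"
    proof (intro prod.cong refl)
      fix k
      show "(\<Prod>i\<in>{1..<Suc k}. x (Suc k) - x i) = poly (q k) (x (Suc k))"
        unfolding poly
        by (rule prod.reindex_bij_witness[where i="Suc" and j="\<lambda>j. j - 1"]) auto
    qed
    finally show ?thesis by simp
  qed
  ultimately show ?thesis by simp
qed

text \<open>
  The bordered matrix is the product of a block lower triangular matrix, with diagonal blocks \<open>A\<close> and
  \<open>- L\<close>, and a block upper triangular one with unit diagonal. So a determinant that contains the
  inverse of \<open>A\<close> is one of a matrix whose entries are known.
\<close>

lemma schur_bordered:
  fixes A B :: "real mat" and \<Phi> \<Psi> V L :: "nat \<Rightarrow> nat \<Rightarrow> real"
  assumes A: "A \<in> carrier_mat d d" and B: "B \<in> carrier_mat d d" and AB: "A * B = 1\<^sub>m d"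
    and L: "\<And>s t. s < k \<Longrightarrow> t < k \<Longrightarrow> L s t = - V s t + (\<Sum>p<d. \<Sum>l<d. \<Psi> s p * B $$ (p, l) * \<Phi> l t)"
  shows "pdet {..<d + k} (\<lambda>r c. if r < d then (if c < d then A $$ (r, c) else \<Phi> r (c - d))
      else (if c < d then \<Psi> (r - d) c else V (r - d) (c - d))) =
    (- 1) ^ k * Determinant.det A * pdet {..<k} L"
proof -
  define P where "P = Matrix.mat d k (\<lambda>(r, s). \<Phi> r s)"
  define Q where "Q = Matrix.mat k d (\<lambda>(s, c). \<Psi> s c)"
  define W where "W = Matrix.mat k k (\<lambda>(s, t). V s t)"
  define M where "M = Matrix.mat k k (\<lambda>(s, t). - L s t)"
  have carr: "P \<in> carrier_mat d k" "Q \<in> carrier_mat k d" "W \<in> carrier_mat k k" "M \<in> carrier_mat k k"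
    by (simp_all add: P_def Q_def W_def M_def)
  have "four_block_mat A (0\<^sub>m d k) Q M * four_block_mat (1\<^sub>m d) (B * P) (0\<^sub>m k d) (1\<^sub>m k) =
     four_block_mat (A * 1\<^sub>m d + 0\<^sub>m d k * 0\<^sub>m k d) (A * (B * P) + 0\<^sub>m d k * 1\<^sub>m k)
       (Q * 1\<^sub>m d + M * 0\<^sub>m k d) (Q * (B * P) + M * 1\<^sub>m k)"
    by (rule mult_four_block_mat) (use A B carr in auto)
  also have "A * 1\<^sub>m d + 0\<^sub>m d k * 0\<^sub>m k d = A" using A by simp
  also have "A * (B * P) + 0\<^sub>m d k * 1\<^sub>m k = P"
  proof -
    have "A * (B * P) = (A * B) * P" using A B carr by (intro assoc_mult_mat[symmetric]) auto
    then show ?thesis using AB carr by simp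
  qed
  also have "Q * 1\<^sub>m d + M * 0\<^sub>m k d = Q" using carr by simp
  also have "Q * (B * P) + M * 1\<^sub>m k = W"
  proof (rule eq_matI)
    fix s t assume "s < dim_row W" "t < dim_col W"
    then have st: "s < k" "t < k" by (simp_all add: W_def)
    have BP: "(B * P) $$ (p, t) = (\<Sum>l<d. B $$ (p, l) * \<Phi> l t)" if "p < d" for p
      using that B st by (simp add: P_def scalar_prod_def atLeast0LessThan)
    have "(Q * (B * P)) $$ (s, t) = (\<Sum>p<d. \<Psi> s p * (B * P) $$ (p, t))"
      using st B carr by (simp add: Q_def scalar_prod_def atLeast0LessThan)
    also have "\<dots> = (\<Sum>p<d. \<Sum>l<d. \<Psi> s p * B $$ (p, l) * \<Phi> l t)"
      by (intro sum.cong refl) (simp add: BP sum_distrib_left mult.assoc)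
    finally show "(Q * (B * P) + M * 1\<^sub>m k) $$ (s, t) = W $$ (s, t)"
      using st carr B by (simp add: W_def M_def L)
  qed (use carr B in auto)
  finally have prod: "four_block_mat A P Q W =
      four_block_mat A (0\<^sub>m d k) Q M * four_block_mat (1\<^sub>m d) (B * P) (0\<^sub>m k d) (1\<^sub>m k)" by simp
  have "Determinant.det (four_block_mat A P Q W) =
      Determinant.det (four_block_mat A (0\<^sub>m d k) Q M) * Determinant.det (four_block_mat (1\<^sub>m d) (B * P) (0\<^sub>m k d) (1\<^sub>m k))"
    unfolding prod by (rule det_mult[of _ "d + k"]) (use A B carr in auto)
  also have "Determinant.det (four_block_mat A (0\<^sub>m d k) Q M) = Determinant.det A * Determinant.det M"
    by (rule det_four_block_mat_upper_right_zero[OF A refl carr(2,4)])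
  also have "Determinant.det (four_block_mat (1\<^sub>m d) (B * P) (0\<^sub>m k d) (1\<^sub>m k)) = 1"
    using B carr by (subst det_four_block_mat_lower_left_zero) auto
  also have "Determinant.det M = pdet {..<k} (\<lambda>s t. (- 1) * L s t * 1)"
    unfolding M_def by (simp add: det_mat_eq_pdet)
  also have "\<dots> = (- 1) ^ k * pdet {..<k} L" by (subst pdet_scale) simp_all
  also have "Determinant.det (four_block_mat A P Q W) =
    pdet {..<d + k} (\<lambda>r c. if r < d then (if c < d then A $$ (r, c) else \<Phi> r (c - d))
      else (if c < d then \<Psi> (r - d) c else V (r - d) (c - d)))"
  proof -
    have "four_block_mat A P Q W = Matrix.mat (d + k) (d + k) (\<lambda>(r, c).
      (\<lambda>r c. if r < d then (if c < d then A $$ (r, c) else \<Phi> r (c - d))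
      else (if c < d then \<Psi> (r - d) c else V (r - d) (c - d))) r c)"
      using A by (intro eq_matI) (auto simp: P_def Q_def W_def)
    then show ?thesis by (simp only: det_mat_eq_pdet)
  qed
  finally show ?thesis by simp
qed

lemma invertible_mat_det:
  fixes A :: "real mat"
  assumes A: "A \<in> carrier_mat d d" and "Determinant.det A \<noteq> 0"
  shows "invertible_mat A"
proof -
  have "A \<in> Units (ring_mat TYPE(real) d ())" by (rule det_non_zero_imp_unit[OF assms])
  then obtain B where B: "B \<in> carrier_mat d d" "B * A = 1\<^sub>m d" "A * B = 1\<^sub>m d"
    unfolding Units_def ring_mat_def by auto
  then have "inverts_mat A B" "inverts_mat B A" using A unfolding inverts_mat_def by auto
  then show ?thesis unfolding invertible_mat_def square_mat.simps using A by auto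
qed

section \<open>Averages over exponential and gamma variables\<close>

text \<open>
  This is the law of \<open>k + 1\<close> summands; \<open>gamma_law 0\<close> is exponential.
\<close>

abbreviation gamma_law :: "nat \<Rightarrow> real measure" where
  "gamma_law k \<equiv> density lborel (\<lambda>s. ennreal (erlang_density k 1 s))"

definition exp_step :: "(real \<Rightarrow> real) \<Rightarrow> real \<Rightarrow> real" where
  "exp_step v y = (\<integral>s. v (y + s) \<partial>gamma_law 0)"

text \<open>
  A class of functions that contains the polynomials, is preserved by averaging over exponential
  variables, and consists of integrable functions: $e^{|y|/2}$ is integrable against $e^{-y}$.
\<close>

definition half_exp_bounded :: "(real \<Rightarrow> real) \<Rightarrow> bool" where
  "half_exp_bounded v \<longleftrightarrow> v \<in> borel_measurable borel \<and> (\<exists>C. \<forall>y. \<bar>v y\<bar> \<le> C * exp (\<bar>y\<bar> / 2))"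

lemma gamma_law_prob: "prob_space (gamma_law k)"
  by (rule prob_space_erlang_density) simp

lemma half_exp_boundedI:
  "v \<in> borel_measurable borel \<Longrightarrow> (\<And>y. \<bar>v y\<bar> \<le> C * exp (\<bar>y\<bar> / 2)) \<Longrightarrow> half_exp_bounded v"
  unfolding half_exp_bounded_def by blast

lemma half_exp_bounded_measurable: "half_exp_bounded v \<Longrightarrow> v \<in> borel_measurable borel"
  unfolding half_exp_bounded_def by blast

lemma half_exp_boundedE:
  assumes "half_exp_bounded v"
  obtains C where "0 \<le> C" "\<And>y. \<bar>v y\<bar> \<le> C * exp (\<bar>y\<bar> / 2)"
proof -
  obtain C where C: "\<And>y. \<bar>v y\<bar> \<le> C * exp (\<bar>y\<bar> / 2)" using assms unfolding half_exp_bounded_def by blast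
  have "0 \<le> C" using C[of 0] by simp
  then show thesis using C that by blast
qed

lemma half_exp_bounded_constants:
  fixes v :: "'i \<Rightarrow> 'j \<Rightarrow> real \<Rightarrow> real"
  assumes "\<And>k l. half_exp_bounded (v k l)"
  obtains C where "\<And>k l. 0 \<le> C k l" "\<And>k l u. \<bar>v k l u\<bar> \<le> C k l * exp (\<bar>u\<bar> / 2)"
proof -
  let ?P = "\<lambda>k l C. 0 \<le> C \<and> (\<forall>u. \<bar>v k l u\<bar> \<le> C * exp (\<bar>u\<bar> / 2))"
  have ex: "\<exists>C. ?P k l C" for k l
    by (rule half_exp_boundedE[OF assms[of k l]]) blast
  have "?P k l (SOME C. ?P k l C)" for k l by (rule someI_ex[OF ex])
  then show thesis by (intro that[of "\<lambda>k l. SOME C. ?P k l C"]) auto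
qed

lemma half_exp_bounded_add:
  assumes "half_exp_bounded v" "half_exp_bounded w"
  shows "half_exp_bounded (\<lambda>y. v y + w y)"
proof -
  obtain C D where C: "\<And>y. \<bar>v y\<bar> \<le> C * exp (\<bar>y\<bar> / 2)" and D: "\<And>y. \<bar>w y\<bar> \<le> D * exp (\<bar>y\<bar> / 2)"
    using half_exp_boundedE[OF assms(1)] half_exp_boundedE[OF assms(2)] by metis
  note [measurable] = assms[THEN half_exp_bounded_measurable]
  show ?thesis
  proof (rule half_exp_boundedI[of _ "C + D"])
    fix y show "\<bar>v y + w y\<bar> \<le> (C + D) * exp (\<bar>y\<bar> / 2)"
      using C[of y] D[of y] by (simp add: distrib_right)
  qed measurable
qed

lemma half_exp_bounded_mult:
  assumes "half_exp_bounded v" "g \<in> borel_measurable borel" "\<And>y. \<bar>g y\<bar> \<le> B"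
  shows "half_exp_bounded (\<lambda>y. g y * v y)"
proof -
  obtain C where C: "0 \<le> C" "\<And>y. \<bar>v y\<bar> \<le> C * exp (\<bar>y\<bar> / 2)"
    using half_exp_boundedE[OF assms(1)] by metis
  note [measurable] = assms(1)[THEN half_exp_bounded_measurable] assms(2)
  have B: "0 \<le> B" using assms(3)[of 0] by linarith
  show ?thesis
  proof (rule half_exp_boundedI[of _ "B * C"])
    fix y show "\<bar>g y * v y\<bar> \<le> B * C * exp (\<bar>y\<bar> / 2)"
      using mult_mono[OF assms(3)[of y] C(2)[of y] B] by (simp add: abs_mult mult.assoc)
  qed measurable
qed

lemma half_exp_bounded_cmult: "half_exp_bounded v \<Longrightarrow> half_exp_bounded (\<lambda>y. c * v y)"
  by (rule half_exp_bounded_mult[where B="\<bar>c\<bar>"]) auto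

lemma half_exp_bounded_diff:
  "half_exp_bounded v \<Longrightarrow> half_exp_bounded w \<Longrightarrow> half_exp_bounded (\<lambda>y. v y - w y)"
  using half_exp_bounded_add[of v "\<lambda>y. (- 1) * w y"] half_exp_bounded_cmult[of w "-1"] by simp

lemma half_exp_bounded_zero: "half_exp_bounded (\<lambda>y. 0)"
  by (rule half_exp_boundedI[of _ 0]) auto

lemma half_exp_bounded_indicator:
  "half_exp_bounded v \<Longrightarrow> A \<in> sets borel \<Longrightarrow> half_exp_bounded (\<lambda>y. indicator A y * v y)"
  by (rule half_exp_bounded_mult[where B=1]) (auto split: split_indicator)

lemma power_le_exp: "0 \<le> (x::real) \<Longrightarrow> x ^ n / fact n \<le> exp x"
proof -
  assume x: "0 \<le> x"
  have s: "(\<lambda>n. x ^ n / fact n) sums exp x" using exp_converges[of x] by (simp add: field_simps)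
  have "(\<Sum>i\<in>{n}. x ^ i / fact i) \<le> (\<Sum>i. x ^ i / fact i)"
    using x s by (intro sum_le_suminf) (auto simp: sums_iff)
  then show ?thesis using s by (simp add: sums_iff)
qed

lemma half_exp_bounded_power: "half_exp_bounded (\<lambda>y. y ^ l)"
proof (rule half_exp_boundedI[of _ "2 ^ l * fact l"])
  fix y :: real
  have "(\<bar>y\<bar> / 2) ^ l / fact l \<le> exp (\<bar>y\<bar> / 2)" by (rule power_le_exp) simp
  then show "\<bar>y ^ l\<bar> \<le> 2 ^ l * fact l * exp (\<bar>y\<bar> / 2)"
    by (simp add: field_simps power_abs)
qed simp

lemma integrable_exp_half: "integrable (gamma_law k) (\<lambda>s. exp (\<bar>s\<bar> / 2))"
proof -
  interpret P: prob_space "density lborel (\<lambda>s. ennreal (erlang_density k (1/2) s))"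
    by (rule prob_space_erlang_density) simp
  have "integrable (density lborel (\<lambda>s. ennreal (erlang_density k (1/2) s))) (\<lambda>_. 1 :: real)"
    by simp
  then have "integrable lborel (\<lambda>s. erlang_density k (1/2) s)"
    by (subst (asm) integrable_density) auto
  then have "integrable lborel (\<lambda>s. 2 ^ Suc k * erlang_density k (1/2) s)" by simp
  also have "(\<lambda>s. 2 ^ Suc k * erlang_density k (1/2) s) = (\<lambda>s. erlang_density k 1 s * exp (\<bar>s\<bar> / 2))"
    by (auto simp: fun_eq_iff erlang_density_def power_divide exp_add[symmetric] field_simps)
  finally show ?thesis by (subst integrable_density) auto
qed

text \<open>
  The bound splits into a factor for the position and one for the increment, so that products over
  independent increments can be integrated.
\<close>

lemma half_exp_shift_bound:
  fixes v :: "real \<Rightarrow> real"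
  assumes "\<And>y. \<bar>v y\<bar> \<le> C * exp (\<bar>y\<bar> / 2)" "0 \<le> C"
  shows "\<bar>v (y + s)\<bar> \<le> C * exp (\<bar>y\<bar> / 2) * exp (\<bar>s\<bar> / 2)"
proof -
  have "\<bar>v (y + s)\<bar> \<le> C * exp (\<bar>y + s\<bar> / 2)" by (rule assms)
  also have "\<dots> \<le> C * exp (\<bar>y\<bar> / 2 + \<bar>s\<bar> / 2)"
    using assms(2) by (intro mult_left_mono) auto
  finally show ?thesis by (simp add: exp_add)
qed

lemma half_exp_bounded_integrable:
  assumes "half_exp_bounded v"
  shows "integrable (gamma_law k) (\<lambda>s. v (y + s))"
proof -
  obtain C where C: "0 \<le> C" "\<And>y. \<bar>v y\<bar> \<le> C * exp (\<bar>y\<bar> / 2)"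
    using half_exp_boundedE[OF assms] by metis
  note [measurable] = assms[THEN half_exp_bounded_measurable]
  have "integrable (gamma_law k) (\<lambda>s. C * exp (\<bar>y\<bar> / 2) * exp (\<bar>s\<bar> / 2))"
    by (intro integrable_mult_right integrable_exp_half)
  then show ?thesis
  proof (rule Bochner_Integration.integrable_bound)
    show "AE s in gamma_law k. norm (v (y + s)) \<le> norm (C * exp (\<bar>y\<bar> / 2) * exp (\<bar>s\<bar> / 2))"
      using half_exp_shift_bound[OF C(2) C(1), of y] C(1) by (intro AE_I2) (simp add: abs_mult)
  qed measurable
qed

lemma half_exp_bounded_exp_step:
  assumes "half_exp_bounded v"
  shows "half_exp_bounded (exp_step v)"
proof -
  obtain C where C: "0 \<le> C" "\<And>y. \<bar>v y\<bar> \<le> C * exp (\<bar>y\<bar> / 2)"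
    using half_exp_boundedE[OF assms] by metis
  note [measurable] = assms[THEN half_exp_bounded_measurable]
  interpret P: prob_space "gamma_law 0" by (rule gamma_law_prob)
  let ?K = "\<integral>s. exp (\<bar>s\<bar> / 2) \<partial>gamma_law 0"
  show ?thesis
  proof (rule half_exp_boundedI[of _ "C * ?K"])
    show "exp_step v \<in> borel_measurable borel"
      unfolding exp_step_def[abs_def] by measurable
    fix y
    have "\<bar>exp_step v y\<bar> \<le> (\<integral>s. \<bar>v (y + s)\<bar> \<partial>gamma_law 0)"
      unfolding exp_step_def by (rule integral_abs_bound)
    also have "\<dots> \<le> (\<integral>s. C * exp (\<bar>y\<bar> / 2) * exp (\<bar>s\<bar> / 2) \<partial>gamma_law 0)"
      by (intro integral_mono integrable_abs half_exp_bounded_integrable[OF assms]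
          integrable_mult_right integrable_exp_half half_exp_shift_bound[OF C(2) C(1)])
    finally show "\<bar>exp_step v y\<bar> \<le> C * ?K * exp (\<bar>y\<bar> / 2)" by (simp add: mult_ac)
  qed
qed

lemma exp_step_cong:
  assumes "v \<in> borel_measurable borel" "w \<in> borel_measurable borel" "\<And>u. y \<le> u \<Longrightarrow> v u = w u"
  shows "exp_step v y = exp_step w y"
  unfolding exp_step_def using assms
  by (subst (1 2) integral_density) (auto simp: erlang_density_def intro!: Bochner_Integration.integral_cong)

lemma exp_step_singleton:
  assumes "v \<in> borel_measurable borel"
  shows "exp_step (\<lambda>u. indicator {a} u * v u) y = 0"
proof -
  note [measurable] = assms
  have "exp_step (\<lambda>u. indicator {a} u * v u) y = (\<integral>s. erlang_density 0 1 s * (indicator {a} (y + s) * v (y + s)) \<partial>lborel)"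
    unfolding exp_step_def by (subst integral_density) auto
  also have "\<dots> = (\<integral>s. 0 \<partial>(lborel :: real measure))"
  proof (rule integral_cong_AE)
    show "AE s in lborel. erlang_density 0 1 s * (indicator {a} (y + s) * v (y + s)) = 0"
      using AE_lborel_singleton[of "a - y"] by eventually_elim (auto split: split_indicator)
  qed measurable
  finally show ?thesis by simp
qed

lemma half_exp_bounded_funpow:
  "half_exp_bounded v \<Longrightarrow> half_exp_bounded ((exp_step ^^ n) v)"
  by (induction n) (auto intro: half_exp_bounded_exp_step)

lemma exp_step_sum:
  assumes "\<And>i. i \<in> I \<Longrightarrow> half_exp_bounded (v i)"
  shows "exp_step (\<lambda>y. \<Sum>i\<in>I. c i * v i y) = (\<lambda>y. \<Sum>i\<in>I. c i * exp_step (v i) y)"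
proof
  fix y
  have "exp_step (\<lambda>y. \<Sum>i\<in>I. c i * v i y) y = (\<Sum>i\<in>I. \<integral>s. c i * v i (y + s) \<partial>gamma_law 0)"
    unfolding exp_step_def
    by (intro Bochner_Integration.integral_sum integrable_mult_right half_exp_bounded_integrable assms)
  then show "exp_step (\<lambda>y. \<Sum>i\<in>I. c i * v i y) y = (\<Sum>i\<in>I. c i * exp_step (v i) y)"
    by (simp add: exp_step_def)
qed

lemma funpow_exp_step_sum:
  assumes "\<And>i. i \<in> I \<Longrightarrow> half_exp_bounded (v i)"
  shows "(exp_step ^^ n) (\<lambda>y. \<Sum>i\<in>I. c i * v i y) = (\<lambda>y. \<Sum>i\<in>I. c i * (exp_step ^^ n) (v i) y)"
proof (induction n)
  case (Suc n)
  have "(exp_step ^^ Suc n) (\<lambda>y. \<Sum>i\<in>I. c i * v i y) = exp_step (\<lambda>y. \<Sum>i\<in>I. c i * (exp_step ^^ n) (v i) y)"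
    by (simp add: Suc)
  also have "\<dots> = (\<lambda>y. \<Sum>i\<in>I. c i * exp_step ((exp_step ^^ n) (v i)) y)"
    by (intro exp_step_sum half_exp_bounded_funpow assms)
  finally show ?case by simp
qed simp

lemma funpow_exp_step_diff:
  assumes "half_exp_bounded v" "half_exp_bounded w"
  shows "(exp_step ^^ n) (\<lambda>y. v y - w y) = (\<lambda>y. (exp_step ^^ n) v y - (exp_step ^^ n) w y)"
proof -
  have "(exp_step ^^ n) (\<lambda>y. \<Sum>b\<in>UNIV. (if b then 1 else - 1) * (if b then v else w) y) =
     (\<lambda>y. \<Sum>b\<in>UNIV. (if b then 1 else - 1) * (exp_step ^^ n) (if b then v else w) y)"
    using assms by (intro funpow_exp_step_sum) auto
  then show ?thesis by (simp add: UNIV_bool)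
qed

lemma exp_step_diff_scaled:
  assumes "half_exp_bounded v" "half_exp_bounded w"
  shows "exp_step (\<lambda>u. v u - c * w u) = (\<lambda>y. exp_step v y - c * exp_step w y)"
proof
  fix y show "exp_step (\<lambda>u. v u - c * w u) y = exp_step v y - c * exp_step w y"
    unfolding exp_step_def using assms
    by (subst Bochner_Integration.integral_diff)
       (auto intro!: integrable_mult_right half_exp_bounded_integrable)
qed

lemma funpow_exp_step_diff_scaled:
  assumes "half_exp_bounded v" "half_exp_bounded w"
  shows "(exp_step ^^ n) (\<lambda>u. v u - c * w u) = (\<lambda>y. (exp_step ^^ n) v y - c * (exp_step ^^ n) w y)"
proof (induction n)
  case (Suc n)
  have "(exp_step ^^ Suc n) (\<lambda>u. v u - c * w u) = exp_step (\<lambda>y. (exp_step ^^ n) v y - c * (exp_step ^^ n) w y)"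
    by (simp add: Suc)
  also have "\<dots> = (\<lambda>y. (exp_step ^^ Suc n) v y - c * (exp_step ^^ Suc n) w y)"
    using assms by (subst exp_step_diff_scaled) (auto intro: half_exp_bounded_funpow)
  finally show ?case .
qed simp

text \<open>
  A variable that exceeds $t - y$ starts afresh there; this happens with probability $e^{y-t}$.
\<close>

lemma exp_step_memoryless:
  assumes v: "half_exp_bounded v" and "y \<le> t"
  shows "exp_step (\<lambda>u. indicator {..t} u * v u) y = exp_step v y - exp (y - t) * exp_step v t"
proof -
  note [measurable] = v[THEN half_exp_bounded_measurable]
  have i: "half_exp_bounded (\<lambda>u. indicator {..t} u * v u)" by (intro half_exp_bounded_indicator v) simp
  have "exp_step v y - exp_step (\<lambda>u. indicator {..t} u * v u) y =
      (\<integral>s. v (y + s) - indicator {..t} (y + s) * v (y + s) \<partial>gamma_law 0)"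
    unfolding exp_step_def
    by (intro Bochner_Integration.integral_diff[symmetric] half_exp_bounded_integrable v half_exp_bounded_integrable[OF i])
  also have "\<dots> = (\<integral>s. indicator {t<..} (y + s) * v (y + s) \<partial>gamma_law 0)"
    by (intro Bochner_Integration.integral_cong) (auto split: split_indicator)
  also have "\<dots> = (\<integral>s. erlang_density 0 1 s * (indicator {t<..} (y + s) * v (y + s)) \<partial>lborel)"
    by (subst integral_density) auto
  also have "\<dots> = (\<integral>s. erlang_density 0 1 ((t - y) + s) * (indicator {t<..} (t + s) * v (t + s)) \<partial>lborel)"
    by (subst lborel_integral_real_affine[where c=1 and t="t - y"]) (auto simp: algebra_simps)
  also have "\<dots> = (\<integral>s. exp (y - t) * (erlang_density 0 1 s * v (t + s)) \<partial>lborel)"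
  proof (rule integral_cong_AE)
    show "AE s in lborel. erlang_density 0 1 (t - y + s) * (indicator {t<..} (t + s) * v (t + s)) =
         exp (y - t) * (erlang_density 0 1 s * v (t + s))"
      using AE_lborel_singleton[of 0]
    proof eventually_elim
      case (elim s)
      then show ?case using \<open>y \<le> t\<close>
        by (cases "s < 0") (auto simp: erlang_density_def exp_add[symmetric] algebra_simps split: split_indicator)
    qed
  qed measurable
  also have "\<dots> = exp (y - t) * exp_step v t"
    unfolding exp_step_def by (subst integral_density) auto
  finally show ?thesis by simp
qed

lemma gamma_law_Suc: "gamma_law (Suc k) = distr (gamma_law 0 \<Otimes>\<^sub>M gamma_law k) borel (\<lambda>(a, b). a + b)"
proof -
  have f: "finite_measure (gamma_law j)" for j
    using gamma_law_prob prob_space.finite_measure by blast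
  have "distr (gamma_law 0 \<Otimes>\<^sub>M gamma_law k) borel (\<lambda>(a, b). a + b) = convolution (gamma_law 0) (gamma_law k)"
    by (simp add: convolution_def)
  also have "\<dots> = density lborel (\<lambda>x. \<integral>\<^sup>+y. ennreal (erlang_density 0 1 (x - y)) * ennreal (erlang_density k 1 y) \<partial>lborel)"
    by (intro convolution_density f) auto
  also have "\<dots> = gamma_law (Suc k)"
    by (subst convolution_erlang_density) auto
  finally show ?thesis by simp
qed

text \<open>
  A Gamma variable is a sum of independent exponential ones, so averages over it are iterated averages.
\<close>

lemma gamma_law_integral:
  assumes v: "half_exp_bounded v"
  shows "(\<integral>s. v (y + s) \<partial>gamma_law k) = (exp_step ^^ Suc k) v y"
proof (induction k arbitrary: y)
  case 0
  then show ?case by (simp add: exp_step_def)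
next
  case (Suc k)
  note [measurable] = v[THEN half_exp_bounded_measurable]
  interpret A: prob_space "gamma_law 0" by (rule gamma_law_prob)
  interpret B: prob_space "gamma_law k" by (rule gamma_law_prob)
  interpret AB: pair_sigma_finite "gamma_law 0" "gamma_law k" ..
  have "integrable (gamma_law (Suc k)) (\<lambda>s. v (y + s))" by (rule half_exp_bounded_integrable[OF v])
  then have int: "integrable (gamma_law 0 \<Otimes>\<^sub>M gamma_law k) (\<lambda>(a, b). v (y + (a + b)))"
    unfolding gamma_law_Suc by (subst (asm) integrable_distr_eq) (auto simp: split_def)
  have "(\<integral>s. v (y + s) \<partial>gamma_law (Suc k)) = (\<integral>(a, b). v (y + (a + b)) \<partial>(gamma_law 0 \<Otimes>\<^sub>M gamma_law k))"
    unfolding gamma_law_Suc by (subst integral_distr) (auto simp: split_def)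
  also have "\<dots> = (\<integral>a. (\<integral>b. v (y + (a + b)) \<partial>gamma_law k) \<partial>gamma_law 0)"
    using AB.integral_fst'[OF int] by simp
  also have "\<dots> = (\<integral>a. (exp_step ^^ Suc k) v (y + a) \<partial>gamma_law 0)"
    by (subst Suc[symmetric]) (simp add: add.assoc)
  also have "\<dots> = (exp_step ^^ Suc (Suc k)) v y" by (simp add: exp_step_def)
  finally show ?case .
qed

lemma gamma_density_eq_erlang: "u \<noteq> 0 \<Longrightarrow> gamma_density (int (Suc k)) u = erlang_density k 1 u"
  by (auto simp: gamma_density_def erlang_density_def nat_add_distrib split: split_indicator)

lemma gamma_density_measurable [measurable]: "gamma_density r \<in> borel_measurable borel"
proof -
  have "gamma_density r = (\<lambda>u. if r < 0 then 0 else if r = 0 then indicator {0} u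
      else u ^ nat (r - 1) / fact (nat (r - 1)) * exp (- u) * indicator {0<..} u)"
    by (simp add: fun_eq_iff gamma_density_def)
  then show ?thesis by (simp only:) measurable
qed

lemma gamma_density_nonneg: "0 \<le> gamma_density r u"
  by (auto simp: gamma_density_def split: split_indicator)

text \<open>
  The factor $e^{u/4}$ pays for the power of \<open>u\<close>. The rate 3/4 leaves room between this decay and the
  growth rate 1/2 of the class \<open>half_exp_bounded\<close>.
\<close>

lemma gamma_density_bound:
  "gamma_density r u \<le> 4 ^ nat r * exp (- 3 / 4 * u)" "u < 0 \<Longrightarrow> gamma_density r u = 0"
proof -
  show "gamma_density r u = 0" if "u < 0" using that by (simp add: gamma_density_def)
  show "gamma_density r u \<le> 4 ^ nat r * exp (- 3 / 4 * u)"
  proof (cases "0 < r \<and> 0 < u")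
    case True
    define k where "k = nat (r - 1)"
    have "(u / 4) ^ k / fact k \<le> exp (u / 4)" using True by (intro power_le_exp) simp
    then have "u ^ k / fact k \<le> 4 ^ k * exp (u / 4)" by (simp add: power_divide field_simps)
    then have "u ^ k / fact k * exp (- u) \<le> 4 ^ k * exp (u / 4) * exp (- u)" by (intro mult_right_mono) auto
    also have "\<dots> = 4 ^ k * exp (- 3 / 4 * u)" by (simp add: mult.assoc flip: exp_add)
    also have "\<dots> \<le> 4 ^ nat r * exp (- 3 / 4 * u)"
      unfolding k_def by (intro mult_right_mono power_increasing) auto
    finally show ?thesis using True by (simp add: gamma_density_def k_def)
  next
    case False
    then show ?thesis by (auto simp: gamma_density_def split: split_indicator)
  qed
qed

lemma gamma_measure_Suc: "gamma_measure (int (Suc k)) y = distr (gamma_law k) borel (\<lambda>s. y + s)"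
proof -
  have "gamma_measure (int (Suc k)) y = density lborel (\<lambda>u. ennreal (gamma_density (int (Suc k)) (u - y)))"
    by (simp only: gamma_measure_def) simp
  also have "\<dots> = density lborel (\<lambda>u. ennreal (erlang_density k 1 (u - y)))"
  proof (rule density_cong)
    show "AE u in lborel. ennreal (gamma_density (int (Suc k)) (u - y)) = ennreal (erlang_density k 1 (u - y))"
      using AE_lborel_singleton[of y] by eventually_elim (simp add: gamma_density_eq_erlang del: of_nat_Suc)
  qed auto
  also have "\<dots> = density (distr lborel borel ((+) y)) (\<lambda>u. ennreal (erlang_density k 1 (u - y)))"
    by (simp add: lborel_distr_plus)
  also have "\<dots> = distr (density lborel (\<lambda>s. ennreal (erlang_density k 1 (y + s - y)))) borel ((+) y)"
    by (subst density_distr) auto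
  finally show ?thesis by simp
qed

lemma gamma_measure_0: "gamma_measure 0 y = return borel y"
  by (simp add: gamma_measure_def)

lemma gamma_measure_prob: "prob_space (gamma_measure (int r) y)"
proof (cases r)
  case 0 then show ?thesis by (simp add: gamma_measure_0 prob_space_return)
next
  case (Suc k)
  then show ?thesis using prob_space.prob_space_distr[OF gamma_law_prob[of k], where f="\<lambda>s. y + s" and M'=borel]
    by (simp add: gamma_measure_Suc del: of_nat_Suc)
qed

lemma gamma_measure_integrable:
  assumes v: "half_exp_bounded v"
  shows "integrable (gamma_measure (int r) y) v"
proof (cases r)
  case 0 
  note [measurable] = v[THEN half_exp_bounded_measurable]
  interpret prob_space "return borel y" by (rule prob_space_return) simp
  have "integrable (return borel y) v"
    by (rule integrable_const_bound[of _ "\<bar>v y\<bar>"]) (auto simp: AE_return)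
  then show ?thesis using 0 by (simp add: gamma_measure_0)
next
  case (Suc k)
  note [measurable] = v[THEN half_exp_bounded_measurable]
  show ?thesis unfolding Suc gamma_measure_Suc
    by (subst integrable_distr_eq) (auto intro: half_exp_bounded_integrable[OF v])
qed

lemma gamma_density_integrable:
  assumes v: "half_exp_bounded v"
  shows "integrable lborel (\<lambda>u. gamma_density (int (Suc k)) (u - y) * v u)"
proof -
  note [measurable] = v[THEN half_exp_bounded_measurable]
  have "integrable (gamma_measure (int (Suc k)) y) v" by (rule gamma_measure_integrable[OF v])
  also have "gamma_measure (int (Suc k)) y = density lborel (\<lambda>u. ennreal (gamma_density (int (Suc k)) (u - y)))"
    by (simp only: gamma_measure_def) simp
  finally show ?thesis
    by (subst (asm) integrable_density) (auto simp: gamma_density_nonneg simp del: of_nat_Suc)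
qed

lemma gamma_measure_integral:
  assumes v: "half_exp_bounded v"
  shows "(\<integral>u. v u \<partial>gamma_measure (int r) y) = (exp_step ^^ r) v y"
proof (cases r)
  case 0 
  note [measurable] = v[THEN half_exp_bounded_measurable]
  show ?thesis using 0 by (simp add: gamma_measure_0 integral_return)
next
  case (Suc k)
  note [measurable] = v[THEN half_exp_bounded_measurable]
  show ?thesis unfolding Suc gamma_measure_Suc
    by (subst integral_distr) (auto simp: gamma_law_integral[OF v] simp del: funpow.simps)
qed

lemma gamma_density_integral:
  assumes v: "half_exp_bounded v"
  shows "(\<integral>u. gamma_density (int (Suc k)) (u - y) * v u \<partial>lborel) = (exp_step ^^ Suc k) v y"
proof -
  note [measurable] = v[THEN half_exp_bounded_measurable]
  have "(exp_step ^^ Suc k) v y = (\<integral>u. v u \<partial>gamma_measure (int (Suc k)) y)"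
    by (simp only: gamma_measure_integral[OF v])
  also have "gamma_measure (int (Suc k)) y = density lborel (\<lambda>u. ennreal (gamma_density (int (Suc k)) (u - y)))"
    by (simp only: gamma_measure_def) simp
  finally show ?thesis
    by (subst (asm) integral_density) (auto simp: gamma_density_nonneg simp del: of_nat_Suc)
qed

lemma gamma_moment_eq: "gamma_moment (int r) y p = (exp_step ^^ r) (\<lambda>u. u ^ p) y"
  unfolding gamma_moment_def by (rule gamma_measure_integral[OF half_exp_bounded_power])

lemma gamma_moment_centred: "gamma_moment (int r) y p = (\<integral>\<zeta>. (y + \<zeta>) ^ p \<partial>gamma_measure (int r) 0)"
proof (cases r)
  case 0
  then show ?thesis by (simp add: gamma_moment_def gamma_measure_0 integral_return)
next
  case (Suc k)
  show ?thesis unfolding gamma_moment_def Suc gamma_measure_Suc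
    by (subst (1 2) integral_distr) auto
qed

lemma gamma_law_moment: "(\<integral>s. s ^ i \<partial>gamma_law 0) = fact i"
proof -
  have "(\<integral>s. s ^ i \<partial>gamma_law 0) = (\<integral>s. erlang_density 0 1 s * s ^ i \<partial>lborel)"
    by (subst integral_density) auto
  also have "\<dots> = enn2real (\<integral>\<^sup>+s. ennreal (erlang_density 0 1 s * s ^ i) \<partial>lborel)"
    by (rule integral_eq_nn_integral) (auto simp: erlang_density_def)
  also have "\<dots> = fact i" by (subst nn_integral_erlang_ith_moment) auto
  finally show ?thesis .
qed

lemma exp_step_power: "exp_step (\<lambda>u. u ^ l) y = (\<Sum>i\<le>l. fact l / fact i * y ^ i)"
proof -
  have int: "integrable (gamma_law 0) (\<lambda>s. s ^ i)" for i
    using half_exp_bounded_integrable[OF half_exp_bounded_power, of 0 0 i] by simp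
  have "exp_step (\<lambda>u. u ^ l) y = (\<integral>s. (\<Sum>i\<le>l. (of_nat (l choose i) * y ^ i) * s ^ (l - i)) \<partial>gamma_law 0)"
    by (simp add: exp_step_def binomial_ring)
  also have "\<dots> = (\<Sum>i\<le>l. (of_nat (l choose i) * y ^ i) * fact (l - i))"
    by (subst Bochner_Integration.integral_sum) (auto intro!: integrable_mult_right int simp: gamma_law_moment)
  also have "\<dots> = (\<Sum>i\<le>l. fact l / fact i * y ^ i)"
    by (intro sum.cong refl) (simp add: binomial_fact field_simps)
  finally show ?thesis .
qed

text \<open>
  This is integration by parts for $\int (y+s)^{l+1} e^{-s} ds$. It makes $v \mapsto v - v'$ the inverse of
  averaging on polynomials.
\<close>

lemma exp_step_power_Suc: "exp_step (\<lambda>u. u ^ Suc l) y = y ^ Suc l + of_nat (Suc l) * exp_step (\<lambda>u. u ^ l) y"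
proof -
  have "(\<Sum>i\<le>l. fact (Suc l) / fact i * y ^ i) = of_nat (Suc l) * (\<Sum>i\<le>l. fact l / fact i * y ^ i)"
    unfolding sum_distrib_left by (intro sum.cong refl) (simp add: field_simps)
  then show ?thesis unfolding exp_step_power sum.atMost_Suc by simp
qed

section \<open>Moments and the harmonic function\<close>

text \<open>
  The polynomial $(1 - D)^p u^l$, whose average over a $\mathrm{Gamma}(p, 1)$ variable is $u^l$. These polynomials
  continue the sequence of averages of the monomials to negative indices.
\<close>

fun inv_power :: "nat \<Rightarrow> nat \<Rightarrow> real \<Rightarrow> real" where
  "inv_power 0 l = (\<lambda>u. u ^ l)"
| "inv_power (Suc p) l = (\<lambda>u. inv_power p l u - real l * inv_power p (l - 1) u)"

lemma half_exp_bounded_inv_power: "half_exp_bounded (inv_power p l)"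
  by (induction p arbitrary: l)
     (auto intro!: half_exp_bounded_power half_exp_bounded_diff half_exp_bounded_cmult)

lemma exp_step_inv_power: "exp_step (inv_power (Suc p) l) = inv_power p l"
proof (induction p arbitrary: l)
  case 0
  have "exp_step (inv_power (Suc 0) l) = (\<lambda>y. exp_step (\<lambda>u. u ^ l) y - real l * exp_step (\<lambda>u. u ^ (l - 1)) y)"
    by (simp add: exp_step_diff_scaled half_exp_bounded_power)
  also have "\<dots> = (\<lambda>u. u ^ l)"
  proof (cases l)
    case (Suc l')
    then show ?thesis using exp_step_power_Suc[of l'] by simp
  next
    case 0
    then show ?thesis using exp_step_power[of 0] by (simp add: fun_eq_iff)
  qed
  finally show ?case by simp
next
  case (Suc p)
  have "exp_step (inv_power (Suc (Suc p)) l) =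
     (\<lambda>y. exp_step (inv_power (Suc p) l) y - real l * exp_step (inv_power (Suc p) (l - 1)) y)"
    by (subst inv_power.simps(2)) (rule exp_step_diff_scaled; rule half_exp_bounded_inv_power)
  also have "\<dots> = inv_power (Suc p) l" unfolding Suc by simp
  finally show ?case .
qed

lemma funpow_exp_step_inv_power: "(exp_step ^^ j) (inv_power (j + p) l) = inv_power p l"
proof (induction j)
  case (Suc j)
  have "(exp_step ^^ Suc j) (inv_power (Suc j + p) l) = (exp_step ^^ j) (exp_step (inv_power (Suc (j + p)) l))"
    by (simp only: funpow_Suc_right o_apply add_Suc)
  then show ?case by (simp only: exp_step_inv_power Suc)
qed simp

text \<open>
  The polynomials \<open>inv_power p l\<close> are monic of degree \<open>l\<close>.
\<close>

lemma pdet_inv_power: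
  "pdet {..<d} (\<lambda>k l. (exp_step ^^ k) (inv_power p l) (z k)) = pdet {..<d} (\<lambda>k l. (exp_step ^^ k) (\<lambda>u. u ^ l) (z k))"
proof (induction p)
  case (Suc p)
  define c where "c l i = (if i = l then 1 else if Suc i = l then - real l else 0)" for l i :: nat
  have c: "(\<Sum>i\<le>l. c l i * f i) = f l - real l * f (l - 1)" for l and f :: "nat \<Rightarrow> real"
  proof (cases l)
    case (Suc n)
    have "(\<Sum>i\<le>n. c l i * f i) = (\<Sum>i\<le>n. if i = n then - real l * f n else 0)"
      by (intro sum.cong refl) (auto simp: c_def Suc)
    then show ?thesis by (simp add: Suc c_def algebra_simps)
  qed (simp add: c_def)
  have "pdet {..<d} (\<lambda>k l. (exp_step ^^ k) (inv_power (Suc p) l) (z k)) = pdet {..<d} (\<lambda>k l. (exp_step ^^ k) (inv_power p l) (z k))"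
  proof (rule pdet_unitriangular_columns[where c=c])
    fix k l
    show "(exp_step ^^ k) (inv_power (Suc p) l) (z k) = (\<Sum>i\<le>l. c l i * (exp_step ^^ k) (inv_power p i) (z k))"
      unfolding c inv_power.simps
      by (subst funpow_exp_step_diff_scaled) (auto intro: half_exp_bounded_inv_power)
  qed (simp add: c_def)
  then show ?case using Suc by simp
qed simp

text \<open>
  Averaging turns monomials into monic polynomials of the same degree. So only the differences of the
  Gamma indices of the rows matter, and the moment matrices of both particles have the same
  determinant at all times.
\<close>

lemma pdet_moment_shift:
  "pdet {..<d} (\<lambda>r l. (exp_step ^^ (p + r)) (\<lambda>u. u ^ l) (z r)) = pdet {..<d} (\<lambda>r l. (exp_step ^^ r) (\<lambda>u. u ^ l) (z r))"
proof (induction p)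
  case (Suc p)
  have "pdet {..<d} (\<lambda>r l. (exp_step ^^ (Suc p + r)) (\<lambda>u. u ^ l) (z r)) = pdet {..<d} (\<lambda>r l. (exp_step ^^ (p + r)) (\<lambda>u. u ^ l) (z r))"
  proof (rule pdet_unitriangular_columns[where c="\<lambda>l i. fact l / fact i"])
    fix r l
    have "(exp_step ^^ (Suc p + r)) (\<lambda>u. u ^ l) = (exp_step ^^ (p + r)) (exp_step (\<lambda>u. u ^ l))"
      by (simp only: add_Suc funpow_Suc_right o_apply)
    also have "exp_step (\<lambda>u. u ^ l) = (\<lambda>y. \<Sum>i\<le>l. fact l / fact i * y ^ i)" by (simp add: exp_step_power fun_eq_iff)
    also have "(exp_step ^^ (p + r)) \<dots> = (\<lambda>y. \<Sum>i\<le>l. fact l / fact i * (exp_step ^^ (p + r)) (\<lambda>u. u ^ i) y)"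
      by (rule funpow_exp_step_sum) (rule half_exp_bounded_power)
    finally show "(exp_step ^^ (Suc p + r)) (\<lambda>u. u ^ l) (z r) = (\<Sum>i\<le>l. fact l / fact i * (exp_step ^^ (p + r)) (\<lambda>u. u ^ i) (z r))"
      by simp
  qed simp
  then show ?case using Suc by simp
qed simp

lemma half_exp_bounded_shifted_power: "half_exp_bounded (\<lambda>u. (x + u) ^ q)"
proof -
  obtain C where C: "0 \<le> C" "\<And>y :: real. \<bar>y ^ q\<bar> \<le> C * exp (\<bar>y\<bar> / 2)"
    using half_exp_boundedE[OF half_exp_bounded_power[of q]] by metis
  show ?thesis
    by (rule half_exp_boundedI[where C="C * exp (\<bar>x\<bar> / 2)"])
       (use half_exp_shift_bound[where v="\<lambda>u. u ^ q", OF C(2) C(1)] in auto)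
qed

text \<open>
  The rows of the Vandermonde matrix depend on different independent variables, so the expectation can
  be taken entry by entry.
\<close>

lemma h_fun_eq_pdet: "h_fun d x = pdet {..<d} (\<lambda>k l. (exp_step ^^ k) (\<lambda>u. u ^ l) (x (Suc k)))"
proof -
  (* Truncated subtraction makes \<mu> 0 a probability measure as well. *)
  define \<mu> where "\<mu> j = gamma_measure (int (j - 1)) 0" for j :: nat
  have prob: "prob_space (\<mu> j)" for j unfolding \<mu>_def by (rule gamma_measure_prob)
  have psf: "product_sigma_finite \<mu>"
    by (simp add: product_sigma_finite_def prob finite_measure.sigma_finite_measure prob_space.finite_measure)
  have int: "integrable (\<mu> j) (\<lambda>u. (x j + u) ^ q)" for j q
    unfolding \<mu>_def by (rule gamma_measure_integrable[OF half_exp_bounded_shifted_power])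
  have val: "(\<integral>u. (x j + u) ^ q \<partial>\<mu> j) = (exp_step ^^ (j - 1)) (\<lambda>u. u ^ q) (x j)" for j q
    unfolding \<mu>_def gamma_moment_centred[symmetric] by (rule gamma_moment_eq)
  have "(\<Pi>\<^sub>M j\<in>{1..d}. gamma_measure (int j - 1) 0) = PiM {1..d} \<mu>"
    by (intro PiM_cong) (auto simp: \<mu>_def of_nat_diff)
  then have "h_fun d x = (\<integral>\<eta>. pdet {..<d} (\<lambda>k l. (x (Suc k) + \<eta> (Suc k)) ^ l) \<partial>PiM {1..d} \<mu>)"
    by (simp add: h_fun_def vandermonde_eq_pdet)
  also have "\<dots> = (\<integral>\<eta>. (\<Sum>p | p permutes {..<d}. of_int (sign p) * (\<Prod>j\<in>{1..d}. (x j + \<eta> j) ^ p (j - 1))) \<partial>PiM {1..d} \<mu>)"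
  proof -
    have "(\<Prod>k<d. (x (Suc k) + \<eta> (Suc k)) ^ p k) = (\<Prod>j\<in>{1..d}. (x j + \<eta> j) ^ p (j - 1))" for \<eta> and p :: "nat \<Rightarrow> nat"
      by (rule prod.reindex_bij_witness[where i="\<lambda>j. j - 1" and j=Suc]) auto
    then show ?thesis by (simp add: pdet_def)
  qed
  also have "\<dots> = (\<Sum>p | p permutes {..<d}. of_int (sign p) * (\<integral>\<eta>. (\<Prod>j\<in>{1..d}. (x j + \<eta> j) ^ p (j - 1)) \<partial>PiM {1..d} \<mu>))"
    by (subst Bochner_Integration.integral_sum)
       (auto intro!: integrable_mult_right product_sigma_finite.product_integrable_prod[OF psf] int)
  also have "\<dots> = (\<Sum>p | p permutes {..<d}. of_int (sign p) * (\<Prod>j\<in>{1..d}. (exp_step ^^ (j - 1)) (\<lambda>u. u ^ p (j - 1)) (x j)))"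
    by (intro sum.cong refl arg_cong2[where f="(*)"])
       (subst product_sigma_finite.product_integral_prod[OF psf], auto intro: int simp: val)
  also have "\<dots> = pdet {..<d} (\<lambda>k l. (exp_step ^^ k) (\<lambda>u. u ^ l) (x (Suc k)))"
  proof -
    have "(\<Prod>j\<in>{1..d}. (exp_step ^^ (j - 1)) (\<lambda>u. u ^ p (j - 1)) (x j)) = (\<Prod>k<d. (exp_step ^^ k) (\<lambda>u. u ^ p k) (x (Suc k)))"
      for p :: "nat \<Rightarrow> nat"
      by (rule prod.reindex_bij_witness[where i=Suc and j="\<lambda>j. j - 1"]) auto
    then show ?thesis by (simp add: pdet_def)
  qed
  finally show ?thesis .
qed

lemma det_moment_mat:
  assumes "c \<le> N + 1"
  shows "Determinant.det (moment_mat c d N x) = h_fun d x"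
proof -
  have "moment_mat c d N x = Matrix.mat d d (\<lambda>(r, l). (exp_step ^^ ((N + 1 - c) + r)) (\<lambda>u. u ^ l) (x (Suc r)))"
  proof -
    have "int N - int c + int (Suc r) = int ((N + 1 - c) + r)" for r using assms by simp
    then have "gamma_moment (int N - int c + int (Suc r)) y l = (exp_step ^^ ((N + 1 - c) + r)) (\<lambda>u. u ^ l) y" for r y l
      by (simp only: gamma_moment_eq)
    then show ?thesis by (intro eq_matI) (simp_all add: moment_mat_def del: of_nat_Suc)
  qed
  then have "Determinant.det (moment_mat c d N x) = pdet {..<d} (\<lambda>r l. (exp_step ^^ ((N + 1 - c) + r)) (\<lambda>u. u ^ l) (x (Suc r)))"
    by (simp only: det_mat_eq_pdet)
  also have "\<dots> = h_fun d x" by (simp only: pdet_moment_shift h_fun_eq_pdet)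
  finally show ?thesis .
qed

section \<open>One step of the killed walk\<close>

definition ordered :: "nat \<Rightarrow> (nat \<Rightarrow> real) \<Rightarrow> bool" where
  "ordered d z \<longleftrightarrow> (\<forall>k. Suc k < d \<longrightarrow> z k \<le> z (Suc k))"

lemma ordered_mono:
  assumes "ordered d z" "i \<le> j" "j < d"
  shows "z i \<le> z j"
  using assms(2,3)
proof (induction j rule: dec_induct)
  case (step j)
  then show ?case using assms(1) unfolding ordered_def by (meson Suc_lessD order_trans)
qed simp

lemma pred_ordered:
  assumes "\<And>k. k < d \<Longrightarrow> (\<lambda>\<omega>. z \<omega> k) \<in> borel_measurable M"
  shows "Measurable.pred M (\<lambda>\<omega>. ordered d (z \<omega>))"
proof -
  have "(\<lambda>\<omega>. ordered d (z \<omega>)) = (\<lambda>\<omega>. \<forall>k\<in>{k. Suc k < d}. z \<omega> k \<le> z \<omega> (Suc k))"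
    by (auto simp: ordered_def fun_eq_iff)
  moreover have "finite {k. Suc k < d}" by (rule finite_subset[of _ "{..<d}"]) auto
  moreover have "Measurable.pred M (\<lambda>\<omega>. z \<omega> k \<le> z \<omega> (Suc k))" if "k \<in> {k. Suc k < d}" for k
    using that unfolding pred_def by (intro borel_measurable_le assms) auto
  ultimately show ?thesis by (auto intro!: pred_intros_finite)
qed

text \<open>
  The increments are indexed by pairs of a time and a particle. Particles are numbered from 0 here, as
  are the rows of the determinants.
\<close>

abbreviation step_law :: "(nat \<times> nat) set \<Rightarrow> (nat \<times> nat \<Rightarrow> real) measure" where
  "step_law I \<equiv> PiM I (\<lambda>_. gamma_law 0)"

lemma product_sigma_finite_gamma_law: "product_sigma_finite (\<lambda>_ :: nat \<times> nat. gamma_law 0)"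
proof -
  have "sigma_finite_measure (gamma_law 0)"
    by (intro finite_measure.sigma_finite_measure prob_space.finite_measure gamma_law_prob)
  then show ?thesis by (simp add: product_sigma_finite_def)
qed

lemma step_law_integrable:
  assumes "finite I" "f \<in> borel_measurable (step_law I)"
    and "\<And>\<omega>. \<bar>f \<omega>\<bar> \<le> K * (\<Prod>p\<in>I. exp (\<bar>\<omega> p\<bar> / 2))"
  shows "integrable (step_law I) f"
proof -
  have "integrable (step_law I) (\<lambda>\<omega>. K * (\<Prod>p\<in>I. exp (\<bar>\<omega> p\<bar> / 2)))"
    by (intro integrable_mult_right
        product_sigma_finite.product_integrable_prod[OF product_sigma_finite_gamma_law assms(1)] integrable_exp_half)
  then show ?thesis
  proof (rule Bochner_Integration.integrable_bound)
    show "AE \<omega> in step_law I. norm (f \<omega>) \<le> norm (K * (\<Prod>p\<in>I. exp (\<bar>\<omega> p\<bar> / 2)))"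
      using assms(3) by (intro AE_I2) (auto intro: order_trans[OF _ abs_ge_self])
  qed fact
qed

text \<open>
  The main computation. The particles are integrated out from the lowest to the highest, and \<open>D j\<close> is
  the integrand that is left when the first \<open>j\<close> are done: their rows are the new ones, the
  remaining rows are still evaluated at the new positions. The boundary term in the hypothesis
  \<open>shift\<close> is a multiple of the next row of \<open>D j\<close>, evaluated at the position of particle \<open>Suc j\<close>.
  Hence the functions have to be related only on the set \<open>A\<close> that confines the new positions.
\<close>

lemma one_step_determinant:
  fixes v v' :: "nat \<Rightarrow> nat \<Rightarrow> real \<Rightarrow> real"
  assumes y: "ordered d y" and A: "A \<in> sets borel"
    and v: "\<And>k l. half_exp_bounded (v k l)"
    and shift: "\<And>k l t. Suc k < d \<Longrightarrow> t \<in> A \<Longrightarrow> y k \<le> t \<Longrightarrow>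
       exp_step (\<lambda>u. indicator (A \<inter> {..t}) u * v k l u) (y k) = v' k l (y k) - exp (y k - t) * v (Suc k) l t"
    and last: "\<And>k l. Suc k = d \<Longrightarrow> exp_step (\<lambda>u. indicator A u * v k l u) (y k) = v' k l (y k)"
  shows "(\<integral>\<omega>. of_bool (ordered d (\<lambda>k. y k + \<omega> (s, k)) \<and> (\<forall>k<d. y k + \<omega> (s, k) \<in> A)) *
       pdet {..<d} (\<lambda>k l. v k l (y k + \<omega> (s, k))) \<partial>step_law ({s} \<times> {..<d})) =
     pdet {..<d} (\<lambda>k l. v' k l (y k))"
proof -
  define z where "z \<omega> k = y k + \<omega> (s, k)" for \<omega> :: "nat \<times> nat \<Rightarrow> real" and k
  define G where "G j \<omega> \<longleftrightarrow> (\<forall>k\<in>{j..<d}. 0 \<le> \<omega> (s, k) \<and> z \<omega> k \<in> A \<and> (Suc k < d \<longrightarrow> z \<omega> k \<le> z \<omega> (Suc k)))"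
    for j \<omega>
  define R where "R j \<omega> k l = (if k < j then v' k l (y k) else v k l (z \<omega> k))" for j \<omega> k l
  define D where "D j \<omega> = of_bool (G j \<omega>) * pdet {..<d} (R j \<omega>)" for j \<omega>
  note [measurable] = A half_exp_bounded_measurable[OF v]
  have G_measurable: "Measurable.pred (step_law ({s} \<times> {j..<d})) (G j)" for j
  proof -
    have comp: "(\<lambda>\<omega>. \<omega> (s, k)) \<in> borel_measurable (step_law ({s} \<times> {j..<d}))" if "j \<le> k" "k < d" for k
      using measurable_component_singleton[of "(s, k)" "{s} \<times> {j..<d}" "\<lambda>_. gamma_law 0"] that by simp
    have inA: "Measurable.pred (step_law ({s} \<times> {j..<d})) (\<lambda>\<omega>. 0 \<le> \<omega> (s, k) \<and> y k + \<omega> (s, k) \<in> A)"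
      if "k \<in> {j..<d}" for k
    proof -
      have [measurable]: "(\<lambda>\<omega>. \<omega> (s, k)) \<in> borel_measurable (step_law ({s} \<times> {j..<d}))"
        using that by (intro comp) auto
      show ?thesis by measurable
    qed
    have le: "Measurable.pred (step_law ({s} \<times> {j..<d})) (\<lambda>\<omega>. y k + \<omega> (s, k) \<le> y (Suc k) + \<omega> (s, Suc k))"
      if "k \<in> {k. j \<le> k \<and> Suc k < d}" for k
      unfolding pred_def using that
      by (intro borel_measurable_le borel_measurable_add borel_measurable_const comp) auto
    have Gj: "G j = (\<lambda>\<omega>. (\<forall>k\<in>{j..<d}. 0 \<le> \<omega> (s, k) \<and> y k + \<omega> (s, k) \<in> A) \<and>
        (\<forall>k\<in>{k. j \<le> k \<and> Suc k < d}. y k + \<omega> (s, k) \<le> y (Suc k) + \<omega> (s, Suc k)))"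
      by (auto simp: G_def z_def fun_eq_iff)
    have fin: "finite {k. j \<le> k \<and> Suc k < d}" by (rule finite_subset[of _ "{..<d}"]) auto
    have 1: "Measurable.pred (step_law ({s} \<times> {j..<d})) (\<lambda>\<omega>. \<forall>k\<in>{j..<d}. 0 \<le> \<omega> (s, k) \<and> y k + \<omega> (s, k) \<in> A)"
      by (intro pred_intros_finite inA finite_atLeastLessThan)
    have 2: "Measurable.pred (step_law ({s} \<times> {j..<d}))
        (\<lambda>\<omega>. \<forall>k\<in>{k. j \<le> k \<and> Suc k < d}. y k + \<omega> (s, k) \<le> y (Suc k) + \<omega> (s, Suc k))"
      by (intro pred_intros_finite le fin)
    show ?thesis unfolding Gj by (intro pred_intros_logic 1 2)
  qed
  have D_measurable [measurable]: "D j \<in> borel_measurable (step_law ({s} \<times> {j..<d}))" for j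
  proof -
    note [measurable] = G_measurable[of j]
    have "(\<lambda>\<omega>. pdet {..<d} (R j \<omega>)) \<in> borel_measurable (step_law ({s} \<times> {j..<d}))"
      unfolding pdet_def
    proof (intro borel_measurable_sum borel_measurable_times borel_measurable_prod borel_measurable_const)
      fix p k assume "k \<in> {..<d}"
      show "(\<lambda>\<omega>. R j \<omega> k (p k)) \<in> borel_measurable (step_law ({s} \<times> {j..<d}))"
      proof (cases "k < j")
        case False
        then have [measurable]: "(\<lambda>\<omega>. \<omega> (s, k)) \<in> borel_measurable (step_law ({s} \<times> {j..<d}))"
          using \<open>k \<in> _\<close> measurable_component_singleton[of "(s, k)" "{s} \<times> {j..<d}" "\<lambda>_. gamma_law 0"] by simp
        show ?thesis unfolding R_def z_def using False by simp
      qed (simp add: R_def)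
    qed
    then show ?thesis unfolding D_def[abs_def] by measurable
  qed
  have D_integrable: "integrable (step_law ({s} \<times> {j..<d})) (D j)" for j
  proof -
    obtain C where C: "\<And>k l. 0 \<le> C k l" "\<And>k l u. \<bar>v k l u\<bar> \<le> C k l * exp (\<bar>u\<bar> / 2)"
      using half_exp_bounded_constants[of v] v by blast
    define B where "B = (\<Sum>k<d. \<Sum>l<d. C k l * exp (\<bar>y k\<bar> / 2) + \<bar>v' k l (y k)\<bar>)"
    have B: "C k l * exp (\<bar>y k\<bar> / 2) + \<bar>v' k l (y k)\<bar> \<le> B" if "k < d" "l < d" for k l
    proof -
      have "C k l * exp (\<bar>y k\<bar> / 2) + \<bar>v' k l (y k)\<bar> \<le> (\<Sum>l<d. C k l * exp (\<bar>y k\<bar> / 2) + \<bar>v' k l (y k)\<bar>)"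
        using that C by (intro member_le_sum) auto
      also have "\<dots> \<le> B" unfolding B_def
        using that C by (intro member_le_sum[where f="\<lambda>k. \<Sum>l<d. C k l * exp (\<bar>y k\<bar> / 2) + \<bar>v' k l (y k)\<bar>"])
           (auto intro!: sum_nonneg add_nonneg_nonneg)
      finally show ?thesis .
    qed
    have B0: "0 \<le> B" unfolding B_def using C by (auto intro!: sum_nonneg add_nonneg_nonneg)
    show ?thesis
    proof (rule step_law_integrable[where K="fact d * B ^ d"])
      fix \<omega> :: "nat \<times> nat \<Rightarrow> real"
      let ?a = "\<lambda>k. B * (if k < j then 1 else exp (\<bar>\<omega> (s, k)\<bar> / 2))"
      have "\<bar>pdet {..<d} (R j \<omega>)\<bar> \<le> fact (card {..<d}) * (\<Prod>k<d. ?a k * 1)"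
      proof (rule pdet_bound)
        fix k l assume kl: "k \<in> {..<d}" "l \<in> {..<d}"
        have nn: "0 \<le> C k l * exp (\<bar>y k\<bar> / 2)" "0 \<le> \<bar>v' k l (y k)\<bar>" using C by auto
        show "\<bar>R j \<omega> k l\<bar> \<le> ?a k * 1"
        proof (cases "k < j")
          case True
          then show ?thesis using B[of k l] kl nn by (simp add: R_def)
        next
          case False
          have "\<bar>v k l (z \<omega> k)\<bar> \<le> C k l * exp (\<bar>y k\<bar> / 2) * exp (\<bar>\<omega> (s, k)\<bar> / 2)"
            unfolding z_def by (rule half_exp_shift_bound[OF C(2) C(1)])
          also have "\<dots> \<le> B * exp (\<bar>\<omega> (s, k)\<bar> / 2)" using B[of k l] kl nn by (intro mult_right_mono) auto
          finally show ?thesis using False by (simp add: R_def)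
        qed
      qed (use B0 in auto)
      also have "\<dots> = fact d * (B ^ d * (\<Prod>k<d. if k < j then 1 else exp (\<bar>\<omega> (s, k)\<bar> / 2)))"
        by (simp add: prod.distrib)
      also have "(\<Prod>k<d. if k < j then 1 else exp (\<bar>\<omega> (s, k)\<bar> / 2)) = (\<Prod>k\<in>{j..<d}. exp (\<bar>\<omega> (s, k)\<bar> / 2))"
        by (rule prod.mono_neutral_cong_right) auto
      also have "\<dots> = (\<Prod>p\<in>{s} \<times> {j..<d}. exp (\<bar>\<omega> p\<bar> / 2))"
        by (rule prod.reindex_bij_witness[where i=snd and j="Pair s"]) auto
      finally show "\<bar>D j \<omega>\<bar> \<le> fact d * B ^ d * (\<Prod>p\<in>{s} \<times> {j..<d}. exp (\<bar>\<omega> p\<bar> / 2))"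
        unfolding D_def by (cases "G j \<omega>") (auto simp: mult.assoc B0 intro!: mult_nonneg_nonneg prod_nonneg)
    qed auto
  qed
  have step: "(\<integral>\<omega>. D j \<omega> \<partial>step_law ({s} \<times> {j..<d})) = (\<integral>\<omega>. D (Suc j) \<omega> \<partial>step_law ({s} \<times> {Suc j..<d}))"
    if "j < d" for j
  proof -
    have ins: "{s} \<times> {j..<d} = insert (s, j) ({s} \<times> {Suc j..<d})" using that by auto
    have "(\<integral>\<omega>. D j \<omega> \<partial>step_law ({s} \<times> {j..<d})) =
      (\<integral>\<omega>. (\<integral>t. D j (fun_upd \<omega> (s, j) t) \<partial>gamma_law 0) \<partial>step_law ({s} \<times> {Suc j..<d}))"
      using D_integrable[of j] unfolding ins
      by (intro product_sigma_finite.product_integral_insert[OF product_sigma_finite_gamma_law]) auto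
    also have "\<dots> = (\<integral>\<omega>. D (Suc j) \<omega> \<partial>step_law ({s} \<times> {Suc j..<d}))"
    proof (rule Bochner_Integration.integral_cong[OF refl])
      fix \<omega> :: "nat \<times> nat \<Rightarrow> real"
      define S where "S = (if Suc j < d then A \<inter> {..z \<omega> (Suc j)} else A)"
      have zk: "z (fun_upd \<omega> (s, j) t) k = (if k = j then y j + t else z \<omega> k)" for t k
        by (simp add: z_def)
      (* The constraint on the coordinate j splits off from those on the later ones. *)
      have Gj: "G j (fun_upd \<omega> (s, j) t) \<longleftrightarrow> 0 \<le> t \<and> y j + t \<in> S \<and> G (Suc j) \<omega>" for t
      proof -
        have "G j (fun_upd \<omega> (s, j) t) \<longleftrightarrow> (0 \<le> t \<and> y j + t \<in> A \<and> (Suc j < d \<longrightarrow> y j + t \<le> z \<omega> (Suc j))) \<and>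
            (\<forall>k\<in>{Suc j..<d}. 0 \<le> \<omega> (s, k) \<and> z \<omega> k \<in> A \<and> (Suc k < d \<longrightarrow> z \<omega> k \<le> z \<omega> (Suc k)))"
        proof -
          have "{j..<d} = insert j {Suc j..<d}" using that by auto
          then show ?thesis unfolding G_def zk by auto
        qed
        then show ?thesis unfolding S_def G_def by auto
      qed
      have Rj: "R j (fun_upd \<omega> (s, j) t) = (R (Suc j) \<omega>)(j := \<lambda>l. v j l (y j + t))" for t
        by (auto simp: fun_eq_iff R_def zk)
      let ?c = "\<lambda>l. pdet {..<d} ((R (Suc j) \<omega>)(j := \<lambda>i. of_bool (i = l)))"
      show "(\<integral>t. D j (fun_upd \<omega> (s, j) t) \<partial>gamma_law 0) = D (Suc j) \<omega>"
      proof (cases "G (Suc j) \<omega>")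
        case False
        then show ?thesis by (simp add: D_def Gj)
      next
        case True
        have S [measurable]: "S \<in> sets borel" unfolding S_def by auto
        have "(\<integral>t. D j (fun_upd \<omega> (s, j) t) \<partial>gamma_law 0) =
           (\<integral>t. of_bool (0 \<le> t) * (\<Sum>l<d. ?c l * (indicator S (y j + t) * v j l (y j + t))) \<partial>gamma_law 0)"
          unfolding D_def Gj Rj using True
          by (intro Bochner_Integration.integral_cong refl, subst pdet_row_expand[OF that])
             (auto simp: indicator_def sum_distrib_left mult_ac)
        also have "\<dots> = (\<integral>t. (\<Sum>l<d. ?c l * (indicator S (y j + t) * v j l (y j + t))) \<partial>gamma_law 0)"
          by (subst (1 2) integral_density) (auto simp: erlang_density_def intro!: Bochner_Integration.integral_cong)
        also have "\<dots> = (\<Sum>l<d. ?c l * exp_step (\<lambda>u. indicator S u * v j l u) (y j))"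
          unfolding exp_step_def
          by (subst Bochner_Integration.integral_sum)
             (auto intro!: integrable_mult_right half_exp_bounded_integrable[OF half_exp_bounded_indicator[OF v S]])
        also have "\<dots> = pdet {..<d} (R (Suc j) \<omega>)"
        proof (cases "Suc j < d")
          case True': True
          have "z \<omega> (Suc j) \<in> A" "0 \<le> \<omega> (s, Suc j)" using True True' unfolding G_def by auto
          moreover have "y j \<le> y (Suc j)" using y True' by (simp add: ordered_def)
          ultimately have e: "exp_step (\<lambda>u. indicator S u * v j l u) (y j) =
              v' j l (y j) - exp (y j - z \<omega> (Suc j)) * v (Suc j) l (z \<omega> (Suc j))" for l
            unfolding S_def using True' by (simp add: shift z_def)
          have "(\<Sum>l<d. ?c l * exp_step (\<lambda>u. indicator S u * v j l u) (y j)) =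
             pdet {..<d} ((R (Suc j) \<omega>)(j := \<lambda>l. v' j l (y j) - exp (y j - z \<omega> (Suc j)) * v (Suc j) l (z \<omega> (Suc j))))"
            unfolding e by (subst (2) pdet_row_expand[OF that]) (simp add: mult.commute)
          also have "\<dots> = pdet {..<d} ((R (Suc j) \<omega>)(j := \<lambda>l. R (Suc j) \<omega> j l + (- exp (y j - z \<omega> (Suc j))) * R (Suc j) \<omega> (Suc j) l))"
            by (intro arg_cong[where f="pdet _"]) (auto simp: fun_eq_iff R_def)
          also have "\<dots> = pdet {..<d} (R (Suc j) \<omega>)"
            using True' by (intro pdet_add_row) auto
          finally show ?thesis .
        next
          case False
          then have "Suc j = d" using that by simp
          then have e: "exp_step (\<lambda>u. indicator S u * v j l u) (y j) = R (Suc j) \<omega> j l" for l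
            unfolding S_def using False by (simp add: last R_def)
          have "(\<Sum>l<d. ?c l * exp_step (\<lambda>u. indicator S u * v j l u) (y j)) =
             pdet {..<d} ((R (Suc j) \<omega>)(j := R (Suc j) \<omega> j))"
            unfolding e by (subst (2) pdet_row_expand[OF that]) (simp add: mult.commute)
          then show ?thesis by simp
        qed
        also have "\<dots> = D (Suc j) \<omega>" using True by (simp add: D_def)
        finally show ?thesis .
      qed
    qed
    finally show ?thesis .
  qed
  have "j \<le> d \<Longrightarrow> (\<integral>\<omega>. D 0 \<omega> \<partial>step_law ({s} \<times> {0..<d})) = (\<integral>\<omega>. D j \<omega> \<partial>step_law ({s} \<times> {j..<d}))" for j
    by (induction j) (simp_all add: step)
  from this[of d] have "(\<integral>\<omega>. D 0 \<omega> \<partial>step_law ({s} \<times> {0..<d})) = (\<integral>\<omega>. D d \<omega> \<partial>step_law {})" by simp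
  also have "\<dots> = D d (\<lambda>_. undefined)"
    by (simp add: PiM_empty lebesgue_integral_count_space_finite)
  also have "\<dots> = pdet {..<d} (\<lambda>k l. v' k l (y k))"
    by (auto simp: D_def G_def R_def intro!: pdet_cong)
  finally have D0: "(\<integral>\<omega>. D 0 \<omega> \<partial>step_law ({s} \<times> {..<d})) = pdet {..<d} (\<lambda>k l. v' k l (y k))"
    by (simp add: atLeast0LessThan)
  (* D 0 requires the increments to be nonnegative, so that y j \<le> y (Suc j) \<le> z (Suc j) above. *)
  have nonneg: "AE \<omega> in step_law ({s} \<times> {..<d}). \<forall>p\<in>{s} \<times> {..<d}. 0 \<le> \<omega> p"
  proof (intro eventually_ball_finite ballI)
    fix p assume "p \<in> {s} \<times> {..<d}"
    moreover have "AE t in gamma_law 0. 0 \<le> t" by (subst AE_density) (auto simp: erlang_density_def)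
    ultimately show "AE \<omega> in step_law ({s} \<times> {..<d}). 0 \<le> \<omega> p"
      by (intro AE_PiM_component gamma_law_prob)
  qed simp
  have "(\<integral>\<omega>. of_bool (ordered d (z \<omega>) \<and> (\<forall>k<d. z \<omega> k \<in> A)) *
       pdet {..<d} (\<lambda>k l. v k l (z \<omega> k)) \<partial>step_law ({s} \<times> {..<d})) =
     (\<integral>\<omega>. D 0 \<omega> \<partial>step_law ({s} \<times> {..<d}))"
  proof (rule integral_cong_AE)
    show "AE \<omega> in step_law ({s} \<times> {..<d}). of_bool (ordered d (z \<omega>) \<and> (\<forall>k<d. z \<omega> k \<in> A)) *
       pdet {..<d} (\<lambda>k l. v k l (z \<omega> k)) = D 0 \<omega>"
      using nonneg
    proof eventually_elim
      case (elim \<omega>)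
      then have "G 0 \<omega> \<longleftrightarrow> ordered d (z \<omega>) \<and> (\<forall>k<d. z \<omega> k \<in> A)"
        unfolding G_def ordered_def by auto
      moreover have "R 0 \<omega> = (\<lambda>k l. v k l (z \<omega> k))" by (simp add: R_def fun_eq_iff)
      ultimately show ?case by (simp add: D_def)
    qed
    show "D 0 \<in> borel_measurable (step_law ({s} \<times> {..<d}))"
      using D_measurable[of 0] by (simp add: atLeast0LessThan)
    have [measurable]: "(\<lambda>\<omega>. z \<omega> k) \<in> borel_measurable (step_law ({s} \<times> {..<d}))" if "k < d" for k
      using measurable_component_singleton[of "(s, k)" "{s} \<times> {..<d}" "\<lambda>_. gamma_law 0"] that
      unfolding z_def by simp
    have "Measurable.pred (step_law ({s} \<times> {..<d})) (\<lambda>\<omega>. \<forall>k\<in>{..<d}. z \<omega> k \<in> A)"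
      by (intro pred_intros_finite) auto
    then have [measurable]: "Measurable.pred (step_law ({s} \<times> {..<d})) (\<lambda>\<omega>. \<forall>k<d. z \<omega> k \<in> A)"
      by (simp add: Ball_def)
    have [measurable]: "Measurable.pred (step_law ({s} \<times> {..<d})) (\<lambda>\<omega>. ordered d (z \<omega>))"
      by (rule pred_ordered) simp
    have [measurable]: "(\<lambda>\<omega>. pdet {..<d} (\<lambda>k l. v k l (z \<omega> k))) \<in> borel_measurable (step_law ({s} \<times> {..<d}))"
      unfolding pdet_def
      by (intro borel_measurable_sum borel_measurable_times borel_measurable_prod borel_measurable_const)
         auto
    show "(\<lambda>\<omega>. of_bool (ordered d (z \<omega>) \<and> (\<forall>k<d. z \<omega> k \<in> A)) *
       pdet {..<d} (\<lambda>k l. v k l (z \<omega> k))) \<in> borel_measurable (step_law ({s} \<times> {..<d}))"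
      by measurable
  qed
  then show ?thesis unfolding D0 z_def .
qed

section \<open>Several steps of the killed walk\<close>

definition position :: "(nat \<Rightarrow> real) \<Rightarrow> (nat \<times> nat \<Rightarrow> real) \<Rightarrow> nat \<Rightarrow> nat \<Rightarrow> real" where
  "position y \<omega> s k = y k + (\<Sum>i=1..s. \<omega> (i, k))"

lemma position_0: "position y \<omega> 0 = y"
  by (simp add: position_def fun_eq_iff)

lemma position_measurable:
  assumes "s \<le> N" "k < d"
  shows "(\<lambda>\<omega>. position y \<omega> s k) \<in> borel_measurable (step_law ({1..N} \<times> {..<d}))"
  unfolding position_def
proof (intro borel_measurable_add borel_measurable_const borel_measurable_sum)
  fix i assume "i \<in> {1..s}"
  then show "(\<lambda>\<omega>. \<omega> (i, k)) \<in> borel_measurable (step_law ({1..N} \<times> {..<d}))"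
    using assms measurable_component_singleton[of "(i, k)" "{1..N} \<times> {..<d}" "\<lambda>_. gamma_law 0"] by simp
qed

lemma walk_determinant_integrable:
  assumes v: "\<And>k l. half_exp_bounded (v k l)"
    and g: "Measurable.pred (step_law ({1..s} \<times> {..<d})) g"
  shows "integrable (step_law ({1..s} \<times> {..<d}))
     (\<lambda>\<omega>. of_bool (g \<omega>) * pdet {..<d} (\<lambda>k l. v k l (position y \<omega> s k)))"
proof -
  obtain C where C: "\<And>k l. 0 \<le> C k l" "\<And>k l u. \<bar>v k l u\<bar> \<le> C k l * exp (\<bar>u\<bar> / 2)"
    using half_exp_bounded_constants[of v] v by blast
  define B where "B = (\<Sum>k<d. \<Sum>l<d. C k l * exp (\<bar>y k\<bar> / 2))"
  have B: "C k l * exp (\<bar>y k\<bar> / 2) \<le> B" if "k < d" "l < d" for k l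
  proof -
    have "C k l * exp (\<bar>y k\<bar> / 2) \<le> (\<Sum>l<d. C k l * exp (\<bar>y k\<bar> / 2))"
      using that C by (intro member_le_sum) auto
    also have "\<dots> \<le> B" unfolding B_def
      using that C by (intro member_le_sum[where f="\<lambda>k. \<Sum>l<d. C k l * exp (\<bar>y k\<bar> / 2)"])
         (auto intro!: sum_nonneg)
    finally show ?thesis .
  qed
  have B0: "0 \<le> B" unfolding B_def using C by (auto intro!: sum_nonneg)
  note [measurable] = half_exp_bounded_measurable[OF v] g
  have [measurable]: "(\<lambda>\<omega>. pdet {..<d} (\<lambda>k l. v k l (position y \<omega> s k))) \<in> borel_measurable (step_law ({1..s} \<times> {..<d}))"
    unfolding pdet_def
    by (intro borel_measurable_sum borel_measurable_times borel_measurable_prod borel_measurable_const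
        measurable_compose[OF position_measurable half_exp_bounded_measurable[OF v]]) auto
  show ?thesis
  proof (rule step_law_integrable[where K="fact d * B ^ d"])
    fix \<omega> :: "nat \<times> nat \<Rightarrow> real"
    have "\<bar>pdet {..<d} (\<lambda>k l. v k l (position y \<omega> s k))\<bar> \<le>
       fact (card {..<d}) * (\<Prod>k<d. (B * (\<Prod>i=1..s. exp (\<bar>\<omega> (i, k)\<bar> / 2))) * 1)"
    proof (rule pdet_bound)
      fix k l assume kl: "k \<in> {..<d}" "l \<in> {..<d}"
      have "\<bar>v k l (position y \<omega> s k)\<bar> \<le> C k l * exp (\<bar>y k\<bar> / 2) * exp (\<bar>\<Sum>i=1..s. \<omega> (i, k)\<bar> / 2)"
        unfolding position_def by (rule half_exp_shift_bound[OF C(2) C(1)])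
      also have "\<dots> \<le> B * (\<Prod>i=1..s. exp (\<bar>\<omega> (i, k)\<bar> / 2))"
      proof (rule mult_mono)
        have "\<bar>\<Sum>i=1..s. \<omega> (i, k)\<bar> / 2 \<le> (\<Sum>i=1..s. \<bar>\<omega> (i, k)\<bar> / 2)"
          using sum_abs[of "\<lambda>i. \<omega> (i, k)" "{1..s}"] by (simp add: sum_divide_distrib[symmetric])
        then show "exp (\<bar>\<Sum>i=1..s. \<omega> (i, k)\<bar> / 2) \<le> (\<Prod>i=1..s. exp (\<bar>\<omega> (i, k)\<bar> / 2))"
          by (simp add: exp_sum[symmetric])
      qed (use B[of k l] kl B0 in auto)
      finally show "\<bar>v k l (position y \<omega> s k)\<bar> \<le> (B * (\<Prod>i=1..s. exp (\<bar>\<omega> (i, k)\<bar> / 2))) * 1" by simp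
    qed (auto intro!: mult_nonneg_nonneg prod_nonneg B0)
    also have "\<dots> = fact d * B ^ d * (\<Prod>k<d. \<Prod>i=1..s. exp (\<bar>\<omega> (i, k)\<bar> / 2))"
      by (simp add: prod.distrib)
    also have "(\<Prod>k<d. \<Prod>i=1..s. exp (\<bar>\<omega> (i, k)\<bar> / 2)) = (\<Prod>p\<in>{1..s} \<times> {..<d}. exp (\<bar>\<omega> p\<bar> / 2))"
      by (subst prod.swap) (simp add: prod.cartesian_product)
    finally show "\<bar>of_bool (g \<omega>) * pdet {..<d} (\<lambda>k l. v k l (position y \<omega> s k))\<bar> \<le>
       fact d * B ^ d * (\<Prod>p\<in>{1..s} \<times> {..<d}. exp (\<bar>\<omega> p\<bar> / 2))"
      by (cases "g \<omega>") (auto intro!: mult_nonneg_nonneg prod_nonneg B0)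
  next
    show "(\<lambda>\<omega>. of_bool (g \<omega>) * pdet {..<d} (\<lambda>k l. v k l (position y \<omega> s k))) \<in> borel_measurable (step_law ({1..s} \<times> {..<d}))"
      by measurable
  qed auto
qed

text \<open>
  Only the particle \<open>c\<close> is constrained, to the set \<open>C t\<close> at time \<open>t\<close>.
\<close>

definition confined :: "nat \<Rightarrow> nat \<Rightarrow> (nat \<Rightarrow> real set) \<Rightarrow> nat \<Rightarrow> (nat \<Rightarrow> nat \<Rightarrow> real) \<Rightarrow> bool" where
  "confined d c C s z \<longleftrightarrow> (\<forall>t\<in>{1..s}. ordered d (z t) \<and> z t c \<in> C t)"

lemma confined_measurable:
  assumes "c < d" "\<And>t. C t \<in> sets borel"
  shows "Measurable.pred (step_law ({1..s} \<times> {..<d})) (\<lambda>\<omega>. confined d c C s (position y \<omega>))"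
  unfolding confined_def
proof (intro pred_intros_finite pred_intros_logic)
  fix t assume "t \<in> {1..s}"
  then show "Measurable.pred (step_law ({1..s} \<times> {..<d})) (\<lambda>\<omega>. ordered d (position y \<omega> t))"
    by (intro pred_ordered position_measurable) auto
  show "Measurable.pred (step_law ({1..s} \<times> {..<d})) (\<lambda>\<omega>. position y \<omega> t c \<in> C t)"
    using \<open>t \<in> _\<close> assms by (intro pred_sets2[OF assms(2)] position_measurable) auto
qed simp

text \<open>
  The increments of the last step are integrated out first, for fixed earlier ones.
\<close>

lemma walk_expectation:
  assumes y: "ordered d y" and c: "c < d" and C: "\<And>t. C t \<in> sets borel"
    and v: "\<And>s k l. half_exp_bounded (v s k l)"
    and step: "\<And>s y. s < N \<Longrightarrow> ordered d y \<Longrightarrow>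
       (\<integral>\<omega>. of_bool (ordered d (\<lambda>k. y k + \<omega> (Suc s, k)) \<and> y c + \<omega> (Suc s, c) \<in> C (Suc s)) *
         pdet {..<d} (\<lambda>k l. v (Suc s) k l (y k + \<omega> (Suc s, k))) \<partial>step_law ({Suc s} \<times> {..<d})) =
       pdet {..<d} (\<lambda>k l. v s k l (y k))"
  shows "s \<le> N \<Longrightarrow> (\<integral>\<omega>. of_bool (confined d c C s (position y \<omega>)) *
       pdet {..<d} (\<lambda>k l. v s k l (position y \<omega> s k)) \<partial>step_law ({1..s} \<times> {..<d})) =
     pdet {..<d} (\<lambda>k l. v 0 k l (y k))"
proof (induction s)
  case 0
  show ?case
    by (simp add: PiM_empty lebesgue_integral_count_space_finite position_0 confined_def)
next
  case (Suc s)
  let ?I = "{1..s} \<times> {..<d}" and ?J = "{Suc s} \<times> {..<d}"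
  let ?f = "\<lambda>\<omega>. of_bool (confined d c C (Suc s) (position y \<omega>)) *
       pdet {..<d} (\<lambda>k l. v (Suc s) k l (position y \<omega> (Suc s) k))"
  have IJ: "{1..Suc s} \<times> {..<d} = ?I \<union> ?J" "?I \<inter> ?J = {}" by auto
  have "integrable (step_law ({1..Suc s} \<times> {..<d})) ?f"
    by (intro walk_determinant_integrable v confined_measurable c C)
  then have "(\<integral>\<omega>. ?f \<omega> \<partial>step_law ({1..Suc s} \<times> {..<d})) =
      (\<integral>\<omega>. (\<integral>\<eta>. ?f (merge ?I ?J (\<omega>, \<eta>)) \<partial>step_law ?J) \<partial>step_law ?I)"
    unfolding IJ(1)
    by (intro product_sigma_finite.product_integral_fold[OF product_sigma_finite_gamma_law IJ(2)]) auto
  also have "\<dots> = (\<integral>\<omega>. of_bool (confined d c C s (position y \<omega>)) *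
       pdet {..<d} (\<lambda>k l. v s k l (position y \<omega> s k)) \<partial>step_law ?I)"
  proof (rule Bochner_Integration.integral_cong[OF refl])
    fix \<omega> :: "nat \<times> nat \<Rightarrow> real"
    have past: "position y (merge ?I ?J (\<omega>, \<eta>)) t k = position y \<omega> t k" if "t \<le> s" "k < d" for t k \<eta>
      unfolding position_def merge_def using that by (intro arg_cong2[where f="(+)"] refl sum.cong) auto
    have now: "position y (merge ?I ?J (\<omega>, \<eta>)) (Suc s) k = position y \<omega> s k + \<eta> (Suc s, k)" if "k < d" for k \<eta>
    proof -
      have "position y (merge ?I ?J (\<omega>, \<eta>)) (Suc s) k = 
         position y (merge ?I ?J (\<omega>, \<eta>)) s k + merge ?I ?J (\<omega>, \<eta>) (Suc s, k)"
        by (simp add: position_def)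
      then show ?thesis using that past[of s k \<eta>] by (simp add: merge_def)
    qed
    have ord: "ordered d z = ordered d z'" if "\<And>k. k < d \<Longrightarrow> z k = z' k" for z z'
      unfolding ordered_def using that by auto
    have conf: "confined d c C (Suc s) (position y (merge ?I ?J (\<omega>, \<eta>))) \<longleftrightarrow>
      confined d c C s (position y \<omega>) \<and>
      (ordered d (\<lambda>k. position y \<omega> s k + \<eta> (Suc s, k)) \<and> position y \<omega> s c + \<eta> (Suc s, c) \<in> C (Suc s))" for \<eta>
    proof -
      have "{1..Suc s} = insert (Suc s) {1..s}" by auto
      then have "confined d c C (Suc s) (position y (merge ?I ?J (\<omega>, \<eta>))) \<longleftrightarrow>
         (\<forall>t\<in>{1..s}. ordered d (position y (merge ?I ?J (\<omega>, \<eta>)) t) \<and> position y (merge ?I ?J (\<omega>, \<eta>)) t c \<in> C t) \<and>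
         (ordered d (position y (merge ?I ?J (\<omega>, \<eta>)) (Suc s)) \<and> position y (merge ?I ?J (\<omega>, \<eta>)) (Suc s) c \<in> C (Suc s))"
        unfolding confined_def by auto
      also have "(\<forall>t\<in>{1..s}. ordered d (position y (merge ?I ?J (\<omega>, \<eta>)) t) \<and> position y (merge ?I ?J (\<omega>, \<eta>)) t c \<in> C t) \<longleftrightarrow>
          confined d c C s (position y \<omega>)"
        unfolding confined_def using past c by (intro ball_cong refl conj_cong ord) auto
      also have "ordered d (position y (merge ?I ?J (\<omega>, \<eta>)) (Suc s)) \<longleftrightarrow> ordered d (\<lambda>k. position y \<omega> s k + \<eta> (Suc s, k))"
        by (rule ord) (rule now)
      finally show ?thesis using now[OF c] by simp
    qed
    have det: "pdet {..<d} (\<lambda>k l. v (Suc s) k l (position y (merge ?I ?J (\<omega>, \<eta>)) (Suc s) k)) =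
        pdet {..<d} (\<lambda>k l. v (Suc s) k l (position y \<omega> s k + \<eta> (Suc s, k)))" for \<eta>
      by (rule pdet_cong) (simp only: lessThan_iff now)
    show "(\<integral>\<eta>. ?f (merge ?I ?J (\<omega>, \<eta>)) \<partial>step_law ?J) = of_bool (confined d c C s (position y \<omega>)) *
       pdet {..<d} (\<lambda>k l. v s k l (position y \<omega> s k))"
    proof (cases "confined d c C s (position y \<omega>)")
      case False
      then show ?thesis unfolding conf by simp
    next
      case True
      have "ordered d (position y \<omega> s)"
        using True y by (cases "s = 0") (auto simp: confined_def position_0)
      then show ?thesis unfolding conf det using True step[of s "position y \<omega> s"] Suc.prems by simp
    qed
  qed
  also have "\<dots> = pdet {..<d} (\<lambda>k l. v 0 k l (y k))" using Suc by simp
  finally show ?case .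
qed

section \<open>Constraints on the largest or the smallest particle\<close>

text \<open>
  The mean of \<open>b\<close> at time \<open>s + n\<close> for a single unordered walk that has to lie in \<open>C t\<close> at the times
  $s < t \le s + n$, as a function of its position at time \<open>s\<close>.
\<close>

fun survive :: "(nat \<Rightarrow> real set) \<Rightarrow> nat \<Rightarrow> nat \<Rightarrow> (real \<Rightarrow> real) \<Rightarrow> real \<Rightarrow> real" where
  "survive C s 0 b = b"
| "survive C s (Suc n) b = exp_step (\<lambda>u. indicator (C (Suc s)) u * survive C (Suc s) n b u)"

lemma half_exp_bounded_survive:
  assumes "\<And>t. C t \<in> sets borel" "half_exp_bounded b"
  shows "half_exp_bounded (survive C s n b)"
  using assms by (induction n arbitrary: s) (auto intro!: half_exp_bounded_exp_step half_exp_bounded_indicator)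

lemma survive_add: "survive C s (i + j) b = survive C s i (survive C (s + i) j b)"
  by (induction i arbitrary: s) auto

lemma survive_free:
  assumes "\<And>t. s < t \<Longrightarrow> t \<le> s + n \<Longrightarrow> C t = UNIV"
  shows "survive C s n b = (exp_step ^^ n) b"
  using assms
proof (induction n arbitrary: s)
  case (Suc n)
  have "survive C (Suc s) n b = (exp_step ^^ n) b" by (rule Suc.IH) (use Suc.prems in auto)
  moreover have "C (Suc s) = UNIV" using Suc.prems by auto
  ultimately show ?case by simp
qed simp

lemma survive_next:
  assumes "s < s'" "s' \<le> T" "\<And>t. s < t \<Longrightarrow> t < s' \<Longrightarrow> C t = UNIV"
  shows "survive C s (T - s) b = (exp_step ^^ (s' - s)) (\<lambda>u. indicator (C s') u * survive C s' (T - s') b u)"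
proof -
  have T: "T - s = (s' - Suc s) + Suc (T - s')" using assms by simp
  have s': "Suc (s + (s' - Suc s)) = s'" using assms by simp
  have "survive C s (T - s) b = survive C s (s' - Suc s) (survive C (s + (s' - Suc s)) (Suc (T - s')) b)"
    unfolding T survive_add by (rule refl)
  also have "\<dots> = (exp_step ^^ (s' - Suc s)) (survive C (s + (s' - Suc s)) (Suc (T - s')) b)"
    using assms by (intro survive_free) auto
  also have "survive C (s + (s' - Suc s)) (Suc (T - s')) b = exp_step (\<lambda>u. indicator (C s') u * survive C s' (T - s') b u)"
    by (simp only: survive.simps s')
  also have "(exp_step ^^ (s' - Suc s)) \<dots> = (exp_step ^^ Suc (s' - Suc s)) (\<lambda>u. indicator (C s') u * survive C s' (T - s') b u)"
    by (simp only: funpow_Suc_right o_apply)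
  also have "Suc (s' - Suc s) = s' - s" using assms by simp
  finally show ?thesis .
qed

text \<open>
  The walk moves upwards, so it cannot return to a set that is closed downwards.
\<close>

lemma survive_vanish:
  assumes C: "\<And>t. C t \<in> sets borel" and b: "half_exp_bounded b"
    and down: "\<And>t u w. w \<in> C t \<Longrightarrow> u \<le> w \<Longrightarrow> u \<in> C t"
    and "u \<notin> C j" "s < j" "j \<le> s + n"
  shows "survive C s n b u = 0"
  using assms(4-6)
proof (induction n arbitrary: s u)
  case (Suc n)
  have "survive C s (Suc n) b u = exp_step (\<lambda>u. 0) u"
    unfolding survive.simps
  proof (rule exp_step_cong)
    show "(\<lambda>u. indicator (C (Suc s)) u * survive C (Suc s) n b u) \<in> borel_measurable borel"
      by (intro half_exp_bounded_measurable half_exp_bounded_indicator half_exp_bounded_survive C b)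
    fix w assume "u \<le> w"
    then have "w \<notin> C j" using down Suc.prems(1) by blast
    show "indicator (C (Suc s)) w * survive C (Suc s) n b w = 0"
    proof (cases "j = Suc s")
      case True then show ?thesis using \<open>w \<notin> C j\<close> by simp
    next
      case False
      then have "survive C (Suc s) n b w = 0" using \<open>w \<notin> C j\<close> Suc.prems by (intro Suc.IH) auto
      then show ?thesis by simp
    qed
  qed simp
  then show ?case by (simp add: exp_step_def)
qed simp

text \<open>
  In row \<open>k\<close> on the left the walk makes all its \<open>k + 1\<close> steps before it meets the threshold, on the
  right only one of them. The two rows agree above \<open>a\<close>. Below \<open>a\<close>, the row on the right is
  $e^{y-a}$ times the value of the left one at \<open>a\<close>. The row on the left is a combination of the values
  at \<open>a\<close> of its predecessors, as the walk may pass \<open>a\<close> at any of its steps. As the points are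
  ordered, all earlier rows belong to points below \<open>a\<close> as well and provide these values.
\<close>

lemma threshold_row_operations:
  assumes y: "ordered d y" and v: "\<And>l. half_exp_bounded (v l)"
  shows "pdet {..<d} (\<lambda>k l. (exp_step ^^ Suc k) (\<lambda>u. indicator {a..} u * v l u) (y k)) =
    pdet {..<d} (\<lambda>k l. exp_step (\<lambda>u. indicator {a..} u * (exp_step ^^ k) (v l) u) (y k))"
proof -
  define g where "g l = (\<lambda>u. indicator {a..} u * v l u)" for l
  define G where "G k l = (exp_step ^^ Suc k) (g l)" for k l
  define f where "f k l = (\<lambda>u. indicator {a..} u * (exp_step ^^ k) (v l) u)" for k l
  define W where "W k l = exp_step (f k l)" for k l
  (* R averages over steps that do not pass a, and e y is the probability to pass a at the next step. *)
  define R where "R h = exp_step (\<lambda>u. indicator {..a} u * h u)" for h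
  define e where "e = (\<lambda>y. indicator {..a} y * exp (y - a))"
  have hg: "half_exp_bounded (g l)" for l unfolding g_def by (intro half_exp_bounded_indicator v) simp
  have hf: "half_exp_bounded (f k l)" for k l
    unfolding f_def by (intro half_exp_bounded_indicator half_exp_bounded_funpow v) simp
  have hG: "half_exp_bounded (G k l)" for k l unfolding G_def by (intro half_exp_bounded_funpow hg)
  have he: "half_exp_bounded ((R ^^ j) e)" for j
  proof (induction j)
    case 0
    show ?case
    proof (rule half_exp_boundedI[of _ 1])
      show "(R ^^ 0) e \<in> borel_measurable borel" unfolding e_def by simp
      fix y :: real
      have "\<bar>e y\<bar> \<le> 1" by (auto simp: e_def split: split_indicator)
      also have "1 \<le> exp (\<bar>y\<bar> / 2)" by simp
      finally show "\<bar>(R ^^ 0) e y\<bar> \<le> 1 * exp (\<bar>y\<bar> / 2)" by simp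
    qed
  next
    case (Suc j)
    then show ?case unfolding funpow.simps o_apply R_def
      by (intro half_exp_bounded_exp_step half_exp_bounded_indicator) auto
  qed
  have above: "(exp_step ^^ j) (g l) z = (exp_step ^^ j) (v l) z" if "a \<le> z" for j l z
    using that
  proof (induction j arbitrary: z)
    case (Suc j)
    have "exp_step ((exp_step ^^ j) (g l)) z = exp_step ((exp_step ^^ j) (v l)) z"
      using Suc.prems
      by (intro exp_step_cong half_exp_bounded_measurable half_exp_bounded_funpow hg v Suc.IH) auto
    then show ?case by simp
  qed (simp add: g_def)
  have W_above: "W k l z = G k l z" if "a \<le> z" for k l z
  proof -
    have "W k l z = exp_step ((exp_step ^^ k) (v l)) z"
      unfolding W_def using that
      by (intro exp_step_cong half_exp_bounded_measurable half_exp_bounded_funpow hf v) (auto simp: f_def)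
    also have "\<dots> = G k l z" using above[OF that, of "Suc k" l] by (simp add: G_def)
    finally show ?thesis .
  qed
  have W_below: "W k l z = exp (z - a) * G k l a" if "z \<le> a" for k l z
  proof -
    have "exp_step (\<lambda>u. indicator {..a} u * f k l u) z = exp_step (\<lambda>u. indicator {a} u * f k l u) z"
      by (intro arg_cong[where f="\<lambda>h. exp_step h z"]) (auto simp: fun_eq_iff f_def split: split_indicator)
    also have "\<dots> = 0" by (intro exp_step_singleton half_exp_bounded_measurable hf)
    finally have "exp_step (f k l) z - exp (z - a) * exp_step (f k l) a = 0"
      using exp_step_memoryless[OF hf that, of k l] by simp
    then show ?thesis using W_above[of a k l] by (simp add: W_def)
  qed
  have G_below: "G k l z = (\<Sum>i\<le>k. G i l a * (R ^^ (k - i)) e z)" if "z \<le> a" for k l z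
    using that
  proof (induction k arbitrary: z)
    case 0
    have "G 0 l z = W 0 l z" by (simp add: G_def W_def f_def g_def)
    then show ?case using W_below[of z 0 l] 0 by (simp add: e_def)
  next
    case (Suc k)
    have "G (Suc k) l z = exp_step (G k l) z" by (simp add: G_def)
    also have "\<dots> = exp_step (\<lambda>u. indicator {..a} u * G k l u) z + exp (z - a) * exp_step (G k l) a"
      using exp_step_memoryless[OF hG Suc.prems, of k l] by simp
    also have "exp_step (G k l) a = G (Suc k) l a" by (simp add: G_def)
    also have "(\<lambda>u. indicator {..a} u * G k l u) = (\<lambda>u. \<Sum>i\<le>k. G i l a * (indicator {..a} u * (R ^^ (k - i)) e u))"
      using Suc.IH by (auto simp: fun_eq_iff sum_distrib_left mult_ac split: split_indicator)
    also have "exp_step \<dots> z = (\<Sum>i\<le>k. G i l a * R ((R ^^ (k - i)) e) z)"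
      unfolding R_def[symmetric]
      by (subst exp_step_sum) (auto intro!: half_exp_bounded_indicator he simp: R_def)
    also have "\<dots> = (\<Sum>i\<le>k. G i l a * (R ^^ (Suc k - i)) e z)"
      by (intro sum.cong refl) (simp add: Suc_diff_le)
    also have "exp (z - a) = (R ^^ (Suc k - Suc k)) e z" using Suc.prems by (simp add: e_def)
    finally show ?case by (simp add: mult.commute)
  qed
  define L where "L k i = (if a \<le> y k then of_bool (i = k) else (R ^^ (k - i)) e (y k) / exp (y i - a))" for k i
  have "pdet {..<d} (\<lambda>k l. G k l (y k)) = pdet {..<d} (\<lambda>k l. W k l (y k))"
  proof (rule pdet_unitriangular_rows[where L=L])
    fix k l assume "k < d" "l < d"
    show "G k l (y k) = (\<Sum>i\<le>k. L k i * W i l (y i))"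
    proof (cases "a \<le> y k")
      case True
      have "(\<Sum>i\<le>k. L k i * W i l (y i)) = (\<Sum>i\<le>k. if i = k then W i l (y i) else 0)"
        by (intro sum.cong refl) (simp add: L_def True)
      then show ?thesis using W_above[OF True, of k l] by simp
    next
      case False
      then have "y k \<le> a" by simp
      have "(\<Sum>i\<le>k. L k i * W i l (y i)) = (\<Sum>i\<le>k. G i l a * (R ^^ (k - i)) e (y k))"
      proof (intro sum.cong refl)
        fix i assume "i \<in> {..k}"
        then have "y i \<le> a" using ordered_mono[OF y, of i k] \<open>k < d\<close> \<open>y k \<le> a\<close> by simp
        then show "L k i * W i l (y i) = G i l a * (R ^^ (k - i)) e (y k)"
          using False by (simp add: L_def W_below)
      qed
      then show ?thesis using G_below[OF \<open>y k \<le> a\<close>] by simp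
    qed
  qed (auto simp: L_def e_def)
  then show ?thesis by (simp only: G_def W_def g_def f_def)
qed

text \<open>
  Row \<open>k\<close> at time \<open>s\<close> is the last row at time $s + d - 1 - k$, so that going back by one step shifts the
  rows; the time is prolonged by $d - 1$ free steps to fill the rows at the end, where the function
  \<open>inv_power (d - 1) l\<close> makes the last row equal to $u^l$ at time \<open>N\<close>. The hypothesis of
  \<open>one_step_determinant\<close> relates the rows below all later levels only, which is enough: above one of
  these levels the last row vanishes, and so does the determinant.
\<close>

lemma largest_walk_determinant:
  assumes d: "1 \<le> d" "d - 1 \<le> N" and y: "ordered d y" and C: "\<And>t. C t \<in> sets borel"
    and down: "\<And>t u w. w \<in> C t \<Longrightarrow> u \<le> w \<Longrightarrow> u \<in> C t" and free: "\<And>t. N < t \<Longrightarrow> C t = UNIV"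
  shows "(\<integral>\<omega>. of_bool (confined d (d - 1) C N (position y \<omega>)) *
       pdet {..<d} (\<lambda>k l. (exp_step ^^ k) (\<lambda>u. u ^ l) (position y \<omega> N k)) \<partial>step_law ({1..N} \<times> {..<d})) =
     pdet {..<d} (\<lambda>k l. survive C (d - 1 - k) (N - (d - 1 - k)) (\<lambda>u. u ^ l) (y k))"
proof -
  define v where "v s k l = survive C (s + (d - 1 - k)) (N + (d - 1) - (s + (d - 1 - k))) (inv_power (d - 1) l)" for s k l
  have hv: "half_exp_bounded (v s k l)" for s k l
    unfolding v_def by (intro half_exp_bounded_survive C half_exp_bounded_inv_power)
  have "(\<integral>\<omega>. of_bool (confined d (d - 1) C N (position y \<omega>)) *
       pdet {..<d} (\<lambda>k l. v N k l (position y \<omega> N k)) \<partial>step_law ({1..N} \<times> {..<d})) =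
     pdet {..<d} (\<lambda>k l. v 0 k l (y k))"
  proof (rule walk_expectation[OF y _ C hv])
    fix s :: nat and y :: "nat \<Rightarrow> real" assume s: "s < N" and y: "ordered d y"
    (* the half-line below all present and later levels *)
    define A where "A = (\<Inter>t\<in>{Suc s..}. C t)"
    have A [measurable]: "A \<in> sets borel" unfolding A_def using C by (intro sets.countable_INT) auto
    have A_down: "u \<in> A" if "w \<in> A" "u \<le> w" for u w using that down unfolding A_def by blast
    have v_step: "v s k l = exp_step (\<lambda>u. indicator (C (Suc (s + (d - 1 - k)))) u * v (Suc s) k l u)" for k l
    proof -
      have n: "N + (d - 1) - (s + (d - 1 - k)) = Suc (N + (d - 1) - (Suc s + (d - 1 - k)))"
        using s by simp
      show ?thesis unfolding v_def n by simp
    qed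
    have v_shift: "v (Suc s) (Suc k) l = v s k l" if "Suc k < d" for k l
    proof -
      have "Suc s + (d - 1 - Suc k) = s + (d - 1 - k)" using that by simp
      then show ?thesis unfolding v_def by (simp only:)
    qed
    have v_vanish: "v (Suc s) k l u = 0" if "k = d - 1" "u \<notin> A" "u \<in> C (Suc s)" for k l u
    proof -
      from that(2) obtain t where "t \<in> {Suc s..}" and t2: "u \<notin> C t" unfolding A_def by blast
      then have t: "Suc s \<le> t" "u \<notin> C t" by simp_all
      have "t \<noteq> Suc s" using that(3) t2 by blast
      moreover have "t \<le> N"
      proof (rule ccontr)
        assume "\<not> t \<le> N"
        then have "C t = UNIV" by (intro free) simp
        then show False using t2 by simp
      qed
      ultimately show ?thesis unfolding v_def using t that(1)
        by (intro survive_vanish[where C=C and j=t, OF C half_exp_bounded_inv_power _ t(2)]) (auto intro: down)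
    qed
    have "(\<integral>\<omega>. of_bool (ordered d (\<lambda>k. y k + \<omega> (Suc s, k)) \<and> y (d - 1) + \<omega> (Suc s, d - 1) \<in> C (Suc s)) *
         pdet {..<d} (\<lambda>k l. v (Suc s) k l (y k + \<omega> (Suc s, k))) \<partial>step_law ({Suc s} \<times> {..<d})) =
       (\<integral>\<omega>. of_bool (ordered d (\<lambda>k. y k + \<omega> (Suc s, k)) \<and> (\<forall>k<d. y k + \<omega> (Suc s, k) \<in> A)) *
         pdet {..<d} (\<lambda>k l. v (Suc s) k l (y k + \<omega> (Suc s, k))) \<partial>step_law ({Suc s} \<times> {..<d}))"
    proof (rule Bochner_Integration.integral_cong[OF refl])
      fix \<omega> :: "nat \<times> nat \<Rightarrow> real"
      define z where "z k = y k + \<omega> (Suc s, k)" for k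
      have "of_bool (ordered d z \<and> z (d - 1) \<in> C (Suc s)) * pdet {..<d} (\<lambda>k l. v (Suc s) k l (z k)) =
         of_bool (ordered d z \<and> (\<forall>k<d. z k \<in> A)) * pdet {..<d} (\<lambda>k l. v (Suc s) k l (z k))"
      proof (cases "ordered d z \<and> z (d - 1) \<in> C (Suc s)")
        case True
        show ?thesis
        proof (cases "z (d - 1) \<in> A")
          case A: True
          have "z k \<in> A" if "k < d" for k
          proof -
            have "z k \<le> z (d - 1)" using True that by (intro ordered_mono[of d]) auto
            then show ?thesis using A A_down by blast
          qed
          then show ?thesis using True by simp
        next
          case False
          have "pdet {..<d} (\<lambda>k l. v (Suc s) k l (z k)) = 0"
            using d False True v_vanish by (intro pdet_row_zero[of _ "d - 1"]) auto
          then show ?thesis by simp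
        qed
      next
        case False
        have "A \<subseteq> C (Suc s)" unfolding A_def by auto
        moreover have "d - 1 < d" using d by simp
        ultimately have "\<not> (ordered d z \<and> (\<forall>k<d. z k \<in> A))" using False by blast
        then show ?thesis using False by (simp only: of_bool_eq mult_zero_left)
      qed
      then show "of_bool (ordered d (\<lambda>k. y k + \<omega> (Suc s, k)) \<and> y (d - 1) + \<omega> (Suc s, d - 1) \<in> C (Suc s)) *
         pdet {..<d} (\<lambda>k l. v (Suc s) k l (y k + \<omega> (Suc s, k))) =
         of_bool (ordered d (\<lambda>k. y k + \<omega> (Suc s, k)) \<and> (\<forall>k<d. y k + \<omega> (Suc s, k) \<in> A)) *
         pdet {..<d} (\<lambda>k l. v (Suc s) k l (y k + \<omega> (Suc s, k)))" unfolding z_def .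
    qed
    also have "\<dots> = pdet {..<d} (\<lambda>k l. v s k l (y k))"
    proof (rule one_step_determinant[OF y A hv])
      fix k l t assume k: "Suc k < d" and t: "t \<in> A" and yt: "y k \<le> t"
      let ?i = "Suc (s + (d - 1 - k))"
      have "(\<lambda>u. indicator (A \<inter> {..t}) u * v (Suc s) k l u) = (\<lambda>u. indicator {..t} u * (indicator (C ?i) u * v (Suc s) k l u))"
      proof
        fix u
        have "u \<le> t \<Longrightarrow> u \<in> A" using A_down[OF t] .
        moreover have "A \<subseteq> C ?i" unfolding A_def by auto
        ultimately show "indicator (A \<inter> {..t}) u * v (Suc s) k l u = indicator {..t} u * (indicator (C ?i) u * v (Suc s) k l u)"
          by (auto split: split_indicator)
      qed
      then have "exp_step (\<lambda>u. indicator (A \<inter> {..t}) u * v (Suc s) k l u) (y k) =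
          exp_step (\<lambda>u. indicator (C ?i) u * v (Suc s) k l u) (y k) -
          exp (y k - t) * exp_step (\<lambda>u. indicator (C ?i) u * v (Suc s) k l u) t"
        using exp_step_memoryless[OF half_exp_bounded_indicator[OF hv C] yt, of ?i "Suc s" k l] by simp
      then show "exp_step (\<lambda>u. indicator (A \<inter> {..t}) u * v (Suc s) k l u) (y k) =
          v s k l (y k) - exp (y k - t) * v (Suc s) (Suc k) l t"
        unfolding v_shift[OF k] by (simp only: v_step[symmetric])
    next
      fix k l assume k: "Suc k = d"
      then have "d - 1 = k" by simp
      have "A \<subseteq> C (Suc s)" unfolding A_def by auto
      then have "(\<lambda>u. indicator A u * v (Suc s) k l u) = (\<lambda>u. indicator (C (Suc s)) u * v (Suc s) k l u)"
        using v_vanish[of k] \<open>d - 1 = k\<close> by (auto simp: fun_eq_iff split: split_indicator)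
      then show "exp_step (\<lambda>u. indicator A u * v (Suc s) k l u) (y k) = v s k l (y k)"
        using v_step[of k l] \<open>d - 1 = k\<close> by simp
    qed
    finally show "(\<integral>\<omega>. of_bool (ordered d (\<lambda>k. y k + \<omega> (Suc s, k)) \<and> y (d - 1) + \<omega> (Suc s, d - 1) \<in> C (Suc s)) *
         pdet {..<d} (\<lambda>k l. v (Suc s) k l (y k + \<omega> (Suc s, k))) \<partial>step_law ({Suc s} \<times> {..<d})) =
       pdet {..<d} (\<lambda>k l. v s k l (y k))" .
  qed (use d in auto)
  moreover have "pdet {..<d} (\<lambda>k l. v N k l (z k)) = pdet {..<d} (\<lambda>k l. (exp_step ^^ k) (\<lambda>u. u ^ l) (z k))" for z
  proof -
    have "v N k l = (exp_step ^^ k) (inv_power (d - 1) l)" if "k < d" for k l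
    proof -
      have n: "N + (d - 1) - (N + (d - 1 - k)) = k" using that by simp
      show ?thesis unfolding v_def n by (rule survive_free) (simp add: free)
    qed
    then have "pdet {..<d} (\<lambda>k l. v N k l (z k)) = pdet {..<d} (\<lambda>k l. (exp_step ^^ k) (inv_power (d - 1) l) (z k))"
      by (intro pdet_cong) auto
    then show ?thesis by (simp add: pdet_inv_power)
  qed
  moreover have "pdet {..<d} (\<lambda>k l. v 0 k l (y k)) =
      pdet {..<d} (\<lambda>k l. survive C (d - 1 - k) (N - (d - 1 - k)) (\<lambda>u. u ^ l) (y k))"
  proof (rule pdet_cong)
    fix k l assume "k \<in> {..<d}"
    let ?j = "d - 1 - k"
    have n: "N + (d - 1) - (0 + ?j) = (N - ?j) + (d - 1)" "?j + (N - ?j) = N" using d by simp_all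
    have "survive C N (d - 1) (inv_power (d - 1) l) = (exp_step ^^ (d - 1)) (inv_power (d - 1 + 0) l)"
      by (simp, rule survive_free) (simp add: free)
    also have "\<dots> = (\<lambda>u. u ^ l)" by (subst funpow_exp_step_inv_power) simp
    finally show "v 0 k l (y k) = survive C ?j (N - ?j) (\<lambda>u. u ^ l) (y k)"
      unfolding v_def n(1) survive_add by (simp only: add_0 n(2))
  qed
  ultimately show ?thesis by simp
qed

text \<open>
  The constraint enters all rows, as all particles lie above the smallest one. Then the rows are no
  longer successive averages of each other, and \<open>threshold_row_operations\<close> repairs this.
\<close>

lemma smallest_walk_determinant:
  assumes d: "1 \<le> d" and y: "ordered d y"
    and C: "\<And>t. C t = UNIV \<or> (\<exists>a. C t = {a..})"
  shows "(\<integral>\<omega>. of_bool (confined d 0 C N (position y \<omega>)) *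
       pdet {..<d} (\<lambda>k l. (exp_step ^^ k) (\<lambda>u. u ^ l) (position y \<omega> N k)) \<partial>step_law ({1..N} \<times> {..<d})) =
     pdet {..<d} (\<lambda>k l. (exp_step ^^ k) (survive C 0 N (\<lambda>u. u ^ l)) (y k))"
proof -
  have Cm: "C t \<in> sets borel" for t using C[of t] by (elim disjE exE) simp_all
  have up: "w \<in> C t" if "u \<in> C t" "u \<le> w" for t u w using C[of t] that by (elim disjE exE) simp_all
  define q where "q s l = survive C s (N - s) (\<lambda>u. u ^ l)" for s l
  define v where "v s k l = (exp_step ^^ k) (q s l)" for s k l
  have hq: "half_exp_bounded (q s l)" for s l
    unfolding q_def by (intro half_exp_bounded_survive Cm half_exp_bounded_power)
  have hv: "half_exp_bounded (v s k l)" for s k l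
    unfolding v_def by (intro half_exp_bounded_funpow hq)
  have "(\<integral>\<omega>. of_bool (confined d 0 C N (position y \<omega>)) *
       pdet {..<d} (\<lambda>k l. v N k l (position y \<omega> N k)) \<partial>step_law ({1..N} \<times> {..<d})) =
     pdet {..<d} (\<lambda>k l. v 0 k l (y k))"
  proof (rule walk_expectation[OF y _ Cm hv])
    fix s :: nat and y :: "nat \<Rightarrow> real" assume s: "s < N" and y: "ordered d y"
    define A where "A = C (Suc s)"
    have Am: "A \<in> sets borel" by (simp add: A_def Cm)
    have hA: "half_exp_bounded (\<lambda>u. indicator A u * v (Suc s) k l u)" for k l
      by (intro half_exp_bounded_indicator hv Am)
    have "(\<integral>\<omega>. of_bool (ordered d (\<lambda>k. y k + \<omega> (Suc s, k)) \<and> y 0 + \<omega> (Suc s, 0) \<in> C (Suc s)) *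
         pdet {..<d} (\<lambda>k l. v (Suc s) k l (y k + \<omega> (Suc s, k))) \<partial>step_law ({Suc s} \<times> {..<d})) =
       (\<integral>\<omega>. of_bool (ordered d (\<lambda>k. y k + \<omega> (Suc s, k)) \<and> (\<forall>k<d. y k + \<omega> (Suc s, k) \<in> A)) *
         pdet {..<d} (\<lambda>k l. v (Suc s) k l (y k + \<omega> (Suc s, k))) \<partial>step_law ({Suc s} \<times> {..<d}))"
    proof (rule Bochner_Integration.integral_cong[OF refl])
      fix \<omega> :: "nat \<times> nat \<Rightarrow> real"
      define z where "z k = y k + \<omega> (Suc s, k)" for k
      have "ordered d z \<and> z 0 \<in> C (Suc s) \<longleftrightarrow> ordered d z \<and> (\<forall>k<d. z k \<in> A)"
      proof (intro conj_cong refl iffI allI impI)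
        fix k assume "ordered d z" "z 0 \<in> C (Suc s)" "k < d"
        then show "z k \<in> A" using up ordered_mono[of d z 0 k] unfolding A_def by blast
      next
        assume "\<forall>k<d. z k \<in> A"
        moreover have "0 < d" using d by simp
        ultimately show "z 0 \<in> C (Suc s)" unfolding A_def by blast
      qed
      then show "of_bool (ordered d (\<lambda>k. y k + \<omega> (Suc s, k)) \<and> y 0 + \<omega> (Suc s, 0) \<in> C (Suc s)) *
         pdet {..<d} (\<lambda>k l. v (Suc s) k l (y k + \<omega> (Suc s, k))) =
         of_bool (ordered d (\<lambda>k. y k + \<omega> (Suc s, k)) \<and> (\<forall>k<d. y k + \<omega> (Suc s, k) \<in> A)) *
         pdet {..<d} (\<lambda>k l. v (Suc s) k l (y k + \<omega> (Suc s, k)))" unfolding z_def by simp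
    qed
    also have "\<dots> = pdet {..<d} (\<lambda>k l. exp_step (\<lambda>u. indicator A u * v (Suc s) k l u) (y k))"
    proof (rule one_step_determinant[OF y Am hv, where v'="\<lambda>k l. exp_step (\<lambda>u. indicator A u * v (Suc s) k l u)"])
      fix k l t assume k: "Suc k < d" and t: "t \<in> A" and yt: "y k \<le> t"
      have "exp_step (\<lambda>u. indicator (A \<inter> {..t}) u * v (Suc s) k l u) (y k) =
          exp_step (\<lambda>u. indicator {..t} u * (indicator A u * v (Suc s) k l u)) (y k)"
        by (intro arg_cong[where f="\<lambda>h. exp_step h (y k)"]) (auto simp: fun_eq_iff split: split_indicator)
      also have "\<dots> = exp_step (\<lambda>u. indicator A u * v (Suc s) k l u) (y k) -
          exp (y k - t) * exp_step (\<lambda>u. indicator A u * v (Suc s) k l u) t"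
        by (rule exp_step_memoryless[OF hA yt])
      also have "exp_step (\<lambda>u. indicator A u * v (Suc s) k l u) t = exp_step (v (Suc s) k l) t"
      proof (intro exp_step_cong half_exp_bounded_measurable hA hv)
        fix u assume "t \<le> u"
        then have "u \<in> A" using t up unfolding A_def by blast
        then show "indicator A u * v (Suc s) k l u = v (Suc s) k l u" by simp
      qed
      also have "\<dots> = v (Suc s) (Suc k) l t" by (simp add: v_def)
      finally show "exp_step (\<lambda>u. indicator (A \<inter> {..t}) u * v (Suc s) k l u) (y k) =
         exp_step (\<lambda>u. indicator A u * v (Suc s) k l u) (y k) - exp (y k - t) * v (Suc s) (Suc k) l t" .
    qed simp
    also have "\<dots> = pdet {..<d} (\<lambda>k l. (exp_step ^^ Suc k) (\<lambda>u. indicator A u * q (Suc s) l u) (y k))"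
    proof (cases "A = UNIV")
      case True
      then show ?thesis by (simp add: v_def)
    next
      case False
      then obtain a where "A = {a..}" using C[of "Suc s"] unfolding A_def by auto
      then show ?thesis unfolding v_def using threshold_row_operations[OF y, of "q (Suc s)" a] hq by simp
    qed
    also have "\<dots> = pdet {..<d} (\<lambda>k l. v s k l (y k))"
    proof (rule pdet_cong)
      fix k l
      have "q s l = exp_step (\<lambda>u. indicator A u * q (Suc s) l u)"
      proof -
        have n: "N - s = Suc (N - Suc s)" using s by simp
        show ?thesis unfolding q_def A_def n by simp
      qed
      then show "(exp_step ^^ Suc k) (\<lambda>u. indicator A u * q (Suc s) l u) (y k) = v s k l (y k)"
        unfolding v_def by (simp only: funpow_Suc_right o_apply)
    qed
    finally show "(\<integral>\<omega>. of_bool (ordered d (\<lambda>k. y k + \<omega> (Suc s, k)) \<and> y 0 + \<omega> (Suc s, 0) \<in> C (Suc s)) *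
         pdet {..<d} (\<lambda>k l. v (Suc s) k l (y k + \<omega> (Suc s, k))) \<partial>step_law ({Suc s} \<times> {..<d})) =
       pdet {..<d} (\<lambda>k l. v s k l (y k))" .
  qed (use d in auto)
  then show ?thesis by (simp add: v_def q_def)
qed

section \<open>Fredholm series of a kernel with a nilpotent part\<close>

lemma (in pair_sigma_finite) integrable_product_mult:
  fixes f g :: "_ \<Rightarrow> real"
  assumes "integrable M1 f" "integrable M2 g"
  shows "integrable (M1 \<Otimes>\<^sub>M M2) (\<lambda>(x, y). f x * g y)"
proof (rule Fubini_integrable)
  note [measurable] = borel_measurable_integrable[OF assms(1)] borel_measurable_integrable[OF assms(2)]
  show "(\<lambda>(x, y). f x * g y) \<in> borel_measurable (M1 \<Otimes>\<^sub>M M2)" by measurable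
  show "integrable M1 (\<lambda>x. \<integral>y. norm (case (x, y) of (x, y) \<Rightarrow> f x * g y) \<partial>M2)"
    using assms by (simp add: abs_mult)
  show "AE x in M1. integrable M2 (\<lambda>y. case (x, y) of (x, y) \<Rightarrow> f x * g y)"
    using assms by simp
qed

text \<open>
  The kernel \<open>U\<close> leads to larger labels only. The weights conjugate the kernel: after division by
  \<open>w i y\<close> and multiplication by \<open>w j z\<close>, each entry is bounded by an integrable function of its second
  argument, and determinants are not changed by a conjugation.
\<close>

locale bordered_kernel =
  fixes m d :: nat and \<rho> :: "nat \<Rightarrow> real measure" and w G :: "nat \<Rightarrow> real \<Rightarrow> real"
    and K :: real and \<psi> :: "nat \<Rightarrow> nat \<Rightarrow> real \<Rightarrow> real" and U :: "nat \<Rightarrow> real \<Rightarrow> nat \<Rightarrow> real \<Rightarrow> real"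
  assumes sigma_finite: "\<And>j. sigma_finite_measure (\<rho> j)"
    and sets_\<rho> [measurable_cong]: "\<And>j. sets (\<rho> j) = sets borel"
    and w_nonneg: "\<And>j y. 0 \<le> w j y" and G_nonneg: "\<And>j y. 0 \<le> G j y" and K_nonneg: "0 \<le> K"
    and w_G_integrable: "\<And>j. j \<in> {1..m} \<Longrightarrow> integrable (\<rho> j) (\<lambda>y. w j y * G j y)"
    and \<psi>_measurable [measurable]: "\<And>l j. \<psi> l j \<in> borel_measurable borel"
    and \<psi>_bound: "\<And>l j y. l < d \<Longrightarrow> j \<in> {1..m} \<Longrightarrow> \<bar>\<psi> l j y\<bar> \<le> K * w j y"
    and U_measurable [measurable]: "\<And>i j. (\<lambda>(y, z). U i y j z) \<in> borel_measurable (borel \<Otimes>\<^sub>M borel)"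
    and U_bound: "\<And>i y j z. i \<in> {1..m} \<Longrightarrow> j \<in> {1..m} \<Longrightarrow> \<bar>U i y j z\<bar> \<le> K * w i y * G j z"
    and U_upper: "\<And>i y j z. j \<le> i \<Longrightarrow> U i y j z = 0"
begin

text \<open>
  The first index is that of a label. Rows of this kind can be integrated against \<open>\<psi>\<close> and \<open>U\<close>.
\<close>

definition dominated :: "(nat \<Rightarrow> real \<Rightarrow> real) \<Rightarrow> bool" where
  "dominated \<phi> \<longleftrightarrow> (\<forall>j. \<phi> j \<in> borel_measurable borel) \<and> (\<exists>C\<ge>0. \<forall>j\<in>{1..m}. \<forall>z. \<bar>\<phi> j z\<bar> \<le> C * G j z)"

text \<open>
  Indices below \<open>d\<close> belong to the matrix \<open>a\<close>, and the index \<open>d + s\<close> belongs to the point \<open>s\<close> with label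
  \<open>i s\<close> and position \<open>y s\<close>.
\<close>

definition bordered :: "(nat \<Rightarrow> nat \<Rightarrow> real) \<Rightarrow> (nat \<Rightarrow> nat \<Rightarrow> real \<Rightarrow> real) \<Rightarrow>
    (nat \<Rightarrow> nat) \<Rightarrow> (nat \<Rightarrow> real) \<Rightarrow> nat \<Rightarrow> nat \<Rightarrow> real" where
  "bordered a \<phi> i y r c =
     (if r < d then (if c < d then a r c else \<phi> r (i (c - d)) (y (c - d)))
      else (if c < d then \<psi> c (i (r - d)) (y (r - d)) else U (i (r - d)) (y (r - d)) (i (c - d)) (y (c - d))))"

definition idx :: "nat set \<Rightarrow> nat set" where
  "idx S = {..<d} \<union> (+) d ` S"

abbreviation points :: "nat set \<Rightarrow> (nat \<Rightarrow> nat) \<Rightarrow> (nat \<Rightarrow> real) measure" where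
  "points S i \<equiv> PiM S (\<lambda>s. \<rho> (i s))"

text \<open>
  The integral of \<open>F\<close> over all labels and positions of the points in \<open>S\<close>, that is, over \<open>S\<close>-tuples in
  \<open>m\<close> copies of the line.
\<close>

definition total :: "nat set \<Rightarrow> ((nat \<Rightarrow> nat) \<Rightarrow> (nat \<Rightarrow> real) \<Rightarrow> real) \<Rightarrow> real" where
  "total S F = (\<Sum>i\<in>S \<rightarrow>\<^sub>E {1..m}. \<integral>y. F i y \<partial>points S i)"

lemma finite_idx: "finite S \<Longrightarrow> finite (idx S)"
  by (simp add: idx_def)

lemma idx_cases: "r \<in> idx S \<longleftrightarrow> r < d \<or> (d \<le> r \<and> r - d \<in> S)"
  by (auto simp: idx_def image_iff) (metis le_add_diff_inverse)

lemma product_sigma_finite_points: "product_sigma_finite (\<lambda>s. \<rho> (i s))"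
  by (simp add: product_sigma_finite_def sigma_finite)

text \<open>
  Each permutation takes one factor \<open>w\<close> from the row and one factor \<open>G\<close> from the column of each point.
\<close>

lemma pdet_integrable:
  assumes S: "finite S" and i: "i \<in> S \<rightarrow>\<^sub>E {1..m}" and B: "0 \<le> B"
    and meas: "\<And>r c. r \<in> idx S \<Longrightarrow> c \<in> idx S \<Longrightarrow> (\<lambda>y. M y r c) \<in> borel_measurable (points S i)"
    and bound: "\<And>y r c. r \<in> idx S \<Longrightarrow> c \<in> idx S \<Longrightarrow>
      \<bar>M y r c\<bar> \<le> (B * (if r < d then 1 else w (i (r - d)) (y (r - d)))) * (if c < d then 1 else G (i (c - d)) (y (c - d)))"
  shows "integrable (points S i) (\<lambda>y. pdet (idx S) (M y))"
proof -
  let ?n = "card (idx S)"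
  have "integrable (points S i) (\<lambda>y. fact ?n * (B ^ ?n * (\<Prod>s\<in>S. w (i s) (y s) * G (i s) (y s))))"
    using i by (intro integrable_mult_right product_sigma_finite.product_integrable_prod[OF product_sigma_finite_points S]
       w_G_integrable) auto
  then show ?thesis
  proof (rule Bochner_Integration.integrable_bound)
    show "(\<lambda>y. pdet (idx S) (M y)) \<in> borel_measurable (points S i)"
      unfolding pdet_def
      by (intro borel_measurable_sum borel_measurable_times borel_measurable_prod borel_measurable_const meas)
         (auto simp: permutes_in_image)
    show "AE y in points S i. norm (pdet (idx S) (M y)) \<le>
       norm (fact ?n * (B ^ ?n * (\<Prod>s\<in>S. w (i s) (y s) * G (i s) (y s))))"
    proof (intro AE_I2)
      fix y :: "nat \<Rightarrow> real"
      let ?a = "\<lambda>r. if r < d then 1 else w (i (r - d)) (y (r - d))"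
      let ?b = "\<lambda>c. if c < d then 1 else G (i (c - d)) (y (c - d))"
      have "\<bar>pdet (idx S) (M y)\<bar> \<le> fact ?n * (\<Prod>r\<in>idx S. (B * ?a r) * ?b r)"
        by (intro pdet_bound finite_idx S bound) (auto simp: B w_nonneg G_nonneg)
      also have "(\<Prod>r\<in>idx S. (B * ?a r) * ?b r) = B ^ ?n * (\<Prod>r\<in>idx S. ?a r * ?b r)"
        by (simp add: prod.distrib mult.assoc)
      also have "(\<Prod>r\<in>idx S. ?a r * ?b r) = (\<Prod>r\<in>(+) d ` S. ?a r * ?b r)"
        by (rule prod.mono_neutral_right) (auto simp: idx_def S)
      also have "\<dots> = (\<Prod>s\<in>S. w (i s) (y s) * G (i s) (y s))"
        by (subst prod.reindex) auto
      finally show "norm (pdet (idx S) (M y)) \<le>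
         norm (fact ?n * (B ^ ?n * (\<Prod>s\<in>S. w (i s) (y s) * G (i s) (y s))))"
        unfolding real_norm_def by (rule order_trans[OF _ abs_ge_self])
    qed
  qed
qed

lemma dominatedE:
  assumes "dominated \<phi>"
  obtains C where "0 \<le> C" "\<And>j z. j \<in> {1..m} \<Longrightarrow> \<bar>\<phi> j z\<bar> \<le> C * G j z"
  using assms unfolding dominated_def by blast

lemma dominated_measurable: "dominated \<phi> \<Longrightarrow> \<phi> j \<in> borel_measurable borel"
  by (simp add: dominated_def)

lemma dominated_zero: "dominated (\<lambda>j z. 0)"
  unfolding dominated_def by (auto intro!: exI[of _ 0])

lemma bordered_measurable:
  assumes i: "i \<in> S \<rightarrow>\<^sub>E {1..m}" and \<phi>: "\<And>r. r < d \<Longrightarrow> dominated (\<phi> r)"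
    and "r \<in> idx S" "c \<in> idx S"
  shows "(\<lambda>y. bordered a \<phi> i y r c) \<in> borel_measurable (points S i)"
proof -
  have comp: "(\<lambda>y. y s) \<in> borel_measurable (points S i)" if "s \<in> S" for s
    using measurable_component_singleton[OF that, of "\<lambda>s. \<rho> (i s)"] by (simp add: measurable_cong_sets[OF refl sets_\<rho>])
  have rc: "r < d \<or> r - d \<in> S" "c < d \<or> c - d \<in> S" using assms(3,4) by (auto simp: idx_cases)
  have "(\<lambda>y. \<phi> r (i (c - d)) (y (c - d))) \<in> borel_measurable (points S i)" if "r < d" "\<not> c < d"
    using that rc by (intro measurable_compose[OF comp dominated_measurable[OF \<phi>]]) auto
  moreover have "(\<lambda>y. \<psi> c (i (r - d)) (y (r - d))) \<in> borel_measurable (points S i)" if "\<not> r < d"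
    using that rc by (intro measurable_compose[OF comp \<psi>_measurable]) auto
  moreover have "(\<lambda>y. U (i (r - d)) (y (r - d)) (i (c - d)) (y (c - d))) \<in> borel_measurable (points S i)"
    if "\<not> r < d" "\<not> c < d"
    using measurable_compose[OF measurable_Pair[OF comp comp] U_measurable, of "r - d" "c - d" "i (r - d)" "i (c - d)"] that rc
    by auto
  ultimately show ?thesis unfolding bordered_def by (cases "r < d"; cases "c < d") simp_all
qed

lemma bordered_bound:
  assumes \<phi>: "\<And>r. r < d \<Longrightarrow> dominated (\<phi> r)"
  obtains B where "0 \<le> B" "\<And>S i y r c. i \<in> S \<rightarrow>\<^sub>E {1..m} \<Longrightarrow> r \<in> idx S \<Longrightarrow> c \<in> idx S \<Longrightarrow>
      \<bar>bordered a \<phi> i y r c\<bar> \<le> (B * (if r < d then 1 else w (i (r - d)) (y (r - d)))) * (if c < d then 1 else G (i (c - d)) (y (c - d)))"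
proof -
  have "\<exists>C. 0 \<le> C \<and> (\<forall>j\<in>{1..m}. \<forall>z. \<bar>\<phi> r j z\<bar> \<le> C * G j z)" if "r < d" for r
    by (rule dominatedE[OF \<phi>[OF that]]) blast
  then obtain C where C: "\<And>r. r < d \<Longrightarrow> 0 \<le> C r" "\<And>r j z. r < d \<Longrightarrow> j \<in> {1..m} \<Longrightarrow> \<bar>\<phi> r j z\<bar> \<le> C r * G j z"
    by metis
  define B where "B = K + (\<Sum>r<d. C r) + (\<Sum>r<d. \<Sum>c<d. \<bar>a r c\<bar>)"
  have nn: "0 \<le> (\<Sum>r<d. C r)" "0 \<le> (\<Sum>r<d. \<Sum>c<d. \<bar>a r c\<bar>)" using C by (auto intro!: sum_nonneg)
  have K: "K \<le> B" and B0: "0 \<le> B" using nn K_nonneg by (auto simp: B_def)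
  have CB: "C r \<le> B" if "r < d" for r
    using member_le_sum[of r "{..<d}" C] that C nn K_nonneg by (auto simp: B_def)
  have aB: "\<bar>a r c\<bar> \<le> B" if "r < d" "c < d" for r c
  proof -
    have "\<bar>a r c\<bar> \<le> (\<Sum>c<d. \<bar>a r c\<bar>)" using that by (intro member_le_sum) auto
    also have "\<dots> \<le> (\<Sum>r<d. \<Sum>c<d. \<bar>a r c\<bar>)"
      using that by (intro member_le_sum[where f="\<lambda>r. \<Sum>c<d. \<bar>a r c\<bar>"]) (auto intro!: sum_nonneg)
    finally show ?thesis using nn K_nonneg by (simp add: B_def)
  qed
  show thesis
  proof (rule that[OF B0])
    fix S i y r c
    assume i: "i \<in> S \<rightarrow>\<^sub>E {1..m}" and "r \<in> idx S" "c \<in> idx S"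
    then have rc: "r < d \<or> i (r - d) \<in> {1..m}" "c < d \<or> i (c - d) \<in> {1..m}"
      by (auto simp: idx_cases PiE_iff)
    have "\<bar>\<phi> r (i (c - d)) (y (c - d))\<bar> \<le> B * G (i (c - d)) (y (c - d))" if "r < d" "\<not> c < d"
      using order_trans[OF C(2) mult_right_mono[OF CB]] that rc G_nonneg by auto
    moreover have "\<bar>\<psi> c (i (r - d)) (y (r - d))\<bar> \<le> B * w (i (r - d)) (y (r - d))" if "\<not> r < d" "c < d"
      using order_trans[OF \<psi>_bound mult_right_mono[OF K]] that rc w_nonneg by auto
    moreover have "\<bar>U (i (r - d)) (y (r - d)) (i (c - d)) (y (c - d))\<bar> \<le> B * w (i (r - d)) (y (r - d)) * G (i (c - d)) (y (c - d))"
      if "\<not> r < d" "\<not> c < d"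
      using order_trans[OF U_bound mult_right_mono[OF mult_right_mono[OF K]]] that rc w_nonneg G_nonneg by auto
    ultimately show "\<bar>bordered a \<phi> i y r c\<bar> \<le> (B * (if r < d then 1 else w (i (r - d)) (y (r - d)))) *
        (if c < d then 1 else G (i (c - d)) (y (c - d)))"
      using aB unfolding bordered_def by auto
  qed
qed

lemma bordered_integrable:
  assumes "finite S" "i \<in> S \<rightarrow>\<^sub>E {1..m}" "\<And>r. r < d \<Longrightarrow> dominated (\<phi> r)"
  shows "integrable (points S i) (\<lambda>y. pdet (idx S) (bordered a \<phi> i y))"
proof -
  obtain B where B: "0 \<le> B" "\<And>S i y r c. i \<in> S \<rightarrow>\<^sub>E {1..m} \<Longrightarrow> r \<in> idx S \<Longrightarrow> c \<in> idx S \<Longrightarrow>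
      \<bar>bordered a \<phi> i y r c\<bar> \<le> (B * (if r < d then 1 else w (i (r - d)) (y (r - d)))) * (if c < d then 1 else G (i (c - d)) (y (c - d)))"
    by (rule bordered_bound[where a=a and \<phi>=\<phi>]) (use assms in auto)
  show ?thesis
    by (rule pdet_integrable[OF assms(1,2) B(1)]) (use assms bordered_measurable B(2) in auto)
qed

text \<open>
  Fubini's theorem for the point \<open>s\<close>.
\<close>

lemma total_remove:
  assumes S: "finite S" "s \<in> S"
    and int: "\<And>i. i \<in> S \<rightarrow>\<^sub>E {1..m} \<Longrightarrow> integrable (points S i) (F i)"
  shows "total S F = (\<Sum>i\<in>(S - {s}) \<rightarrow>\<^sub>E {1..m}. \<Sum>j=1..m. \<integral>y. (\<integral>z. F (i(s := j)) (y(s := z)) \<partial>\<rho> j) \<partial>points (S - {s}) i)"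
proof -
  let ?S = "S - {s}"
  have ins: "insert s ?S = S" using S by auto
  have "total S F = (\<Sum>i\<in>(\<lambda>(j, i). i(s := j)) ` ({1..m} \<times> (?S \<rightarrow>\<^sub>E {1..m})). \<integral>y. F i y \<partial>points S i)"
    unfolding total_def using PiE_insert_eq[of s ?S "\<lambda>_. {1..m}"] S by (simp add: insert_absorb)
  also have "\<dots> = (\<Sum>(j, i)\<in>{1..m} \<times> (?S \<rightarrow>\<^sub>E {1..m}). \<integral>y. F (i(s := j)) y \<partial>points S (i(s := j)))"
    by (subst sum.reindex[OF inj_combinator]) (auto simp: split_def)
  also have "\<dots> = (\<Sum>j=1..m. \<Sum>i\<in>?S \<rightarrow>\<^sub>E {1..m}. \<integral>y. F (i(s := j)) y \<partial>points S (i(s := j)))"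
    by (simp add: sum.cartesian_product)
  also have "\<dots> = (\<Sum>i\<in>?S \<rightarrow>\<^sub>E {1..m}. \<Sum>j=1..m. \<integral>y. F (i(s := j)) y \<partial>points S (i(s := j)))"
    by (rule sum.swap)
  also have "\<dots> = (\<Sum>i\<in>?S \<rightarrow>\<^sub>E {1..m}. \<Sum>j=1..m. \<integral>y. (\<integral>z. F (i(s := j)) (y(s := z)) \<partial>\<rho> j) \<partial>points ?S i)"
  proof (intro sum.cong refl)
    fix i j assume i: "i \<in> ?S \<rightarrow>\<^sub>E {1..m}" and j: "j \<in> {1..m}"
    have "i(s := j) \<in> S \<rightarrow>\<^sub>E {1..m}" using i j S by (auto simp: PiE_iff extensional_def)
    then have "integrable (points (insert s ?S) (i(s := j))) (F (i(s := j)))"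
      unfolding ins by (rule int)
    then have "(\<integral>y. F (i(s := j)) y \<partial>points (insert s ?S) (i(s := j))) =
       (\<integral>y. (\<integral>z. F (i(s := j)) (y(s := z)) \<partial>\<rho> ((i(s := j)) s)) \<partial>points ?S (i(s := j)))"
      using S by (intro product_sigma_finite.product_integral_insert[OF product_sigma_finite_points]) auto
    moreover have "points ?S (i(s := j)) = points ?S i" by (intro PiM_cong) auto
    ultimately show "(\<integral>y. F (i(s := j)) y \<partial>points S (i(s := j))) =
       (\<integral>y. (\<integral>z. F (i(s := j)) (y(s := z)) \<partial>\<rho> j) \<partial>points ?S i)"
      unfolding ins by (simp only: fun_upd_same)
  qed
  finally show ?thesis .
qed

definition label_scalar :: "(nat \<Rightarrow> real \<Rightarrow> real) \<Rightarrow> nat \<Rightarrow> nat \<Rightarrow> real" where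
  "label_scalar \<phi> j c = (\<integral>z. \<phi> j z * \<psi> c j z \<partial>\<rho> j)"

definition label_row :: "(nat \<Rightarrow> real \<Rightarrow> real) \<Rightarrow> nat \<Rightarrow> nat \<Rightarrow> real \<Rightarrow> real" where
  "label_row \<phi> j j' z' = (\<integral>z. \<phi> j z * U j z j' z' \<partial>\<rho> j)"

definition push_scalar :: "(nat \<Rightarrow> real \<Rightarrow> real) \<Rightarrow> nat \<Rightarrow> real" where
  "push_scalar \<phi> c = (\<Sum>j=1..m. label_scalar \<phi> j c)"

text \<open>
  The functions \<open>push_scalar\<close> and \<open>push_row\<close> are $\int \phi \psi$ and $\int \phi U$: the row of a point, averaged
  over the point with weight \<open>\<phi>\<close>.
\<close>

definition push_row :: "(nat \<Rightarrow> real \<Rightarrow> real) \<Rightarrow> nat \<Rightarrow> real \<Rightarrow> real" where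
  "push_row \<phi> j' z' = (\<Sum>j=1..m. label_row \<phi> j j' z')"

lemma U_section_measurable [measurable]: 
  "U i y j \<in> borel_measurable borel" "(\<lambda>y. U i y j z) \<in> borel_measurable borel"
proof -
  have "(\<lambda>z. case (y, z) of (y, z) \<Rightarrow> U i y j z) \<in> borel_measurable borel"
    by (rule measurable_compose[OF _ U_measurable]) measurable
  then show "U i y j \<in> borel_measurable borel" by simp
  have "(\<lambda>y. case (y, z) of (y, z) \<Rightarrow> U i y j z) \<in> borel_measurable borel"
    by (rule measurable_compose[OF _ U_measurable]) measurable
  then show "(\<lambda>y. U i y j z) \<in> borel_measurable borel" by simp
qed

lemma integrable_by_weight:
  assumes "j \<in> {1..m}" "f \<in> borel_measurable borel" "\<And>z. \<bar>f z\<bar> \<le> B * (w j z * G j z)"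
  shows "integrable (\<rho> j) f"
proof -
  have "integrable (\<rho> j) (\<lambda>z. B * (w j z * G j z))"
    by (intro integrable_mult_right w_G_integrable assms(1))
  then show ?thesis
  proof (rule Bochner_Integration.integrable_bound)
    show "f \<in> borel_measurable (\<rho> j)" using assms(2) by (simp add: measurable_cong_sets[OF sets_\<rho> refl])
    show "AE z in \<rho> j. norm (f z) \<le> norm (B * (w j z * G j z))"
      using assms(3) by (intro AE_I2) (auto intro: order_trans[OF _ abs_ge_self])
  qed
qed

lemma dominated_mult_bound:
  assumes "\<bar>a\<bar> \<le> C * g" "\<bar>b\<bar> \<le> K' * (w' :: real)" "0 \<le> C" "0 \<le> g"
  shows "\<bar>a * b\<bar> \<le> C * K' * (w' * g)"
proof -
  have "\<bar>a\<bar> * \<bar>b\<bar> \<le> (C * g) * (K' * w')" using assms by (intro mult_mono) auto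
  then show ?thesis by (simp add: abs_mult mult_ac)
qed

lemma label_scalar_integrable:
  assumes "dominated \<phi>" "j \<in> {1..m}" "c < d"
  shows "integrable (\<rho> j) (\<lambda>z. \<phi> j z * \<psi> c j z)"
proof -
  obtain C where C: "0 \<le> C" "\<And>j z. j \<in> {1..m} \<Longrightarrow> \<bar>\<phi> j z\<bar> \<le> C * G j z" using dominatedE[OF assms(1)] by metis
  show ?thesis
  proof (rule integrable_by_weight[OF assms(2), where B="C * K"])
    show "(\<lambda>z. \<phi> j z * \<psi> c j z) \<in> borel_measurable borel"
      using dominated_measurable[OF assms(1)] by measurable
    show "\<bar>\<phi> j z * \<psi> c j z\<bar> \<le> C * K * (w j z * G j z)" for z
      by (rule dominated_mult_bound[OF C(2)[OF assms(2)] \<psi>_bound[OF assms(3,2)] C(1) G_nonneg])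
  qed
qed

lemma label_row_bound:
  assumes "j \<in> {1..m}" "j' \<in> {1..m}" "0 \<le> C" "\<And>z. \<bar>\<phi> j z\<bar> \<le> C * G j z"
  shows "\<bar>\<phi> j z * U j z j' z'\<bar> \<le> (C * K * G j' z') * (w j z * G j z)"
proof -
  have "\<bar>\<phi> j z * U j z j' z'\<bar> \<le> C * K * ((w j z * G j' z') * G j z)"
    using U_bound[OF assms(1,2), of z z'] assms(3,4) G_nonneg by (intro dominated_mult_bound) (auto simp: mult.assoc)
  then show ?thesis by (simp add: mult_ac)
qed

lemma label_row_integrable:
  assumes "dominated \<phi>" "j \<in> {1..m}" "j' \<in> {1..m}"
  shows "integrable (\<rho> j) (\<lambda>z. \<phi> j z * U j z j' z')"
proof -
  obtain C where C: "0 \<le> C" "\<And>j z. j \<in> {1..m} \<Longrightarrow> \<bar>\<phi> j z\<bar> \<le> C * G j z" using dominatedE[OF assms(1)] by metis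
  show ?thesis
  proof (rule integrable_by_weight[OF assms(2)])
    show "\<bar>\<phi> j z * U j z j' z'\<bar> \<le> (C * K * G j' z') * (w j z * G j z)" for z
      by (intro label_row_bound assms C)
    show "(\<lambda>z. \<phi> j z * U j z j' z') \<in> borel_measurable borel"
      using dominated_measurable[OF assms(1)] by measurable
  qed
qed

lemma label_row_dominated:
  assumes "dominated \<phi>" "j \<in> {1..m}"
  shows "dominated (label_row \<phi> j)"
  unfolding dominated_def
proof (intro conjI allI)
  fix j'
  interpret sigma_finite_measure "\<rho> j" by (rule sigma_finite)
  note [measurable] = dominated_measurable[OF assms(1), of j]
  have [measurable]: "(\<lambda>(z', z). U j z j' z') \<in> borel_measurable (borel \<Otimes>\<^sub>M borel)"
    using measurable_compose[OF measurable_pair_swap' U_measurable[of j j']] by (simp add: split_def)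
  have "(\<lambda>(z', z). \<phi> j z * U j z j' z') \<in> borel_measurable (borel \<Otimes>\<^sub>M \<rho> j)"
    by measurable
  then show "label_row \<phi> j j' \<in> borel_measurable borel"
    unfolding label_row_def[abs_def] by (rule borel_measurable_lebesgue_integral)
next
  obtain C where C: "0 \<le> C" "\<And>j z. j \<in> {1..m} \<Longrightarrow> \<bar>\<phi> j z\<bar> \<le> C * G j z" using dominatedE[OF assms(1)] by metis
  let ?I = "\<integral>z. w j z * G j z \<partial>\<rho> j"
  show "\<exists>C\<ge>0. \<forall>j'\<in>{1..m}. \<forall>z'. \<bar>label_row \<phi> j j' z'\<bar> \<le> C * G j' z'"
  proof (intro exI[of _ "C * K * ?I"] conjI ballI allI)
    show "0 \<le> C * K * ?I" using C K_nonneg w_nonneg G_nonneg by simp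
    fix j' z' assume j': "j' \<in> {1..m}"
    have "\<bar>label_row \<phi> j j' z'\<bar> \<le> (\<integral>z. \<bar>\<phi> j z * U j z j' z'\<bar> \<partial>\<rho> j)"
      unfolding label_row_def by (rule integral_abs_bound)
    also have "\<dots> \<le> (\<integral>z. (C * K * G j' z') * (w j z * G j z) \<partial>\<rho> j)"
      by (intro integral_mono integrable_abs label_row_integrable assms j' integrable_mult_right w_G_integrable
          label_row_bound C)
    also have "\<dots> = (C * K * G j' z') * ?I" by (rule integral_mult_right_zero)
    finally show "\<bar>label_row \<phi> j j' z'\<bar> \<le> C * K * ?I * G j' z'" by (simp only: mult_ac)
  qed
qed

lemma push_row_dominated:
  assumes "dominated \<phi>"
  shows "dominated (push_row \<phi>)"
  unfolding dominated_def
proof (intro conjI allI)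
  fix j'
  show "push_row \<phi> j' \<in> borel_measurable borel"
    unfolding push_row_def[abs_def]
    by (intro borel_measurable_sum dominated_measurable label_row_dominated assms)
next
  have "\<exists>C. 0 \<le> C \<and> (\<forall>j'\<in>{1..m}. \<forall>z. \<bar>label_row \<phi> j j' z\<bar> \<le> C * G j' z)" if "j \<in> {1..m}" for j
    by (rule dominatedE[OF label_row_dominated[OF assms that]]) blast
  then obtain C where C: "\<And>j. j \<in> {1..m} \<Longrightarrow> 0 \<le> C j"
     "\<And>j j' z. j \<in> {1..m} \<Longrightarrow> j' \<in> {1..m} \<Longrightarrow> \<bar>label_row \<phi> j j' z\<bar> \<le> C j * G j' z"
    by metis
  show "\<exists>C\<ge>0. \<forall>j'\<in>{1..m}. \<forall>z'. \<bar>push_row \<phi> j' z'\<bar> \<le> C * G j' z'"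
  proof (intro exI[of _ "\<Sum>j=1..m. C j"] conjI ballI allI)
    show "0 \<le> (\<Sum>j=1..m. C j)" using C by (intro sum_nonneg) auto
    fix j' z' assume j': "j' \<in> {1..m}"
    have "\<bar>push_row \<phi> j' z'\<bar> \<le> (\<Sum>j=1..m. \<bar>label_row \<phi> j j' z'\<bar>)" unfolding push_row_def by (rule sum_abs)
    also have "\<dots> \<le> (\<Sum>j=1..m. C j * G j' z')" using C j' by (intro sum_mono) auto
    finally show "\<bar>push_row \<phi> j' z'\<bar> \<le> (\<Sum>j=1..m. C j) * G j' z'" by (simp add: sum_distrib_right)
  qed
qed

lemma bordered_update_row:
  assumes "r < d"
  shows "bordered (a(r := \<alpha>)) (\<phi>(r := \<beta>)) i y =
    (bordered a \<phi> i y)(r := \<lambda>c. if c < d then \<alpha> c else \<beta> (i (c - d)) (y (c - d)))"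
  using assms by (auto simp: fun_eq_iff bordered_def)

text \<open>
  Exchange of the unit row with the row of the point \<open>s\<close> gives the sign, and then the unit row removes
  the point.
\<close>

lemma bordered_unit_row:
  assumes S: "finite S" "s \<in> S" and r: "r < d"
  shows "pdet (idx S) ((bordered a \<phi> i y)(r := \<lambda>c. t * of_bool (c = d + s))) =
    - t * pdet (idx (S - {s})) (bordered (a(r := \<lambda>c. \<psi> c (i s) (y s))) (\<phi>(r := U (i s) (y s))) i y)"
proof -
  define N where "N = (bordered a \<phi> i y)(r := \<lambda>c. of_bool (c = d + s))"
  let ?T = "idx (S - {s})"
  have fin: "finite (idx S)" "finite ?T" using S by (auto intro: finite_idx)
  have in_idx: "r \<in> idx S" "d + s \<in> idx S" "r \<noteq> d + s" using r S by (auto simp: idx_cases)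
  have ins: "idx S = insert (d + s) ?T" "d + s \<notin> ?T" using S by (auto simp: idx_def)
  have "pdet (idx S) ((bordered a \<phi> i y)(r := \<lambda>c. t * of_bool (c = d + s))) = t * pdet (idx S) N"
    unfolding N_def by (rule pdet_row_scale[OF fin(1) in_idx(1)])
  also have "pdet (idx S) N = - pdet (idx S) (N(r := N (d + s), d + s := N r))"
    by (simp add: pdet_swap_rows[OF fin(1) in_idx])
  also have "pdet (idx S) (N(r := N (d + s), d + s := N r)) = pdet ?T (N(r := N (d + s), d + s := N r))"
    unfolding ins(1) using ins(2) fin(2) by (intro pdet_unit_row) (auto simp: N_def)
  also have "\<dots> = pdet ?T (bordered (a(r := \<lambda>c. \<psi> c (i s) (y s))) (\<phi>(r := U (i s) (y s))) i y)"
    unfolding bordered_update_row[OF r]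
    using ins(2) r by (intro pdet_cong) (auto simp: N_def bordered_def)
  finally show ?thesis by (simp only: mult_minus_left mult_minus_right)
qed

lemma bordered_split_row:
  assumes S: "finite S" and r: "r < d"
  shows "pdet (idx S) (bordered a \<phi> i y) = pdet (idx S) (bordered a (\<phi>(r := \<lambda>_ _. 0)) i y) +
    (\<Sum>s\<in>S. pdet (idx S) ((bordered a \<phi> i y)(r := \<lambda>c. \<phi> r (i s) (y s) * of_bool (c = d + s))))"
proof -
  let ?M = "bordered a \<phi> i y"
  have rI: "r \<in> idx S" using r by (simp add: idx_cases)
  have "pdet (idx S) ?M = pdet (idx S) (?M(r := \<lambda>c. (if c < d then a r c else 0) +
      1 * (\<Sum>s\<in>S. \<phi> r (i s) (y s) * of_bool (c = d + s))))"
  proof (rule pdet_cong)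
    fix r' c assume "c \<in> idx S"
    have "(\<Sum>s\<in>S. \<phi> r (i s) (y s) * of_bool (c = d + s)) = (if c < d then 0 else \<phi> r (i (c - d)) (y (c - d)))"
    proof (cases "c < d")
      case False
      then have c: "c - d \<in> S" "\<And>s. c = d + s \<longleftrightarrow> s = c - d" using \<open>c \<in> idx S\<close> by (auto simp: idx_cases)
      have "(\<Sum>s\<in>S. \<phi> r (i s) (y s) * of_bool (c = d + s)) = (\<Sum>s\<in>S. if s = c - d then \<phi> r (i s) (y s) else 0)"
        using False by (intro sum.cong refl) auto
      then show ?thesis using S c(1) False by simp
    qed simp
    then show "?M r' c = (?M(r := \<lambda>c. (if c < d then a r c else 0) +
      1 * (\<Sum>s\<in>S. \<phi> r (i s) (y s) * of_bool (c = d + s)))) r' c"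
      using r by (simp add: bordered_def)
  qed
  also have "\<dots> = pdet (idx S) (?M(r := \<lambda>c. if c < d then a r c else 0)) +
     1 * pdet (idx S) (?M(r := \<lambda>c. \<Sum>s\<in>S. \<phi> r (i s) (y s) * of_bool (c = d + s)))"
    by (rule pdet_row_lincomb[OF finite_idx[OF S] rI])
  also have "?M(r := \<lambda>c. if c < d then a r c else 0) = bordered a (\<phi>(r := \<lambda>_ _. 0)) i y"
    using bordered_update_row[OF r, of a "a r" \<phi> "\<lambda>_ _. 0" i y] by simp
  also have "pdet (idx S) (?M(r := \<lambda>c. \<Sum>s\<in>S. \<phi> r (i s) (y s) * of_bool (c = d + s))) =
     (\<Sum>s\<in>S. \<phi> r (i s) (y s) * pdet (idx S) (?M(r := \<lambda>c. of_bool (c = d + s))))"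
    by (rule pdet_row_sum[OF finite_idx[OF S] rI])
  also have "\<dots> = (\<Sum>s\<in>S. pdet (idx S) (?M(r := \<lambda>c. \<phi> r (i s) (y s) * of_bool (c = d + s))))"
    by (intro sum.cong refl pdet_row_scale[OF finite_idx[OF S] rI, symmetric])
  finally show ?thesis by (simp only: mult_1_left)
qed

lemma unit_row_integrable:
  assumes S: "finite S" "s \<in> S" and r: "r < d" and i: "i \<in> S \<rightarrow>\<^sub>E {1..m}"
    and \<phi>: "\<And>r. r < d \<Longrightarrow> dominated (\<phi> r)"
  shows "integrable (points S i) (\<lambda>y. pdet (idx S) ((bordered a \<phi> i y)(r := \<lambda>c. \<phi> r (i s) (y s) * of_bool (c = d + s))))"
proof -
  obtain B where B: "0 \<le> B" "\<And>S i y r c. i \<in> S \<rightarrow>\<^sub>E {1..m} \<Longrightarrow> r \<in> idx S \<Longrightarrow> c \<in> idx S \<Longrightarrow>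
      \<bar>bordered a \<phi> i y r c\<bar> \<le> (B * (if r < d then 1 else w (i (r - d)) (y (r - d)))) * (if c < d then 1 else G (i (c - d)) (y (c - d)))"
    by (rule bordered_bound[where a=a and \<phi>=\<phi>]) (use \<phi> in auto)
  have ds: "d + s \<in> idx S" "r \<in> idx S" using S r by (auto simp: idx_cases)
  have at: "bordered a \<phi> i y r (d + s) = \<phi> r (i s) (y s)" for y using r by (simp add: bordered_def)
  show ?thesis
  proof (rule pdet_integrable[OF S(1) i B(1)])
    fix r' c assume rc: "r' \<in> idx S" "c \<in> idx S"
    have 1: "(\<lambda>y. bordered a \<phi> i y r' c) \<in> borel_measurable (points S i)" "(\<lambda>y. bordered a \<phi> i y r (d + s)) \<in> borel_measurable (points S i)"
      using bordered_measurable[OF i \<phi>] rc ds by auto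
    then show "(\<lambda>y. ((bordered a \<phi> i y)(r := \<lambda>c. \<phi> r (i s) (y s) * of_bool (c = d + s))) r' c) \<in> borel_measurable (points S i)"
      unfolding at by (cases "r' = r") auto
    fix y
    show "\<bar>((bordered a \<phi> i y)(r := \<lambda>c. \<phi> r (i s) (y s) * of_bool (c = d + s))) r' c\<bar> \<le>
       (B * (if r' < d then 1 else w (i (r' - d)) (y (r' - d)))) * (if c < d then 1 else G (i (c - d)) (y (c - d)))"
    proof (cases "r' = r")
      case False then show ?thesis using B(2)[OF i rc] by simp
    next
      case True
      show ?thesis
      proof (cases "c = d + s")
        case True': True
        then show ?thesis using B(2)[OF i ds(2) ds(1), of y] True r unfolding at by simp
      next
        case False
        then show ?thesis using True r B(1) G_nonneg by simp
      qed
    qed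
  qed
qed

text \<open>
  After the removal of the point \<open>s\<close>, its label and position occur in row \<open>r\<close> only, and a determinant is
  linear in a row. So the integral over the point can be taken inside this row.
\<close>

lemma total_unit_row:
  assumes S: "finite S" "s \<in> S" and r: "r < d" and \<phi>: "\<And>r. r < d \<Longrightarrow> dominated (\<phi> r)"
  shows "total S (\<lambda>i y. pdet (idx S) ((bordered a \<phi> i y)(r := \<lambda>c. \<phi> r (i s) (y s) * of_bool (c = d + s)))) =
    - total (S - {s}) (\<lambda>i y. pdet (idx (S - {s})) (bordered (a(r := push_scalar (\<phi> r))) (\<phi>(r := push_row (\<phi> r))) i y))"
proof -
  let ?S = "S - {s}"
  let ?T = "idx ?S"
  have fin: "finite ?S" "finite ?T" using S by (auto intro: finite_idx)
  have rT: "r \<in> ?T" using r by (simp add: idx_cases)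
  have \<phi>': "dominated ((\<phi>(r := label_row (\<phi> r) j)) r')" if "j \<in> {1..m}" "r' < d" for j r'
    using that \<phi> label_row_dominated[OF \<phi>[OF r]] by simp
  let ?P = "\<lambda>j i y. pdet ?T (bordered (a(r := label_scalar (\<phi> r) j)) (\<phi>(r := label_row (\<phi> r) j)) i y)"
  have inner: "(\<integral>z. pdet (idx S) ((bordered a \<phi> (i(s := j)) (y(s := z)))(r := \<lambda>c. \<phi> r ((i(s := j)) s) ((y(s := z)) s) * of_bool (c = d + s))) \<partial>\<rho> j) =
     - ?P j i y" if j: "j \<in> {1..m}" and i: "i \<in> ?S \<rightarrow>\<^sub>E {1..m}" for i j y
  proof -
    let ?u = "\<lambda>z c. if c < d then \<psi> c j z else U j z (i (c - d)) (y (c - d))"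
    let ?co = "\<lambda>c. pdet ?T ((bordered a \<phi> i y)(r := \<lambda>c'. of_bool (c' = c)))"
    have "pdet (idx S) ((bordered a \<phi> (i(s := j)) (y(s := z)))(r := \<lambda>c. \<phi> r ((i(s := j)) s) ((y(s := z)) s) * of_bool (c = d + s))) =
        - (\<Sum>c\<in>?T. ?co c * (\<phi> r j z * ?u z c))" for z
    proof -
      have "pdet ?T (bordered (a(r := \<lambda>c. \<psi> c j z)) (\<phi>(r := U j z)) (i(s := j)) (y(s := z))) =
         pdet ?T (bordered (a(r := \<lambda>c. \<psi> c j z)) (\<phi>(r := U j z)) i y)"
        by (rule pdet_cong) (auto simp: bordered_def idx_cases)
      also have "\<dots> = (\<Sum>c\<in>?T. ?u z c * ?co c)"
        unfolding bordered_update_row[OF r] by (rule pdet_row_expand_finite[OF fin(2) rT])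
      finally show ?thesis
        by (subst bordered_unit_row[OF S r]) (simp add: sum_distrib_left mult_ac sum_negf)
    qed
    then have "(\<integral>z. pdet (idx S) ((bordered a \<phi> (i(s := j)) (y(s := z)))(r := \<lambda>c. \<phi> r ((i(s := j)) s) ((y(s := z)) s) * of_bool (c = d + s))) \<partial>\<rho> j) =
       - (\<integral>z. (\<Sum>c\<in>?T. ?co c * (\<phi> r j z * ?u z c)) \<partial>\<rho> j)" by simp
    also have "(\<integral>z. (\<Sum>c\<in>?T. ?co c * (\<phi> r j z * ?u z c)) \<partial>\<rho> j) = (\<Sum>c\<in>?T. \<integral>z. ?co c * (\<phi> r j z * ?u z c) \<partial>\<rho> j)"
    proof (rule Bochner_Integration.integral_sum)
      fix c assume "c \<in> ?T"
      then have "c < d \<or> i (c - d) \<in> {1..m}" using i by (auto simp: idx_cases PiE_iff)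
      then show "integrable (\<rho> j) (\<lambda>z. ?co c * (\<phi> r j z * ?u z c))"
        using label_scalar_integrable[OF \<phi>[OF r] j] label_row_integrable[OF \<phi>[OF r] j]
        by (intro integrable_mult_right) (cases "c < d"; simp)
    qed
    also have "\<dots> = (\<Sum>c\<in>?T. (if c < d then label_scalar (\<phi> r) j c else label_row (\<phi> r) j (i (c - d)) (y (c - d))) * ?co c)"
      by (intro sum.cong refl) (simp add: label_scalar_def label_row_def)
    also have "\<dots> = ?P j i y"
      unfolding bordered_update_row[OF r] by (rule pdet_row_expand_finite[OF fin(2) rT, symmetric])
    finally show ?thesis .
  qed
  have "total S (\<lambda>i y. pdet (idx S) ((bordered a \<phi> i y)(r := \<lambda>c. \<phi> r (i s) (y s) * of_bool (c = d + s)))) =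
    (\<Sum>i\<in>?S \<rightarrow>\<^sub>E {1..m}. \<Sum>j=1..m. \<integral>y. - ?P j i y \<partial>points ?S i)"
    by (subst total_remove[OF S]) (auto simp del: fun_upd_apply intro!: unit_row_integrable S r \<phi> sum.cong simp: inner)
  also have "\<dots> = (\<Sum>i\<in>?S \<rightarrow>\<^sub>E {1..m}. - (\<integral>y. (\<Sum>j=1..m. ?P j i y) \<partial>points ?S i))"
  proof (intro sum.cong refl)
    fix i assume i: "i \<in> ?S \<rightarrow>\<^sub>E {1..m}"
    have "(\<integral>y. (\<Sum>j=1..m. ?P j i y) \<partial>points ?S i) = (\<Sum>j=1..m. \<integral>y. ?P j i y \<partial>points ?S i)"
      by (intro Bochner_Integration.integral_sum bordered_integrable fin i \<phi>')
    then show "(\<Sum>j=1..m. \<integral>y. - ?P j i y \<partial>points ?S i) = - (\<integral>y. (\<Sum>j=1..m. ?P j i y) \<partial>points ?S i)"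
      by (simp add: sum_negf)
  qed
  also have "\<dots> = - total ?S (\<lambda>i y. pdet ?T (bordered (a(r := push_scalar (\<phi> r))) (\<phi>(r := push_row (\<phi> r))) i y))"
  proof -
    have "(\<Sum>j=1..m. ?P j i y) = pdet ?T (bordered (a(r := push_scalar (\<phi> r))) (\<phi>(r := push_row (\<phi> r))) i y)" for i y
    proof -
      let ?v = "\<lambda>j c. if c < d then label_scalar (\<phi> r) j c else label_row (\<phi> r) j (i (c - d)) (y (c - d))"
      have "pdet ?T ((bordered a \<phi> i y)(r := \<lambda>c. \<Sum>j=1..m. 1 * ?v j c)) = (\<Sum>j=1..m. 1 * pdet ?T ((bordered a \<phi> i y)(r := ?v j)))"
        by (rule pdet_row_sum[OF fin(2) rT])
      moreover have "(\<lambda>c. \<Sum>j=1..m. 1 * ?v j c) = (\<lambda>c. if c < d then push_scalar (\<phi> r) c else push_row (\<phi> r) (i (c - d)) (y (c - d)))"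
        by (auto simp: push_scalar_def push_row_def fun_eq_iff)
      ultimately show ?thesis unfolding bordered_update_row[OF r] by simp
    qed
    then show ?thesis by (simp add: total_def sum_negf)
  qed
  finally show ?thesis .
qed

definition bordered_total :: "nat set \<Rightarrow> (nat \<Rightarrow> nat \<Rightarrow> real) \<Rightarrow> (nat \<Rightarrow> nat \<Rightarrow> real \<Rightarrow> real) \<Rightarrow> real" where
  "bordered_total S a \<phi> = total S (\<lambda>i y. pdet (idx S) (bordered a \<phi> i y))"

text \<open>
  The recursion that sums the series. It trades the functions in row \<open>r\<close> for a constant row, at the cost
  of terms with one point less whose row \<open>r\<close> is supported on later labels.
\<close>

lemma bordered_total_reduce:
  assumes S: "finite S" and r: "r < d" and \<phi>: "\<And>r. r < d \<Longrightarrow> dominated (\<phi> r)"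
  shows "bordered_total S a \<phi> = bordered_total S a (\<phi>(r := \<lambda>_ _. 0)) -
    (\<Sum>s\<in>S. bordered_total (S - {s}) (a(r := push_scalar (\<phi> r))) (\<phi>(r := push_row (\<phi> r))))"
proof -
  let ?H = "\<lambda>s i y. pdet (idx S) ((bordered a \<phi> i y)(r := \<lambda>c. \<phi> r (i s) (y s) * of_bool (c = d + s)))"
  have "dominated ((\<phi>(r := \<lambda>_ _. 0)) r')" if "r' < d" for r' using that \<phi> dominated_zero by simp
  then have "bordered_total S a \<phi> = (\<Sum>i\<in>S \<rightarrow>\<^sub>E {1..m}.
      (\<integral>y. pdet (idx S) (bordered a (\<phi>(r := \<lambda>_ _. 0)) i y) \<partial>points S i) + (\<Sum>s\<in>S. \<integral>y. ?H s i y \<partial>points S i))"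
    unfolding bordered_total_def total_def
    by (subst bordered_split_row[OF S r])
       (auto intro!: sum.cong Bochner_Integration.integral_add[THEN trans] bordered_integrable S
          Bochner_Integration.integral_sum Bochner_Integration.integrable_sum unit_row_integrable r \<phi>
          arg_cong2[where f="(+)"])
  also have "\<dots> = bordered_total S a (\<phi>(r := \<lambda>_ _. 0)) + (\<Sum>s\<in>S. total S (?H s))"
    unfolding bordered_total_def total_def sum.distrib by (subst (2) sum.swap) simp
  also have "(\<Sum>s\<in>S. total S (?H s)) = (\<Sum>s\<in>S. - bordered_total (S - {s}) (a(r := push_scalar (\<phi> r))) (\<phi>(r := push_row (\<phi> r))))"
    unfolding bordered_total_def by (intro sum.cong refl total_unit_row S r \<phi>)
  finally show ?thesis by (simp only: sum_negf diff_conv_add_uminus)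
qed

text \<open>
  The entries of $A - \int \phi \kappa$, where \<open>\<kappa>\<close> will be $\psi - U \psi + U U \psi - \dots$
\<close>

definition corrected ::
    "(nat \<Rightarrow> nat \<Rightarrow> real \<Rightarrow> real) \<Rightarrow> (nat \<Rightarrow> nat \<Rightarrow> real) \<Rightarrow> (nat \<Rightarrow> nat \<Rightarrow> real \<Rightarrow> real) \<Rightarrow> nat \<Rightarrow> nat \<Rightarrow> real" where
  "corrected \<kappa> a \<phi> r c = a r c - (\<Sum>j=1..m. \<integral>z. \<phi> r j z * \<kappa> c j z \<partial>\<rho> j)"

text \<open>
  The equation $\kappa = \psi - U \kappa$ characterizes the alternating series.
\<close>

definition resolvent :: "(nat \<Rightarrow> nat \<Rightarrow> real \<Rightarrow> real) \<Rightarrow> bool" where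
  "resolvent \<kappa> \<longleftrightarrow> (\<forall>c j. \<kappa> c j \<in> borel_measurable borel) \<and>
     (\<exists>C\<ge>0. \<forall>c<d. \<forall>j\<in>{1..m}. \<forall>y. \<bar>\<kappa> c j y\<bar> \<le> C * w j y) \<and>
     (\<forall>c<d. \<forall>j\<in>{1..m}. \<forall>y. \<kappa> c j y = \<psi> c j y - (\<Sum>j'=1..m. \<integral>z. U j y j' z * \<kappa> c j' z \<partial>\<rho> j'))"

text \<open>
  Pushing a row forward and correcting it afterwards gives $\int \phi \psi - \int \phi U \kappa = \int \phi \kappa$.
\<close>

lemma push_corrected:
  assumes \<phi>: "dominated \<phi>" and \<kappa>: "resolvent \<kappa>" and c: "c < d"
  shows "push_scalar \<phi> c - (\<Sum>j'=1..m. \<integral>z'. push_row \<phi> j' z' * \<kappa> c j' z' \<partial>\<rho> j') =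
    (\<Sum>j=1..m. \<integral>z. \<phi> j z * \<kappa> c j z \<partial>\<rho> j)"
proof -
  obtain C where C: "0 \<le> C" "\<And>j z. j \<in> {1..m} \<Longrightarrow> \<bar>\<phi> j z\<bar> \<le> C * G j z" using dominatedE[OF \<phi>] by metis
  obtain K' where K': "0 \<le> K'" "\<And>j y. j \<in> {1..m} \<Longrightarrow> \<bar>\<kappa> c j y\<bar> \<le> K' * w j y"
    using \<kappa> c unfolding resolvent_def by metis
  have [measurable]: "\<kappa> c j \<in> borel_measurable borel" for j using \<kappa> by (simp add: resolvent_def)
  note [measurable] = dominated_measurable[OF \<phi>]
  have \<kappa>_eq: "\<kappa> c j y = \<psi> c j y - (\<Sum>j'=1..m. \<integral>z. U j y j' z * \<kappa> c j' z \<partial>\<rho> j')" if "j \<in> {1..m}" for j y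
    using \<kappa> c that unfolding resolvent_def by blast
  let ?H = "\<lambda>j j' z z'. \<phi> j z * U j z j' z' * \<kappa> c j' z'"
  have int: "integrable (\<rho> j \<Otimes>\<^sub>M \<rho> j') (\<lambda>(z, z'). ?H j j' z z')" if j: "j \<in> {1..m}" "j' \<in> {1..m}" for j j'
  proof -
    interpret A: sigma_finite_measure "\<rho> j" by (rule sigma_finite)
    interpret B: sigma_finite_measure "\<rho> j'" by (rule sigma_finite)
    interpret AB: pair_sigma_finite "\<rho> j" "\<rho> j'" ..
    have "integrable (\<rho> j \<Otimes>\<^sub>M \<rho> j') (\<lambda>(z, z'). (C * K * (w j z * G j z)) * (K' * (w j' z' * G j' z')))"
      using j by (intro AB.integrable_product_mult integrable_mult_right w_G_integrable)
    then show ?thesis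
    proof (rule Bochner_Integration.integrable_bound)
      show "(\<lambda>(z, z'). ?H j j' z z') \<in> borel_measurable (\<rho> j \<Otimes>\<^sub>M \<rho> j')"
        by measurable
      have "\<bar>?H j j' z z'\<bar> \<le> (C * K * (w j z * G j z)) * (K' * (w j' z' * G j' z'))" for z z'
      proof -
        have "\<bar>\<phi> j z * U j z j' z'\<bar> * \<bar>\<kappa> c j' z'\<bar> \<le> ((C * K * G j' z') * (w j z * G j z)) * (K' * w j' z')"
          using label_row_bound[of j j' C \<phi> z z'] C K' j by (intro mult_mono) auto
        then show ?thesis by (simp add: abs_mult mult_ac)
      qed
      then show "AE x in \<rho> j \<Otimes>\<^sub>M \<rho> j'. norm (case x of (z, z') \<Rightarrow> ?H j j' z z') \<le>
         norm (case x of (z, z') \<Rightarrow> (C * K * (w j z * G j z)) * (K' * (w j' z' * G j' z')))"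
        by (intro AE_I2) (auto intro: order_trans[OF _ abs_ge_self] split: prod.split)
    qed
  qed
  have swap: "(\<integral>z'. (\<integral>z. ?H j j' z z' \<partial>\<rho> j) \<partial>\<rho> j') = (\<integral>z. (\<integral>z'. ?H j j' z z' \<partial>\<rho> j') \<partial>\<rho> j)"
    and int1: "integrable (\<rho> j) (\<lambda>z. \<integral>z'. ?H j j' z z' \<partial>\<rho> j')"
    and int2: "integrable (\<rho> j') (\<lambda>z'. \<integral>z. ?H j j' z z' \<partial>\<rho> j)"
    if j: "j \<in> {1..m}" "j' \<in> {1..m}" for j j'
  proof -
    interpret A: sigma_finite_measure "\<rho> j" by (rule sigma_finite)
    interpret B: sigma_finite_measure "\<rho> j'" by (rule sigma_finite)
    interpret AB: pair_sigma_finite "\<rho> j" "\<rho> j'" ..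
    show "(\<integral>z'. (\<integral>z. ?H j j' z z' \<partial>\<rho> j) \<partial>\<rho> j') = (\<integral>z. (\<integral>z'. ?H j j' z z' \<partial>\<rho> j') \<partial>\<rho> j)"
      by (rule AB.Fubini_integral[OF int[OF j]])
    show "integrable (\<rho> j) (\<lambda>z. \<integral>z'. ?H j j' z z' \<partial>\<rho> j')" by (rule AB.integrable_fst[OF int[OF j]])
    show "integrable (\<rho> j') (\<lambda>z'. \<integral>z. ?H j j' z z' \<partial>\<rho> j)" by (rule AB.integrable_snd[OF int[OF j]])
  qed
  have "(\<Sum>j'=1..m. \<integral>z'. push_row \<phi> j' z' * \<kappa> c j' z' \<partial>\<rho> j') =
     (\<Sum>j'=1..m. \<integral>z'. (\<Sum>j=1..m. \<integral>z. ?H j j' z z' \<partial>\<rho> j) \<partial>\<rho> j')"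
    unfolding push_row_def label_row_def sum_distrib_right by (simp only: integral_mult_left_zero)
  also have "\<dots> = (\<Sum>j'=1..m. \<Sum>j=1..m. \<integral>z'. (\<integral>z. ?H j j' z z' \<partial>\<rho> j) \<partial>\<rho> j')"
    by (intro sum.cong refl Bochner_Integration.integral_sum int2)
  also have "\<dots> = (\<Sum>j'=1..m. \<Sum>j=1..m. \<integral>z. (\<integral>z'. ?H j j' z z' \<partial>\<rho> j') \<partial>\<rho> j)"
    by (intro sum.cong refl swap)
  also have "\<dots> = (\<Sum>j=1..m. \<Sum>j'=1..m. \<integral>z. (\<integral>z'. ?H j j' z z' \<partial>\<rho> j') \<partial>\<rho> j)"
    by (rule sum.swap)
  finally have lhs: "(\<Sum>j'=1..m. \<integral>z'. push_row \<phi> j' z' * \<kappa> c j' z' \<partial>\<rho> j') =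
      (\<Sum>j=1..m. \<Sum>j'=1..m. \<integral>z. (\<integral>z'. ?H j j' z z' \<partial>\<rho> j') \<partial>\<rho> j)" .
  have "(\<Sum>j=1..m. \<integral>z. \<phi> j z * \<kappa> c j z \<partial>\<rho> j) =
    (\<Sum>j=1..m. label_scalar \<phi> j c - (\<Sum>j'=1..m. \<integral>z. (\<integral>z'. ?H j j' z z' \<partial>\<rho> j') \<partial>\<rho> j))"
  proof (intro sum.cong refl)
    fix j assume j: "j \<in> {1..m}"
    have "(\<integral>z. \<phi> j z * \<kappa> c j z \<partial>\<rho> j) = (\<integral>z. \<phi> j z * \<psi> c j z - (\<Sum>j'=1..m. \<integral>z'. ?H j j' z z' \<partial>\<rho> j') \<partial>\<rho> j)"
      by (subst \<kappa>_eq[OF j]) (simp add: right_diff_distrib sum_distrib_left mult.assoc)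
    also have "\<dots> = label_scalar \<phi> j c - (\<integral>z. (\<Sum>j'=1..m. \<integral>z'. ?H j j' z z' \<partial>\<rho> j') \<partial>\<rho> j)"
      unfolding label_scalar_def
      by (intro Bochner_Integration.integral_diff label_scalar_integrable \<phi> j c Bochner_Integration.integrable_sum int1)
    also have "(\<integral>z. (\<Sum>j'=1..m. \<integral>z'. ?H j j' z z' \<partial>\<rho> j') \<partial>\<rho> j) = (\<Sum>j'=1..m. \<integral>z. (\<integral>z'. ?H j j' z z' \<partial>\<rho> j') \<partial>\<rho> j)"
      by (intro Bochner_Integration.integral_sum int1 j)
    finally show "(\<integral>z. \<phi> j z * \<kappa> c j z \<partial>\<rho> j) =
       label_scalar \<phi> j c - (\<Sum>j'=1..m. \<integral>z. (\<integral>z'. ?H j j' z z' \<partial>\<rho> j') \<partial>\<rho> j)" .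
  qed
  then show ?thesis unfolding lhs by (simp add: sum_subtractf push_scalar_def)
qed

text \<open>
  Nothing leads into a point with the smallest label, so its column is zero.
\<close>

lemma bordered_total_no_rows:
  assumes S: "finite S" "S \<noteq> {}" and \<phi>: "\<And>r j z. r < d \<Longrightarrow> j \<in> {1..m} \<Longrightarrow> \<phi> r j z = 0"
  shows "bordered_total S a \<phi> = 0"
proof -
  have "pdet (idx S) (bordered a \<phi> i y) = 0" if i: "i \<in> S \<rightarrow>\<^sub>E {1..m}" for i y
  proof -
    obtain s where s: "s \<in> S" "\<And>t. t \<in> S \<Longrightarrow> i s \<le> i t"
      using ex_min_if_finite[of "i ` S"] S by (metis (no_types, lifting) arg_min_if_finite(1) arg_min_least)
    show ?thesis
    proof (rule pdet_column_zero[OF finite_idx[OF S(1)], of "d + s"])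
      show "d + s \<in> idx S" using s by (simp add: idx_cases)
      fix r assume "r \<in> idx S"
      then show "bordered a \<phi> i y r (d + s) = 0"
        using s i \<phi> U_upper by (auto simp: bordered_def idx_cases PiE_iff)
    qed
  qed
  then show ?thesis unfolding bordered_total_def total_def by simp
qed

lemma bordered_total_empty: "bordered_total {} a \<phi> = pdet {..<d} a"
proof -
  have "pdet (idx {}) (bordered a \<phi> i y) = pdet {..<d} a" for i y
    by (simp add: idx_def) (intro pdet_cong, simp add: bordered_def)
  then show ?thesis
    by (simp add: bordered_total_def total_def PiM_empty lebesgue_integral_count_space_finite)
qed

text \<open>
  Induction on the total number of labels that the functions in the first \<open>d\<close> rows can still reach. Each
  application of \<open>bordered_total_reduce\<close> lowers this number in both of its terms. The factorial
  counts the orders in which the points are removed, and it cancels the one of the Fredholm series.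
\<close>

lemma bordered_total_expansion:
  assumes \<kappa>: "resolvent \<kappa>"
    and \<phi>: "\<And>r. r < d \<Longrightarrow> dominated (\<phi> r)"
    and L: "\<And>r j z. r < d \<Longrightarrow> j \<le> L r \<Longrightarrow> \<phi> r j z = 0"
    and N: "N = (\<Sum>r<d. m - L r)"
  shows "\<exists>c. (\<forall>S. finite S \<longrightarrow> bordered_total S a \<phi> = fact (card S) * c (card S)) \<and> (\<forall>k>N. c k = 0) \<and>
    (\<Sum>k\<le>N. c k) = pdet {..<d} (corrected \<kappa> a \<phi>)"
  using \<phi> L N
proof (induction N arbitrary: a \<phi> L rule: less_induct)
  case (less N)
  show ?case
  proof (cases "\<exists>r<d. L r < m")
    case False
    then have mL: "m \<le> L r" if "r < d" for r using that not_less by blast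
    have zero: "\<phi> r j z = 0" if "r < d" "j \<in> {1..m}" for r j z
      using that mL[OF that(1)] by (intro less.prems(2)) auto
    have N0: "N = 0" unfolding less.prems(3) by (simp add: mL)
    have "bordered_total S a \<phi> = fact (card S) * (if card S = 0 then pdet {..<d} a else 0)" if "finite S" for S
      using that bordered_total_no_rows[OF that _ zero, where a=a] bordered_total_empty[where a=a and \<phi>=\<phi>] by (cases "S = {}") auto
    moreover have "pdet {..<d} (corrected \<kappa> a \<phi>) = pdet {..<d} a"
      by (rule pdet_cong) (simp add: corrected_def zero)
    ultimately show ?thesis using N0
      by (intro exI[of _ "\<lambda>k. if k = 0 then pdet {..<d} a else 0"]) auto
  next
    case True
    then obtain r where r: "r < d" "L r < m" by blast
    define \<phi>1 where "\<phi>1 = \<phi>(r := \<lambda>_ _. 0)"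
    define L1 where "L1 = L(r := m)"
    define a2 where "a2 = a(r := push_scalar (\<phi> r))"
    define \<phi>2 where "\<phi>2 = \<phi>(r := push_row (\<phi> r))"
    define L2 where "L2 = L(r := Suc (L r))"
    have split: "(\<Sum>r'<d. m - (L(r := l)) r') = (m - l) + (\<Sum>r'\<in>{..<d} - {r}. m - L r')" for l
    proof -
      have "(\<Sum>r'<d. m - (L(r := l)) r') = (m - (L(r := l)) r) + (\<Sum>r'\<in>{..<d} - {r}. m - (L(r := l)) r')"
        using r(1) by (intro sum.remove) auto
      also have "(\<Sum>r'\<in>{..<d} - {r}. m - (L(r := l)) r') = (\<Sum>r'\<in>{..<d} - {r}. m - L r')"
        by (intro sum.cong) auto
      finally show ?thesis by simp
    qed
    have N: "N = (m - L r) + (\<Sum>r'\<in>{..<d} - {r}. m - L r')"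
      using split[of "L r"] less.prems(3) by simp
    define N1 where "N1 = (\<Sum>r<d. m - L1 r)"
    define N2 where "N2 = (\<Sum>r<d. m - L2 r)"
    have N1: "N1 < N" and N2: "N = Suc N2"
      using split[of m] split[of "Suc (L r)"] r(2) unfolding N N1_def N2_def L1_def L2_def by simp_all
    have "\<exists>c. (\<forall>S. finite S \<longrightarrow> bordered_total S a \<phi>1 = fact (card S) * c (card S)) \<and> (\<forall>k>N1. c k = 0) \<and>
      (\<Sum>k\<le>N1. c k) = pdet {..<d} (corrected \<kappa> a \<phi>1)"
    proof (rule less.IH[OF N1 _ _ N1_def])
      show "dominated (\<phi>1 r')" if "r' < d" for r'
        using less.prems(1)[OF that] dominated_zero by (simp add: \<phi>1_def)
      show "\<phi>1 r' j z = 0" if "r' < d" "j \<le> L1 r'" for r' j z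
        using that less.prems(2) by (auto simp: \<phi>1_def L1_def split: if_splits)
    qed
    then obtain c1 where c1: "\<And>S. finite S \<Longrightarrow> bordered_total S a \<phi>1 = fact (card S) * c1 (card S)"
        "\<And>k. k > N1 \<Longrightarrow> c1 k = 0" "(\<Sum>k\<le>N1. c1 k) = pdet {..<d} (corrected \<kappa> a \<phi>1)"
      by blast
    have "\<exists>c. (\<forall>S. finite S \<longrightarrow> bordered_total S a2 \<phi>2 = fact (card S) * c (card S)) \<and> (\<forall>k>N2. c k = 0) \<and>
      (\<Sum>k\<le>N2. c k) = pdet {..<d} (corrected \<kappa> a2 \<phi>2)"
    proof (rule less.IH[OF _ _ _ N2_def])
      show "N2 < N" using N2 by simp
      show "dominated (\<phi>2 r')" if "r' < d" for r'
        using less.prems(1)[OF that] push_row_dominated[OF less.prems(1)[OF r(1)]] by (simp add: \<phi>2_def)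
      have "push_row (\<phi> r) j z = 0" if "j \<le> Suc (L r)" for j z
        unfolding push_row_def label_row_def
      proof (intro sum.neutral ballI)
        fix j' assume "j' \<in> {1..m}"
        have "\<phi> r j' u * U j' u j z = 0" for u
          using less.prems(2)[OF r(1), of j' u] U_upper[of j j' u z] that by (cases "j' \<le> L r") auto
        then show "(\<integral>u. \<phi> r j' u * U j' u j z \<partial>\<rho> j') = 0" by (simp only: integral_zero)
      qed
      then show "\<phi>2 r' j z = 0" if "r' < d" "j \<le> L2 r'" for r' j z
        using that less.prems(2) by (auto simp: \<phi>2_def L2_def split: if_splits)
    qed
    then obtain c2 where c2: "\<And>S. finite S \<Longrightarrow> bordered_total S a2 \<phi>2 = fact (card S) * c2 (card S)"
        "\<And>k. k > N2 \<Longrightarrow> c2 k = 0" "(\<Sum>k\<le>N2. c2 k) = pdet {..<d} (corrected \<kappa> a2 \<phi>2)"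
      by blast
    (* One point is used up by the removal, hence the shift of c2. *)
    define c where "c k = c1 k - (case k of 0 \<Rightarrow> 0 | Suc k' \<Rightarrow> c2 k')" for k
    have "bordered_total S a \<phi> = fact (card S) * c (card S)" if S: "finite S" for S
    proof -
      have "bordered_total S a \<phi> = fact (card S) * c1 (card S) - (\<Sum>s\<in>S. bordered_total (S - {s}) a2 \<phi>2)"
        using bordered_total_reduce[OF S r(1) less.prems(1), where a=a] c1(1)[OF S] by (simp add: \<phi>1_def a2_def \<phi>2_def)
      also have "(\<Sum>s\<in>S. bordered_total (S - {s}) a2 \<phi>2) = (\<Sum>s\<in>S. fact (card S - 1) * c2 (card S - 1))"
        using S by (intro sum.cong refl) (simp add: c2(1))
      also have "\<dots> = fact (card S) * (case card S of 0 \<Rightarrow> 0 | Suc k' \<Rightarrow> c2 k')"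
        by (cases "card S") (simp_all add: mult_ac)
      finally show ?thesis by (simp add: c_def right_diff_distrib)
    qed
    moreover have "c k = 0" if "k > N" for k
      using that N1 N2 c1(2) c2(2) by (cases k) (auto simp: c_def)
    moreover have "(\<Sum>k\<le>N. c k) = pdet {..<d} (corrected \<kappa> a \<phi>)"
    proof -
      have "(\<Sum>k\<le>N. c k) = (\<Sum>k\<le>N. c1 k) - (\<Sum>k\<le>N. (case k of 0 \<Rightarrow> 0 | Suc k' \<Rightarrow> c2 k'))"
        by (simp add: c_def sum_subtractf)
      also have "(\<Sum>k\<le>N. c1 k) = (\<Sum>k\<le>N1. c1 k)"
        using N1 c1(2) by (intro sum.mono_neutral_right) auto
      also have "(\<Sum>k\<le>N. (case k of 0 \<Rightarrow> 0 | Suc k' \<Rightarrow> c2 k')) = (\<Sum>k\<le>N2. c2 k)"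
        unfolding N2 by (subst sum.atMost_Suc_shift) simp
      also have "(\<Sum>k\<le>N1. c1 k) - (\<Sum>k\<le>N2. c2 k) =
         pdet {..<d} (corrected \<kappa> a \<phi>1) + (- 1) * pdet {..<d} (corrected \<kappa> a2 \<phi>2)"
        using c1(3) c2(3) by simp
      also have "\<dots> = pdet {..<d} ((corrected \<kappa> a \<phi>)(r := corrected \<kappa> a \<phi>1 r)) +
          (- 1) * pdet {..<d} ((corrected \<kappa> a \<phi>)(r := corrected \<kappa> a2 \<phi>2 r))"
        by (intro arg_cong2[where f="\<lambda>x y. x + (- 1) * y"] pdet_cong)
           (auto simp: corrected_def \<phi>1_def a2_def \<phi>2_def)
      also have "\<dots> = pdet {..<d} ((corrected \<kappa> a \<phi>)(r := \<lambda>c. corrected \<kappa> a \<phi>1 r c + (- 1) * corrected \<kappa> a2 \<phi>2 r c))"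
        using r(1) by (intro pdet_row_lincomb[symmetric]) auto
      also have "\<dots> = pdet {..<d} (corrected \<kappa> a \<phi>)"
      proof (rule pdet_cong)
        fix r' c assume "c \<in> {..<d}"
        then have "corrected \<kappa> a2 \<phi>2 r c = (\<Sum>j=1..m. \<integral>z. \<phi> r j z * \<kappa> c j z \<partial>\<rho> j)"
          using push_corrected[OF less.prems(1)[OF r(1)] \<kappa>, of c] by (simp add: corrected_def a2_def \<phi>2_def)
        then show "((corrected \<kappa> a \<phi>)(r := \<lambda>c. corrected \<kappa> a \<phi>1 r c + (- 1) * corrected \<kappa> a2 \<phi>2 r c)) r' c = corrected \<kappa> a \<phi> r' c"
          by (simp add: corrected_def \<phi>1_def)
      qed
      finally show ?thesis .
    qed
    ultimately show ?thesis by blast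
  qed
qed

lemma idx_lessThan: "idx {..<k} = {..<d + k}"
proof -
  have "r \<in> idx {..<k} \<longleftrightarrow> r \<in> {..<d + k}" for r by (auto simp: idx_cases)
  then show ?thesis by blast
qed

text \<open>
  The indicator \<open>\<theta>\<close> occurs once for each point in the Fredholm series. As it is idempotent, it may be
  attached to both sides of the kernel.
\<close>

theorem fredholm_det_bordered:
  fixes A B :: "real mat" and \<phi> :: "nat \<Rightarrow> nat \<Rightarrow> real \<Rightarrow> real"
  assumes A: "A \<in> carrier_mat d d" and B: "B \<in> carrier_mat d d" and AB: "A * B = 1\<^sub>m d"
    and det: "Determinant.det A \<noteq> 0"
    and \<theta>: "\<And>j y. \<theta> j y = 0 \<or> \<theta> j y = (1 :: real)"
    and L: "\<And>i j y z. i \<in> {1..m} \<Longrightarrow> j \<in> {1..m} \<Longrightarrow>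
       \<theta> i y * L i y j z * \<theta> j z = - U i y j z + (\<Sum>p<d. \<Sum>l<d. \<psi> p i y * B $$ (p, l) * \<phi> l j z)"
    and \<phi>: "\<And>r. r < d \<Longrightarrow> dominated (\<phi> r)" and \<phi>0: "\<And>r z. \<phi> r 0 z = 0"
    and \<kappa>: "resolvent \<kappa>"
  shows "fredholm_convergent m \<rho> \<theta> L"
    and "fredholm_det m \<rho> \<theta> L = pdet {..<d} (corrected \<kappa> (\<lambda>r c. A $$ (r, c)) \<phi>) / Determinant.det A"
proof -
  let ?a = "\<lambda>r c. A $$ (r, c)"
  have integrand: "fredholm_integrand \<theta> L k i y = (- 1) ^ k / Determinant.det A * pdet (idx {..<k}) (bordered ?a \<phi> i y)"
    if i: "i \<in> {..<k} \<rightarrow>\<^sub>E {1..m}" for k i y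
  proof -
    let ?L = "\<lambda>s t. \<theta> (i s) (y s) * L (i s) (y s) (i t) (y t) * \<theta> (i t) (y t)"
    have "fredholm_integrand \<theta> L k i y = (\<Prod>r<k. \<theta> (i r) (y r)) * pdet {..<k} (\<lambda>s t. L (i s) (y s) (i t) (y t))"
      by (simp add: fredholm_integrand_def det_mat_eq_pdet)
    also have "(\<Prod>r<k. \<theta> (i r) (y r)) = (\<Prod>r<k. \<theta> (i r) (y r)) * (\<Prod>r<k. \<theta> (i r) (y r))"
      unfolding prod.distrib[symmetric] using \<theta> by (intro prod.cong refl) (metis mult_zero_left mult_1_left)
    also have "\<dots> * pdet {..<k} (\<lambda>s t. L (i s) (y s) (i t) (y t)) = pdet {..<k} ?L"
      by (subst pdet_scale) simp_all
    finally have 1: "fredholm_integrand \<theta> L k i y = pdet {..<k} ?L" .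
    have im: "i s \<in> {1..m}" if "s < k" for s using i that by (auto simp: PiE_iff)
    have "pdet (idx {..<k}) (bordered ?a \<phi> i y) = (- 1) ^ k * Determinant.det A * pdet {..<k} ?L"
      unfolding idx_lessThan bordered_def
      by (rule schur_bordered[OF A B AB]) (rule L[OF im im])
    then show ?thesis using det unfolding 1 by (simp add: field_simps flip: power_mult_distrib)
  qed
  have "\<exists>c. (\<forall>S. finite S \<longrightarrow> bordered_total S ?a \<phi> = fact (card S) * c (card S)) \<and>
      (\<forall>k>(\<Sum>r<d. m - 0). c k = 0) \<and> (\<Sum>k\<le>(\<Sum>r<d. m - 0). c k) = pdet {..<d} (corrected \<kappa> ?a \<phi>)"
    by (rule bordered_total_expansion[OF \<kappa> \<phi>, where L="\<lambda>_. 0"]) (simp_all add: \<phi>0)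
  then obtain c where c: "\<And>S. finite S \<Longrightarrow> bordered_total S ?a \<phi> = fact (card S) * c (card S)"
    "\<And>k. k > (\<Sum>r<d. m - 0) \<Longrightarrow> c k = 0" "(\<Sum>k\<le>(\<Sum>r<d. m - 0). c k) = pdet {..<d} (corrected \<kappa> ?a \<phi>)"
    by blast
  let ?N = "\<Sum>r<d. m - 0"
  have fterm: "fredholm_term m \<rho> \<theta> L k = c k / Determinant.det A" for k
  proof -
    have "(\<Sum>i\<in>{..<k} \<rightarrow>\<^sub>E {1..m}. \<integral>y. fredholm_integrand \<theta> L k i y \<partial>points {..<k} i) =
      (\<Sum>i\<in>{..<k} \<rightarrow>\<^sub>E {1..m}. (- 1) ^ k / Determinant.det A * (\<integral>y. pdet (idx {..<k}) (bordered ?a \<phi> i y) \<partial>points {..<k} i))"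
      by (intro sum.cong refl) (simp add: integrand)
    also have "\<dots> = (- 1) ^ k / Determinant.det A * bordered_total {..<k} ?a \<phi>"
      by (simp add: bordered_total_def total_def sum_distrib_left)
    also have "\<dots> = (- 1) ^ k / Determinant.det A * (fact k * c k)" by (simp add: c(1))
    finally have "fredholm_term m \<rho> \<theta> L k = ((- 1) ^ k * (- 1) ^ k) * (c k / Determinant.det A)"
      by (simp add: fredholm_term_def)
    then show ?thesis by (simp flip: power_mult_distrib)
  qed
  show "fredholm_convergent m \<rho> \<theta> L"
    unfolding fredholm_convergent_def
  proof (intro conjI allI ballI)
    fix k :: nat and i assume i: "i \<in> {..<k} \<rightarrow>\<^sub>E {1..m}"
    have "integrable (points {..<k} i) (\<lambda>y. (- 1) ^ k / Determinant.det A * pdet (idx {..<k}) (bordered ?a \<phi> i y))"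
      by (intro integrable_mult_right bordered_integrable i \<phi>) auto
    then show "integrable (points {..<k} i) (fredholm_integrand \<theta> L k i)"
      by (simp add: integrand[OF i, abs_def] cong: Bochner_Integration.integrable_cong)
  next
    have "fredholm_term m \<rho> \<theta> L k = 0" if "k \<notin> {..?N}" for k
      using that c(2)[of k] fterm[of k] by simp
    then show "summable (fredholm_term m \<rho> \<theta> L)" by (intro summable_finite[of "{..?N}"]) auto
  qed
  have c0: "c 0 = Determinant.det A"
  proof -
    have "c 0 = bordered_total {} ?a \<phi>" using c(1)[of "{}"] by simp
    also have "\<dots> = pdet {..<d} ?a" by (rule bordered_total_empty)
    also have "\<dots> = Determinant.det (Matrix.mat d d (\<lambda>(r, c). A $$ (r, c)))" by (rule det_mat_eq_pdet[symmetric])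
    also have "Matrix.mat d d (\<lambda>(r, c). A $$ (r, c)) = A" using A by (intro eq_matI) auto
    finally show ?thesis .
  qed
  have "(\<Sum>k. fredholm_term m \<rho> \<theta> L (Suc k)) = (\<Sum>k<?N. c (Suc k) / Determinant.det A)"
    using c(2) by (subst suminf_finite[of "{..<?N}"]) (auto simp: fterm)
  also have "\<dots> = ((\<Sum>k\<le>?N. c k) - c 0) / Determinant.det A"
  proof -
    have "(\<Sum>k\<le>?N. c k) = c 0 + (\<Sum>k<?N. c (Suc k))"
      by (simp only: lessThan_Suc_atMost[symmetric] sum.lessThan_Suc_shift)
    then show ?thesis by (simp flip: sum_divide_distrib)
  qed
  finally show "fredholm_det m \<rho> \<theta> L = pdet {..<d} (corrected \<kappa> ?a \<phi>) / Determinant.det A"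
    unfolding fredholm_det_def c(3) c0 using det by (simp add: field_simps)
qed

end

section \<open>The kernel of the walk\<close>

text \<open>
  The setting that the two particles share. The set of forbidden positions at the \<open>j\<close>-th time has the
  indicator \<open>\<theta> j\<close>. The three inequalities for the weights bound $\psi$, $\phi$ and $U$ in this order. The function
  \<open>Q i l\<close> is the mean of $u^l$ at the last time, for a walk that starts at the \<open>i\<close>-th time and
  avoids the forbidden positions later on.
\<close>

locale walk_fredholm =
  fixes d m c :: nat and n :: "nat \<Rightarrow> nat" and x :: "nat \<Rightarrow> real" and \<rho> :: "nat \<Rightarrow> real measure"
    and \<theta> :: "nat \<Rightarrow> real \<Rightarrow> real" and w G :: "nat \<Rightarrow> real \<Rightarrow> real" and K1 K2 K3 :: real
    and Q :: "nat \<Rightarrow> nat \<Rightarrow> real \<Rightarrow> real"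
  assumes d: "1 \<le> d" and m: "1 \<le> m" and n_mono: "strict_mono_on {1..m} n" and c: "c \<le> n 1 + 1"
    and x: "\<And>r. r < d \<Longrightarrow> x 1 \<le> x (Suc r)"
    and \<theta>_measurable [measurable]: "\<And>j. \<theta> j \<in> borel_measurable borel"
    and \<theta>: "\<And>j y. \<theta> j y = 0 \<or> \<theta> j y = 1"
    and sigma: "\<And>j. sigma_finite_measure (\<rho> j)" and sets: "\<And>j. sets (\<rho> j) = sets borel"
    and \<rho>_start: "\<And>j r g. j \<in> {1..m} \<Longrightarrow> r < d \<Longrightarrow> half_exp_bounded g \<Longrightarrow>
       (\<integral>z. gamma_density (int (n j) - int c + int (Suc r)) (z - x (Suc r)) * g z \<partial>\<rho> j) =
       (exp_step ^^ (n j + Suc r - c)) g (x (Suc r))"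
    and \<rho>_later: "\<And>i j y g. i \<in> {1..m} \<Longrightarrow> j \<in> {1..m} \<Longrightarrow> i < j \<Longrightarrow> half_exp_bounded g \<Longrightarrow>
       (\<integral>z. gamma_density (int (n j) - int (n i)) (z - y) * g z \<partial>\<rho> j) = (exp_step ^^ (n j - n i)) g y"
    and w_nonneg: "\<And>j y. 0 \<le> w j y" and G_nonneg: "\<And>j y. 0 \<le> G j y"
    and K_nonneg: "0 \<le> K1" "0 \<le> K2" "0 \<le> K3"
    and weight_growth: "\<And>j y. j \<in> {1..m} \<Longrightarrow> \<theta> j y = 1 \<Longrightarrow> exp (\<bar>y\<bar> / 2) \<le> K1 * w j y"
    and weight_start: "\<And>j z. j \<in> {1..m} \<Longrightarrow> \<theta> j z = 1 \<Longrightarrow> x 1 \<le> z \<Longrightarrow> exp (- 3 / 4 * z) \<le> K2 * G j z"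
    and weight_step: "\<And>i j y z. i \<in> {1..m} \<Longrightarrow> j \<in> {1..m} \<Longrightarrow> i < j \<Longrightarrow> \<theta> i y = 1 \<Longrightarrow> \<theta> j z = 1 \<Longrightarrow> y \<le> z \<Longrightarrow>
       exp (- 3 / 4 * (z - y)) \<le> K3 * w i y * G j z"
    and weight_integrable: "\<And>j. j \<in> {1..m} \<Longrightarrow> integrable (\<rho> j) (\<lambda>y. w j y * G j y)"
    and Q_bounded: "\<And>i l. half_exp_bounded (Q i l)"
    and Q_last: "\<And>l. Q m l = (\<lambda>u. u ^ l)"
    and Q_step: "\<And>i l. 1 \<le> i \<Longrightarrow> i < m \<Longrightarrow>
       Q i l = (exp_step ^^ (n (Suc i) - n i)) (\<lambda>u. (1 - \<theta> (Suc i) u) * Q (Suc i) l u)"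
begin

lemma n_le: "1 \<le> i \<Longrightarrow> i \<le> j \<Longrightarrow> j \<le> m \<Longrightarrow> n i \<le> n j"
  using n_mono by (cases "i = j") (auto simp: strict_mono_on_def intro: less_imp_le)

lemma \<theta>_bounded: "\<bar>\<theta> j y\<bar> \<le> 1"
  using \<theta>[of j y] by auto

lemma \<theta>_Q_bounded: "half_exp_bounded (\<lambda>u. \<theta> j u * Q i l u)"
  by (rule half_exp_bounded_mult[OF Q_bounded \<theta>_measurable \<theta>_bounded])

lemma funpow_Q_outside:
  "(exp_step ^^ e) (\<lambda>u. (1 - \<theta> i u) * Q i l u) = (\<lambda>y. (exp_step ^^ e) (Q i l) y - (exp_step ^^ e) (\<lambda>u. \<theta> i u * Q i l u) y)"
proof -
  have "(\<lambda>u. (1 - \<theta> i u) * Q i l u) = (\<lambda>u. Q i l u - \<theta> i u * Q i l u)" by (simp add: left_diff_distrib)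
  then show ?thesis by (simp add: funpow_exp_step_diff[OF Q_bounded \<theta>_Q_bounded])
qed

text \<open>
  Drop all later constraints, and subtract the paths according to the last time \<open>j\<close> at which a constraint is
  broken without regard to the times in between; from there on the constraints are kept. With \<open>e = 0\<close>
  this says that \<open>\<theta> Q\<close> solves the equation \<open>resolvent\<close>.
\<close>

lemma Q_expansion:
  assumes "i \<le> m" "1 \<le> i"
  shows "(exp_step ^^ e) (Q i l) y = (exp_step ^^ (e + (n m - n i))) (\<lambda>u. u ^ l) y -
    (\<Sum>j=Suc i..m. (exp_step ^^ (e + (n j - n i))) (\<lambda>u. \<theta> j u * Q j l u) y)"
  using assms
proof (induction i arbitrary: e rule: inc_induct)
  case base
  then show ?case by (simp add: Q_last)
next
  case (step i)
  let ?e = "e + (n (Suc i) - n i)"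
  have e: "?e + (n j - n (Suc i)) = e + (n j - n i)" if "Suc i \<le> j" "j \<le> m" for j
    using n_le[of i "Suc i"] n_le[of "Suc i" j] step that by simp
  have "(exp_step ^^ e) (Q i l) y = (exp_step ^^ ?e) (\<lambda>u. (1 - \<theta> (Suc i) u) * Q (Suc i) l u) y"
    using step by (simp add: Q_step funpow_add)
  also have "\<dots> = (exp_step ^^ ?e) (Q (Suc i) l) y - (exp_step ^^ ?e) (\<lambda>u. \<theta> (Suc i) u * Q (Suc i) l u) y"
    by (simp add: funpow_Q_outside)
  also have "(exp_step ^^ ?e) (Q (Suc i) l) y = (exp_step ^^ (?e + (n m - n (Suc i)))) (\<lambda>u. u ^ l) y -
    (\<Sum>j=Suc (Suc i)..m. (exp_step ^^ (?e + (n j - n (Suc i)))) (\<lambda>u. \<theta> j u * Q j l u) y)"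
    using step by (intro step.IH) auto
  also have "?e + (n m - n (Suc i)) = e + (n m - n i)" using step by (intro e) auto
  also have "(\<Sum>j=Suc (Suc i)..m. (exp_step ^^ (?e + (n j - n (Suc i)))) (\<lambda>u. \<theta> j u * Q j l u) y) =
      (\<Sum>j=Suc (Suc i)..m. (exp_step ^^ (e + (n j - n i))) (\<lambda>u. \<theta> j u * Q j l u) y)"
    by (intro sum.cong refl) (simp only: e atLeastAtMost_iff Suc_leD)
  finally show ?case using step.hyps by (simp add: sum.atLeast_Suc_atMost[of "Suc i" m])
qed

definition \<psi> :: "nat \<Rightarrow> nat \<Rightarrow> real \<Rightarrow> real" where
  "\<psi> l i y = \<theta> i y * (exp_step ^^ (n m - n i)) (\<lambda>u. u ^ l) y"

definition U :: "nat \<Rightarrow> real \<Rightarrow> nat \<Rightarrow> real \<Rightarrow> real" where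
  "U i y j z = (if i \<in> {1..m} \<and> j \<in> {1..m} \<and> i < j then \<theta> i y * gamma_density (int (n j) - int (n i)) (z - y) * \<theta> j z else 0)"

definition \<phi> :: "nat \<Rightarrow> nat \<Rightarrow> real \<Rightarrow> real" where
  "\<phi> r j z = (if j \<in> {1..m} then \<theta> j z * gamma_density (int (n j) - int c + int (Suc r)) (z - x (Suc r)) else 0)"

lemma U_bound: "i \<in> {1..m} \<Longrightarrow> j \<in> {1..m} \<Longrightarrow> \<bar>U i y j z\<bar> \<le> (K3 * 4 ^ n m) * w i y * G j z"
proof (cases "i < j \<and> \<theta> i y = 1 \<and> \<theta> j z = 1 \<and> y \<le> z")
  case True
  assume ij: "i \<in> {1..m}" "j \<in> {1..m}"
  have "\<bar>U i y j z\<bar> = gamma_density (int (n j) - int (n i)) (z - y)"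
    using True ij gamma_density_nonneg by (simp add: U_def)
  also have "\<dots> \<le> 4 ^ nat (int (n j) - int (n i)) * exp (- 3 / 4 * (z - y))" by (rule gamma_density_bound)
  also have "\<dots> \<le> 4 ^ n m * (K3 * w i y * G j z)"
    using True ij weight_step[of i j y z] n_le[of j m] by (intro mult_mono power_increasing) auto
  finally show ?thesis by (simp add: mult_ac)
next
  case False
  then have "U i y j z = 0" using \<theta>[of i y] \<theta>[of j z] gamma_density_bound(2)[of "z - y"] by (auto simp: U_def)
  then show ?thesis using w_nonneg G_nonneg K_nonneg by simp
qed

lemma \<psi>_K: obtains K where "0 \<le> K" "K3 * 4 ^ n m \<le> K"
  "\<And>l j y. l < d \<Longrightarrow> j \<in> {1..m} \<Longrightarrow> \<bar>\<psi> l j y\<bar> \<le> K * w j y"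
proof -
  obtain C where C: "\<And>l i. 0 \<le> C l i" "\<And>l i y. \<bar>(exp_step ^^ (n m - n i)) (\<lambda>u. u ^ l) y\<bar> \<le> C l i * exp (\<bar>y\<bar> / 2)"
    using half_exp_bounded_constants[of "\<lambda>l i. (exp_step ^^ (n m - n i)) (\<lambda>u. u ^ l)"]
      half_exp_bounded_funpow[OF half_exp_bounded_power] by blast
  define K where "K = K3 * 4 ^ n m + (\<Sum>p\<in>{..<d} \<times> {1..m}. C (fst p) (snd p)) * K1"
  have s: "0 \<le> (\<Sum>p\<in>{..<d} \<times> {1..m}. C (fst p) (snd p))" using C by (intro sum_nonneg) auto
  show thesis
  proof
    show "0 \<le> K" "K3 * 4 ^ n m \<le> K" using s K_nonneg by (auto simp: K_def)
    fix l j y assume lj: "l < d" "j \<in> {1..m}"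
    show "\<bar>\<psi> l j y\<bar> \<le> K * w j y"
    proof (cases "\<theta> j y = 1")
      case True
      have "C l j \<le> (\<Sum>p\<in>{..<d} \<times> {1..m}. C (fst p) (snd p))"
        using lj C member_le_sum[of "(l, j)" "{..<d} \<times> {1..m}" "\<lambda>p. C (fst p) (snd p)"] by auto
      then have "C l j * K1 \<le> K" using K_nonneg unfolding K_def by (auto intro!: add_increasing mult_right_mono)
      have "\<bar>\<psi> l j y\<bar> \<le> C l j * exp (\<bar>y\<bar> / 2)" using C(2)[of j l y] True by (simp add: \<psi>_def)
      also have "\<dots> \<le> C l j * (K1 * w j y)" using weight_growth[OF lj(2) True] C by (intro mult_left_mono) auto
      also have "\<dots> = (C l j * K1) * w j y" by simp
      also have "\<dots> \<le> K * w j y" using \<open>C l j * K1 \<le> K\<close> w_nonneg by (rule mult_right_mono)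
      finally show ?thesis .
    next
      case False
      then show ?thesis using \<theta>[of j y] \<open>0 \<le> K\<close> w_nonneg by (simp add: \<psi>_def)
    qed
  qed
qed

lemma \<phi>_measurable: "\<phi> r j \<in> borel_measurable borel"
  unfolding \<phi>_def[abs_def] by measurable

lemma \<phi>_bound:
  assumes "r < d" "j \<in> {1..m}"
  shows "\<bar>\<phi> r j z\<bar> \<le> (4 ^ (n m + d) * exp (3 / 4 * x (Suc r)) * K2) * G j z"
proof (cases "\<theta> j z = 1 \<and> x (Suc r) \<le> z")
  case True
  let ?e = "int (n j) - int c + int (Suc r)"
  have "\<bar>\<phi> r j z\<bar> = gamma_density ?e (z - x (Suc r))"
    using True assms gamma_density_nonneg by (simp add: \<phi>_def)
  also have "\<dots> \<le> 4 ^ nat ?e * exp (- 3 / 4 * (z - x (Suc r)))" by (rule gamma_density_bound)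
  also have "exp (- 3 / 4 * (z - x (Suc r))) = exp (3 / 4 * x (Suc r)) * exp (- 3 / 4 * z)"
    by (simp add: field_simps flip: exp_add)
  also have "4 ^ nat ?e * \<dots> \<le> 4 ^ (n m + d) * (exp (3 / 4 * x (Suc r)) * (K2 * G j z))"
  proof (intro mult_mono power_increasing)
    show "exp (- 3 / 4 * z) \<le> K2 * G j z"
      using True x[OF assms(1)] by (intro weight_start assms) auto
    show "nat ?e \<le> n m + d" using n_le[of j m] assms by simp
  qed (use G_nonneg K_nonneg in auto)
  finally show ?thesis by (simp add: mult_ac)
next
  case False
  then have "\<phi> r j z = 0" using \<theta>[of j z] gamma_density_bound(2)[of "z - x (Suc r)"] by (auto simp: \<phi>_def)
  then show ?thesis using G_nonneg K_nonneg by simp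
qed

text \<open>
  Here \<open>corrected\<close> of the moment matrix is \<open>Q_expansion\<close> at the first time, with the starting points in
  the place of the positions.
\<close>

theorem fredholm_det_walk_kernel:
  assumes det: "Determinant.det (moment_mat c d (n m) x) \<noteq> 0"
  shows "fredholm_convergent m \<rho> \<theta> (walk_kernel c d m n x)"
    and "fredholm_det m \<rho> \<theta> (walk_kernel c d m n x) =
      pdet {..<d} (\<lambda>r l. (exp_step ^^ (n 1 + Suc r - c)) (\<lambda>u. (1 - \<theta> 1 u) * Q 1 l u) (x (Suc r))) /
      Determinant.det (moment_mat c d (n m) x)"
proof -
  define A where "A = moment_mat c d (n m) x"
  define B where "B = the (mat_inverse A)"
  have A: "A \<in> carrier_mat d d" by (simp add: A_def moment_mat_def)
  have "A \<in> Units (ring_mat TYPE(real) d ())"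
    using det unfolding A_def[symmetric] by (rule det_non_zero_imp_unit[OF A])
  then have "mat_inverse A \<noteq> None" using mat_inverse(1)[OF A, of "()"] by blast
  then obtain B' where "mat_inverse A = Some B'" by blast
  then have "mat_inverse A = Some B" by (simp only: B_def option.sel)
  then have B: "A * B = 1\<^sub>m d" "B \<in> carrier_mat d d"
    using mat_inverse(2)[OF A, of B] by simp_all
  obtain K where K: "0 \<le> K" "K3 * 4 ^ n m \<le> K"
      "\<And>l j y. l < d \<Longrightarrow> j \<in> {1..m} \<Longrightarrow> \<bar>\<psi> l j y\<bar> \<le> K * w j y"
    using \<psi>_K by blast
  note Ks = K_nonneg
  interpret bordered_kernel m d \<rho> w G K \<psi> U
  proof (rule bordered_kernel.intro)
    show "\<psi> l j \<in> borel_measurable borel" for l j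
      unfolding \<psi>_def[abs_def]
      by (intro borel_measurable_times \<theta>_measurable half_exp_bounded_measurable half_exp_bounded_funpow half_exp_bounded_power)
    show "(\<lambda>(y, z). U i y j z) \<in> borel_measurable (borel \<Otimes>\<^sub>M borel)" for i j
      unfolding U_def by measurable
    show "\<bar>U i y j z\<bar> \<le> K * w i y * G j z" if "i \<in> {1..m}" "j \<in> {1..m}" for i y j z
      using order_trans[OF U_bound[OF that] mult_right_mono[OF mult_right_mono[OF K(2) w_nonneg] G_nonneg]] .
    show "U i y j z = 0" if "j \<le> i" for i y j z using that by (simp add: U_def)
  qed (rule sigma sets w_nonneg G_nonneg K(1) weight_integrable K(3); assumption)+
  have dom: "dominated (\<phi> r)" if "r < d" for r
    unfolding dominated_def using \<phi>_measurable \<phi>_bound[OF that] Ks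
    by (auto intro!: exI[of _ "4 ^ (n m + d) * exp (3 / 4 * x (Suc r)) * K2"])
  define \<kappa> where "\<kappa> l i y = \<theta> i y * Q i l y" for l i y
  have \<kappa>_bounded: "half_exp_bounded (\<kappa> l i)" for l i
    using \<theta>_Q_bounded[of i i l] by (simp add: \<kappa>_def[abs_def])
  have idem: "\<theta> j y * \<theta> j y = \<theta> j y" for j y using \<theta>[of j y] by auto
  have res: "resolvent \<kappa>"
    unfolding resolvent_def
  proof (intro conjI allI impI ballI)
    show "\<kappa> l j \<in> borel_measurable borel" for l j by (rule half_exp_bounded_measurable[OF \<kappa>_bounded])
    obtain C where C: "\<And>l i. 0 \<le> C l i" "\<And>l i y. \<bar>\<kappa> l i y\<bar> \<le> C l i * exp (\<bar>y\<bar> / 2)"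
      using half_exp_bounded_constants[of \<kappa>] \<kappa>_bounded by blast
    let ?S = "\<Sum>p\<in>{..<d} \<times> {1..m}. C (fst p) (snd p)"
    show "\<exists>C\<ge>0. \<forall>l<d. \<forall>j\<in>{1..m}. \<forall>y. \<bar>\<kappa> l j y\<bar> \<le> C * w j y"
    proof (intro exI[of _ "?S * K1"] conjI allI impI ballI)
      show "0 \<le> ?S * K1" using C Ks by (intro mult_nonneg_nonneg sum_nonneg) auto
      fix l j y assume lj: "l < d" "j \<in> {1..m}"
      show "\<bar>\<kappa> l j y\<bar> \<le> ?S * K1 * w j y"
      proof (cases "\<theta> j y = 1")
        case True
        have "\<bar>\<kappa> l j y\<bar> \<le> C l j * exp (\<bar>y\<bar> / 2)" by (rule C)
        also have "\<dots> \<le> ?S * (K1 * w j y)"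
          using lj C member_le_sum[of "(l, j)" "{..<d} \<times> {1..m}" "\<lambda>p. C (fst p) (snd p)"]
          by (intro mult_mono weight_growth True sum_nonneg) auto
        finally show ?thesis by simp
      next
        case False
        then show ?thesis using \<theta>[of j y] \<open>0 \<le> ?S * K1\<close> w_nonneg by (simp add: \<kappa>_def)
      qed
    qed
    fix l j y assume lj: "l < d" "j \<in> {1..m}"
    have "(\<Sum>j'=1..m. \<integral>z. U j y j' z * \<kappa> l j' z \<partial>\<rho> j') =
        (\<Sum>j'=Suc j..m. \<theta> j y * (exp_step ^^ (n j' - n j)) (\<kappa> l j') y)"
    proof (rule sum.mono_neutral_cong_right)
      fix j' assume j': "j' \<in> {Suc j..m}"
      have "(\<lambda>z. U j y j' z * \<kappa> l j' z) = (\<lambda>z. \<theta> j y * (gamma_density (int (n j') - int (n j)) (z - y) * \<kappa> l j' z))"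
        using j' lj idem[of j'] by (auto simp: U_def \<kappa>_def fun_eq_iff mult.assoc[symmetric]) 
      then have "(\<integral>z. U j y j' z * \<kappa> l j' z \<partial>\<rho> j') = \<theta> j y * (\<integral>z. gamma_density (int (n j') - int (n j)) (z - y) * \<kappa> l j' z \<partial>\<rho> j')"
        by simp
      also have "\<dots> = \<theta> j y * (exp_step ^^ (n j' - n j)) (\<kappa> l j') y"
        using lj j' by (subst \<rho>_later) (auto intro: \<kappa>_bounded)
      finally show "(\<integral>z. U j y j' z * \<kappa> l j' z \<partial>\<rho> j') = \<theta> j y * (exp_step ^^ (n j' - n j)) (\<kappa> l j') y" .
    qed (use lj in \<open>auto simp: U_def\<close>)
    moreover have "\<kappa> l j y = \<theta> j y * ((exp_step ^^ (n m - n j)) (\<lambda>u. u ^ l) y -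
        (\<Sum>j'=Suc j..m. (exp_step ^^ (n j' - n j)) (\<kappa> l j') y))"
      using Q_expansion[of j 0 l y] lj by (simp add: \<kappa>_def[abs_def])
    ultimately show "\<kappa> l j y = \<psi> l j y - (\<Sum>j'=1..m. \<integral>z. U j y j' z * \<kappa> l j' z \<partial>\<rho> j')"
      by (simp add: \<psi>_def right_diff_distrib sum_distrib_left)
  qed
  have entry: "A $$ (r, l) = (exp_step ^^ (n m + Suc r - c)) (\<lambda>u. u ^ l) (x (Suc r))" if "r < d" "l < d" for r l
  proof -
    have "int (n m) - int c + int (Suc r) = int (n m + Suc r - c)" using c n_le[of 1 m] m by simp
    then have "gamma_moment (int (n m) - int c + int (Suc r)) (x (Suc r)) l = (exp_step ^^ (n m + Suc r - c)) (\<lambda>u. u ^ l) (x (Suc r))"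
      by (simp only: gamma_moment_eq)
    then show ?thesis using that by (simp add: A_def moment_mat_def)
  qed
  have kernel: "\<theta> i y * walk_kernel c d m n x i y j z * \<theta> j z =
      - U i y j z + (\<Sum>p<d. \<Sum>l<d. \<psi> p i y * B $$ (p, l) * \<phi> l j z)" if ij: "i \<in> {1..m}" "j \<in> {1..m}" for i y j z
  proof -
    have mom: "gamma_moment (int (n m) - int (n i)) y p = (exp_step ^^ (n m - n i)) (\<lambda>u. u ^ p) y" for p
      using n_le[of i m] ij gamma_moment_eq[of "n m - n i" y p] by (simp add: of_nat_diff)
    have shift: "(\<Sum>k=1..d. f k) = (\<Sum>p<d. f (Suc p))" for f :: "nat \<Rightarrow> real"
      by (rule sum.reindex_bij_witness[where i=Suc and j="\<lambda>k. k - 1"]) auto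
    have "(\<Sum>k=1..d. \<Sum>l=1..d. gamma_moment (int (n m) - int (n i)) y (k - 1) * B $$ (k - 1, l - 1) *
        gamma_density (int (n j) - int c + int l) (z - x l)) =
      (\<Sum>p<d. \<Sum>l<d. gamma_moment (int (n m) - int (n i)) y p * B $$ (p, l) *
        gamma_density (int (n j) - int c + int (Suc l)) (z - x (Suc l)))"
      by (simp only: shift diff_Suc_1)
    then have "walk_kernel c d m n x i y j z = - (gamma_density (int (n j) - int (n i)) (z - y) * of_bool (i < j)) +
      (\<Sum>p<d. \<Sum>l<d. (exp_step ^^ (n m - n i)) (\<lambda>u. u ^ p) y * B $$ (p, l) *
        gamma_density (int (n j) - int c + int (Suc l)) (z - x (Suc l)))"
      by (simp add: walk_kernel_def mom B_def A_def)
    moreover have "U i y j z = \<theta> i y * (gamma_density (int (n j) - int (n i)) (z - y) * of_bool (i < j)) * \<theta> j z"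
      using ij by (simp add: U_def)
    moreover have "(\<Sum>p<d. \<Sum>l<d. \<psi> p i y * B $$ (p, l) * \<phi> l j z) =
      \<theta> i y * (\<Sum>p<d. \<Sum>l<d. (exp_step ^^ (n m - n i)) (\<lambda>u. u ^ p) y * B $$ (p, l) *
        gamma_density (int (n j) - int c + int (Suc l)) (z - x (Suc l))) * \<theta> j z"
      using ij by (simp add: \<psi>_def \<phi>_def sum_distrib_left sum_distrib_right mult_ac)
    ultimately show ?thesis by (simp only: distrib_left distrib_right mult_minus_left mult_minus_right)
  qed
  have \<phi>0: "\<phi> r 0 z = 0" for r z by (simp add: \<phi>_def)
  have corr: "corrected \<kappa> (\<lambda>r c. A $$ (r, c)) \<phi> r l =
     (exp_step ^^ (n 1 + Suc r - c)) (\<lambda>u. (1 - \<theta> 1 u) * Q 1 l u) (x (Suc r))" if "r < d" "l < d" for r l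
  proof -
    let ?e = "n 1 + Suc r - c"
    have e: "?e + (n j - n 1) = n j + Suc r - c" if "j \<in> {1..m}" for j using n_le[of 1 j] that c by simp
    have "(\<integral>z. \<phi> r j z * \<kappa> l j z \<partial>\<rho> j) = (exp_step ^^ (?e + (n j - n 1))) (\<kappa> l j) (x (Suc r))" if j: "j \<in> {1..m}" for j
    proof -
      have "(\<lambda>z. \<phi> r j z * \<kappa> l j z) = (\<lambda>z. gamma_density (int (n j) - int c + int (Suc r)) (z - x (Suc r)) * \<kappa> l j z)"
        using j \<theta> by (auto simp: \<phi>_def \<kappa>_def fun_eq_iff)
      then show ?thesis using \<rho>_start[OF j \<open>r < d\<close> \<kappa>_bounded] by (simp only: e[OF j])
    qed
    then have "corrected \<kappa> (\<lambda>r c. A $$ (r, c)) \<phi> r l = (exp_step ^^ (?e + (n m - n 1))) (\<lambda>u. u ^ l) (x (Suc r)) -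
        (\<Sum>j=1..m. (exp_step ^^ (?e + (n j - n 1))) (\<kappa> l j) (x (Suc r)))"
      using m e[of m] by (simp add: corrected_def entry[OF that])
    also have "\<dots> = (exp_step ^^ ?e) (Q 1 l) (x (Suc r)) - (exp_step ^^ ?e) (\<kappa> l 1) (x (Suc r))"
    proof -
      have "(\<Sum>j=1..m. (exp_step ^^ (?e + (n j - n 1))) (\<kappa> l j) (x (Suc r))) =
         (exp_step ^^ (?e + (n 1 - n 1))) (\<kappa> l 1) (x (Suc r)) +
         (\<Sum>j=Suc 1..m. (exp_step ^^ (?e + (n j - n 1))) (\<kappa> l j) (x (Suc r)))"
        using m by (rule sum.atLeast_Suc_atMost)
      moreover have "(exp_step ^^ ?e) (Q 1 l) (x (Suc r)) = (exp_step ^^ (?e + (n m - n 1))) (\<lambda>u. u ^ l) (x (Suc r)) -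
         (\<Sum>j=Suc 1..m. (exp_step ^^ (?e + (n j - n 1))) (\<kappa> l j) (x (Suc r)))"
        using Q_expansion[OF m order_refl] by (simp only: \<kappa>_def[abs_def])
      ultimately show ?thesis by simp
    qed
    also have "\<dots> = (exp_step ^^ ?e) (\<lambda>u. (1 - \<theta> 1 u) * Q 1 l u) (x (Suc r))"
      by (simp add: funpow_Q_outside \<kappa>_def[abs_def])
    finally show ?thesis .
  qed
  have det': "Determinant.det A \<noteq> 0" using det by (simp add: A_def)
  show "fredholm_convergent m \<rho> \<theta> (walk_kernel c d m n x)"
    by (rule fredholm_det_bordered(1)[OF A B(2) B(1) det' \<theta> kernel dom \<phi>0 res])
  have "fredholm_det m \<rho> \<theta> (walk_kernel c d m n x) = pdet {..<d} (corrected \<kappa> (\<lambda>r c. A $$ (r, c)) \<phi>) / Determinant.det A"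
    by (rule fredholm_det_bordered(2)[OF A B(2) B(1) det' \<theta> kernel dom \<phi>0 res])
  also have "pdet {..<d} (corrected \<kappa> (\<lambda>r c. A $$ (r, c)) \<phi>) =
     pdet {..<d} (\<lambda>r l. (exp_step ^^ (n 1 + Suc r - c)) (\<lambda>u. (1 - \<theta> 1 u) * Q 1 l u) (x (Suc r)))"
    by (rule pdet_cong) (simp add: corr del: One_nat_def)
  finally show "fredholm_det m \<rho> \<theta> (walk_kernel c d m n x) =
      pdet {..<d} (\<lambda>r l. (exp_step ^^ (n 1 + Suc r - c)) (\<lambda>u. (1 - \<theta> 1 u) * Q 1 l u) (x (Suc r))) /
      Determinant.det (moment_mat c d (n m) x)" by (simp add: A_def)
qed

end

section \<open>From the transformed process to the killed walk\<close>

lemma weyl_chamber_iff_ordered: "z \<in> weyl_chamber d \<longleftrightarrow> ordered d (\<lambda>k. z (Suc k))"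
proof
  assume z: "z \<in> weyl_chamber d"
  show "ordered d (\<lambda>k. z (Suc k))" unfolding ordered_def
  proof (intro allI impI)
    fix k assume "Suc k < d"
    then show "z (Suc k) \<le> z (Suc (Suc k))"
      using z unfolding weyl_chamber_def mem_Collect_eq by (intro mono_onD[of "{1..d}" z]) auto
  qed
next
  assume z: "ordered d (\<lambda>k. z (Suc k))"
  show "z \<in> weyl_chamber d" unfolding weyl_chamber_def mem_Collect_eq
  proof (rule mono_onI)
    fix i j assume "i \<in> {1..d}" "j \<in> {1..d}" "i \<le> j"
    then show "z i \<le> z j" using ordered_mono[OF z, of "i - 1" "j - 1"] by simp
  qed
qed

lemma less_exit_time_iff: "enat n < exit_time d S \<omega> \<longleftrightarrow> (\<forall>t\<in>{1..n}. S t \<omega> \<in> weyl_chamber d)"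
proof -
  let ?A = "{enat t | t. 1 \<le> t \<and> S t \<omega> \<notin> weyl_chamber d}"
  have "enat n < Inf ?A \<longleftrightarrow> (\<forall>a\<in>?A. enat n < a)"
  proof
    assume "enat n < Inf ?A"
    then show "\<forall>a\<in>?A. enat n < a" by (meson Inf_lower less_le_trans)
  next
    assume a: "\<forall>a\<in>?A. enat n < a"
    show "enat n < Inf ?A"
    proof (cases "?A = {}")
      case True
      then show ?thesis by (simp only: Inf_enat_def if_True) simp
    next
      case False
      then have "Inf ?A \<in> ?A" unfolding Inf_enat_def by (simp only: if_False) (meson LeastI ex_in_conv)
      then show ?thesis using a by blast
    qed
  qed
  also have "(\<forall>a\<in>?A. enat n < a) \<longleftrightarrow> (\<forall>t\<in>{1..n}. S t \<omega> \<in> weyl_chamber d)"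
  proof
    assume a: "\<forall>a\<in>?A. enat n < a"
    show "\<forall>t\<in>{1..n}. S t \<omega> \<in> weyl_chamber d"
    proof (rule ballI, rule ccontr)
      fix t assume "t \<in> {1..n}" "S t \<omega> \<notin> weyl_chamber d"
      then have "enat t \<in> ?A" by auto
      then have "enat n < enat t" using a by blast
      then show False using \<open>t \<in> {1..n}\<close> by simp
    qed
  next
    assume a: "\<forall>t\<in>{1..n}. S t \<omega> \<in> weyl_chamber d"
    show "\<forall>a\<in>?A. enat n < a"
    proof
      fix a assume "a \<in> ?A"
      then obtain t where t: "a = enat t" "1 \<le> t" "S t \<omega> \<notin> weyl_chamber d" by blast
      then have "\<not> t \<le> n" using a by auto
      then show "enat n < a" using t by simp
    qed
  qed
  finally show ?thesis unfolding exit_time_def .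
qed

text \<open>
  Independence refers to the numbering of the particles from 1, the product measure \<open>step_law\<close> to the one
  from 0.
\<close>

lemma (in prob_space) indep_vars_inj_reindex:
  assumes f: "inj_on f I" and ind: "indep_vars M' X (f ` I)"
  shows "indep_vars (\<lambda>i. M' (f i)) (\<lambda>i. X (f i)) I"
  unfolding indep_vars_def2
proof (intro conjI ballI indep_setsI)
  let ?F = "\<lambda>i. {X i -` A \<inter> space M | A. A \<in> sets (M' i)}"
  have rv: "\<And>i. i \<in> f ` I \<Longrightarrow> random_variable (M' i) (X i)" and sets: "indep_sets ?F (f ` I)"
    using ind unfolding indep_vars_def2 by auto
  show "random_variable (M' (f i)) (X (f i))" if "i \<in> I" for i using rv that by simp
  show "?F (f i) \<subseteq> events" if "i \<in> I" for i
    using sets that unfolding indep_sets_def by blast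
  fix A J assume J: "J \<noteq> {}" "J \<subseteq> I" "finite J" and A: "\<forall>j\<in>J. A j \<in> ?F (f j)"
  define A' where "A' = A \<circ> inv_into I f"
  have A': "A' (f j) = A j" if "j \<in> J" for j
    unfolding A'_def using inv_into_f_f[OF f, of j] that J by auto
  have "prob (\<Inter>j\<in>f ` J. A' j) = (\<Prod>j\<in>f ` J. prob (A' j))"
  proof (rule indep_setsD[OF sets])
    show "f ` J \<subseteq> f ` I" "f ` J \<noteq> {}" "finite (f ` J)" using J by auto
    show "\<forall>j\<in>f ` J. A' j \<in> ?F j" using A A' by simp
  qed
  moreover have "(\<Inter>j\<in>f ` J. A' j) = (\<Inter>j\<in>J. A j)" using A' by simp
  moreover have "(\<Prod>j\<in>f ` J. prob (A' j)) = (\<Prod>j\<in>J. prob (A j))"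
    using A' inj_on_subset[OF f J(2)] by (simp add: prod.reindex)
  ultimately show "prob (\<Inter>j\<in>J. A j) = (\<Prod>j\<in>J. prob (A j))" by simp
qed

lemma iid_exponential_law:
  assumes iid: "iid_exponential M d X" and "1 \<le> N" "1 \<le> d"
  shows "distr M (PiM ({1..N} \<times> {..<d}) (\<lambda>_. borel)) (\<lambda>\<omega>. \<lambda>p\<in>{1..N} \<times> {..<d}. X (fst p) (Suc (snd p)) \<omega>) =
    step_law ({1..N} \<times> {..<d})"
    and "(\<lambda>\<omega>. \<lambda>p\<in>{1..N} \<times> {..<d}. X (fst p) (Suc (snd p)) \<omega>) \<in> measurable M (step_law ({1..N} \<times> {..<d}))"
proof -
  let ?I = "{1..N} \<times> {..<d}"
  let ?f = "\<lambda>p. (fst p, Suc (snd p))"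
  interpret prob_space M using iid by (simp add: iid_exponential_def)
  have dist: "distributed M lborel (X i j) (exponential_density 1)" if "1 \<le> i" "j \<in> {1..d}" for i j
    using iid that by (simp add: iid_exponential_def)
  have rv: "X i j \<in> borel_measurable M" if "1 \<le> i" "j \<in> {1..d}" for i j
    using distributed_measurable[OF dist[OF that]] by simp
  have law: "distr M borel (X i j) = gamma_law 0" if "1 \<le> i" "j \<in> {1..d}" for i j
  proof -
    have "distr M borel (X i j) = distr M lborel (X i j)" by (rule distr_cong) auto
    then show ?thesis using distributed_distr_eq_density[OF dist[OF that]] by simp
  qed
  have ind: "indep_vars (\<lambda>_. borel) (\<lambda>p. X (fst p) (snd p)) ({1..} \<times> {1..d})"
    using iid by (simp add: iid_exponential_def split_def)
  have "inj_on ?f ?I" by (auto simp: inj_on_def)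
  have "indep_vars (\<lambda>_. borel) (\<lambda>p. X (fst p) (snd p)) (?f ` ?I)"
    by (rule indep_vars_subset[OF ind]) auto
  then have "indep_vars (\<lambda>_. borel) (\<lambda>p. X (fst p) (Suc (snd p))) ?I"
    using indep_vars_inj_reindex[OF \<open>inj_on ?f ?I\<close>, of "\<lambda>_. borel" "\<lambda>p. X (fst p) (snd p)"] by simp
  moreover have "(1, 0) \<in> ?I" using assms by simp
  then have "?I \<noteq> {}" by blast
  ultimately have "distr M (PiM ?I (\<lambda>_. borel)) (\<lambda>\<omega>. \<lambda>p\<in>?I. X (fst p) (Suc (snd p)) \<omega>) =
      PiM ?I (\<lambda>p. distr M borel (X (fst p) (Suc (snd p))))"
    by (subst (asm) indep_vars_iff_distr_eq_PiM') (auto intro: rv)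
  also have "\<dots> = step_law ?I" by (intro PiM_cong law) auto
  finally show "distr M (PiM ?I (\<lambda>_. borel)) (\<lambda>\<omega>. \<lambda>p\<in>?I. X (fst p) (Suc (snd p)) \<omega>) = step_law ?I" .
  show "(\<lambda>\<omega>. \<lambda>p\<in>?I. X (fst p) (Suc (snd p)) \<omega>) \<in> measurable M (step_law ?I)"
    by (rule measurable_restrict) (auto intro: rv)
qed

text \<open>
  The case $F = 1$, $n = 0$ of the transform shows that $h(x) \ne 0$: otherwise the right-hand side, a quotient
  by zero, would be 0 instead of 1.
\<close>

lemma doob_transform_probability:
  assumes iid: "iid_exponential M d X" and Z: "ordered_exponential_walk M X d x N Z"
    and "1 \<le> d" "1 \<le> T" "c < d" and C: "\<And>t. C t \<in> sets borel"
  shows "h_fun d x \<noteq> 0"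
    and "measure N {\<omega>\<in>space N. \<forall>t\<in>{1..T}. Z t \<omega> (Suc c) \<in> C t} * h_fun d x =
      (\<integral>\<omega>. of_bool (confined d c C T (position (\<lambda>k. x (Suc k)) \<omega>)) *
         pdet {..<d} (\<lambda>k l. (exp_step ^^ k) (\<lambda>u. u ^ l) (position (\<lambda>k. x (Suc k)) \<omega> T k))
         \<partial>step_law ({1..T} \<times> {..<d}))"
proof -
  interpret N: prob_space N using Z by (simp add: ordered_exponential_walk_def)
  have Zm: "(\<lambda>\<omega>. Z k \<omega> j) \<in> borel_measurable N" if "j \<in> {1..d}" for k j
    using Z that by (simp add: ordered_exponential_walk_def)
  have doob: "(\<integral>\<omega>. F (trajectory d n Z \<omega>) \<partial>N) =
        (\<integral>\<omega>. h_fun d (walk X x n \<omega>) / h_fun d x * F (trajectory d n (walk X x) \<omega>) *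
              indicator {\<omega>. enat n < exit_time d (walk X x) \<omega>} \<omega> \<partial>M)"
    if "F \<in> borel_measurable (path_space d n)" "bounded (F ` space (path_space d n))" for F n
    using Z that unfolding ordered_exponential_walk_def by blast
  show h: "h_fun d x \<noteq> 0"
  proof
    assume "h_fun d x = 0"
    moreover have "bounded ((\<lambda>_. 1 :: real) ` space (path_space d 0))" by (rule boundedI[of _ 1]) auto
    ultimately have "(\<integral>\<omega>. (1 :: real) \<partial>N) = 0" using doob[of "\<lambda>_. 1" 0] by simp
    then show False using N.prob_space by simp
  qed
  define F where "F p = (of_bool (\<forall>t\<in>{1..T}. p t (Suc c) \<in> C t) :: real)" for p :: "nat \<Rightarrow> nat \<Rightarrow> real"
  have F_meas: "F \<in> borel_measurable (path_space d T)"
  proof -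
    have "(\<lambda>p. p t (Suc c)) \<in> borel_measurable (path_space d T)" if "t \<in> {1..T}" for t
    proof -
      have "(\<lambda>p. p t) \<in> measurable (path_space d T) (PiM {1..d} (\<lambda>_. borel :: real measure))"
        unfolding path_space_def using that by (intro measurable_component_singleton) auto
      moreover have "(\<lambda>q. q (Suc c)) \<in> measurable (PiM {1..d} (\<lambda>_. borel :: real measure)) borel"
        using \<open>c < d\<close> by (intro measurable_component_singleton) auto
      ultimately show ?thesis by (rule measurable_compose)
    qed
    then have [measurable]: "Measurable.pred (path_space d T) (\<lambda>p. \<forall>t\<in>{1..T}. p t (Suc c) \<in> C t)"
      by (intro pred_intros_finite pred_sets2[OF C]) auto
    show ?thesis unfolding F_def[abs_def] by measurable
  qed
  have F_bounded: "bounded (F ` space (path_space d T))"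
    by (rule boundedI[of _ 1]) (auto simp: F_def)
  let ?E = "{\<omega>\<in>space N. \<forall>t\<in>{1..T}. Z t \<omega> (Suc c) \<in> C t}"
  have E_meas: "?E \<in> sets N"
  proof -
    have "Measurable.pred N (\<lambda>\<omega>. \<forall>t\<in>{1..T}. Z t \<omega> (Suc c) \<in> C t)"
      using \<open>c < d\<close> by (intro pred_intros_finite pred_sets2[OF C] Zm) auto
    then show ?thesis by (simp add: pred_def)
  qed
  have "measure N ?E = (\<integral>\<omega>. indicator ?E \<omega> \<partial>N)" using E_meas by simp
  also have "\<dots> = (\<integral>\<omega>. F (trajectory d T Z \<omega>) \<partial>N)"
    using \<open>c < d\<close> by (intro Bochner_Integration.integral_cong refl) (auto simp: F_def trajectory_def indicator_def)
  also have "\<dots> = (\<integral>\<omega>. h_fun d (walk X x T \<omega>) / h_fun d x * F (trajectory d T (walk X x) \<omega>) *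
              indicator {\<omega>. enat T < exit_time d (walk X x) \<omega>} \<omega> \<partial>M)"
    by (rule doob[OF F_meas F_bounded])
  also have "\<dots> = (\<integral>\<omega>. (1 / h_fun d x) * (of_bool (confined d c C T (\<lambda>t k. walk X x t \<omega> (Suc k))) *
         pdet {..<d} (\<lambda>k l. (exp_step ^^ k) (\<lambda>u. u ^ l) (walk X x T \<omega> (Suc k)))) \<partial>M)"
  proof (intro Bochner_Integration.integral_cong refl)
    fix \<omega>
    have "F (trajectory d T (walk X x) \<omega>) * indicator {\<omega>. enat T < exit_time d (walk X x) \<omega>} \<omega> =
      (of_bool (confined d c C T (\<lambda>t k. walk X x t \<omega> (Suc k))) :: real)"
      using \<open>c < d\<close> by (auto simp: F_def trajectory_def less_exit_time_iff weyl_chamber_iff_ordered confined_def indicator_def)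
    then show "h_fun d (walk X x T \<omega>) / h_fun d x * F (trajectory d T (walk X x) \<omega>) *
              indicator {\<omega>. enat T < exit_time d (walk X x) \<omega>} \<omega> =
       (1 / h_fun d x) * (of_bool (confined d c C T (\<lambda>t k. walk X x t \<omega> (Suc k))) *
         pdet {..<d} (\<lambda>k l. (exp_step ^^ k) (\<lambda>u. u ^ l) (walk X x T \<omega> (Suc k))))"
      by (simp add: h_fun_eq_pdet mult.assoc) 
  qed
  also have "\<dots> = (1 / h_fun d x) * (\<integral>\<omega>. of_bool (confined d c C T (\<lambda>t k. walk X x t \<omega> (Suc k))) *
         pdet {..<d} (\<lambda>k l. (exp_step ^^ k) (\<lambda>u. u ^ l) (walk X x T \<omega> (Suc k))) \<partial>M)"
    by (rule integral_mult_right_zero)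
  finally have 1: "measure N ?E * h_fun d x = (\<integral>\<omega>. of_bool (confined d c C T (\<lambda>t k. walk X x t \<omega> (Suc k))) *
         pdet {..<d} (\<lambda>k l. (exp_step ^^ k) (\<lambda>u. u ^ l) (walk X x T \<omega> (Suc k))) \<partial>M)"
    using h by simp
  let ?I = "{1..T} \<times> {..<d}"
  let ?X = "\<lambda>\<omega>. \<lambda>p\<in>?I. X (fst p) (Suc (snd p)) \<omega>"
  let ?g = "\<lambda>\<omega>. of_bool (confined d c C T (position (\<lambda>k. x (Suc k)) \<omega>)) *
         pdet {..<d} (\<lambda>k l. (exp_step ^^ k) (\<lambda>u. u ^ l) (position (\<lambda>k. x (Suc k)) \<omega> T k))"
  have "integrable (step_law ?I) ?g"
    by (intro walk_determinant_integrable half_exp_bounded_funpow half_exp_bounded_power confined_measurable C \<open>c < d\<close>)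
  then have g_meas: "?g \<in> borel_measurable (step_law ?I)" by (rule borel_measurable_integrable)
  have pos: "position (\<lambda>k. x (Suc k)) (?X \<omega>) t k = walk X x t \<omega> (Suc k)" if "t \<le> T" "k < d" for \<omega> t k
    unfolding position_def walk_def using that by (intro arg_cong2[where f="(+)"] refl sum.cong) auto
  have "(\<integral>\<omega>. ?g \<omega> \<partial>step_law ?I) = (\<integral>\<omega>. ?g \<omega> \<partial>distr M (step_law ?I) ?X)"
  proof -
    have "distr M (step_law ?I) ?X = distr M (PiM ?I (\<lambda>_. borel)) ?X"
      by (intro distr_cong refl sets_PiM_cong) simp_all
    then show ?thesis by (simp only: iid_exponential_law(1)[OF iid \<open>1 \<le> T\<close> \<open>1 \<le> d\<close>])
  qed
  also have "\<dots> = (\<integral>\<omega>. ?g (?X \<omega>) \<partial>M)"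
    by (rule integral_distr[OF iid_exponential_law(2)[OF iid \<open>1 \<le> T\<close> \<open>1 \<le> d\<close>] g_meas])
  also have "\<dots> = (\<integral>\<omega>. of_bool (confined d c C T (\<lambda>t k. walk X x t \<omega> (Suc k))) *
         pdet {..<d} (\<lambda>k l. (exp_step ^^ k) (\<lambda>u. u ^ l) (walk X x T \<omega> (Suc k))) \<partial>M)"
  proof (intro Bochner_Integration.integral_cong refl arg_cong2[where f="(*)"] arg_cong[where f=of_bool] pdet_cong)
    fix \<omega>
    have ord: "ordered d z = ordered d z'" if "\<And>k. k < d \<Longrightarrow> z k = z' k" for z z'
      unfolding ordered_def using that by auto
    show "confined d c C T (position (\<lambda>k. x (Suc k)) (?X \<omega>)) = confined d c C T (\<lambda>t k. walk X x t \<omega> (Suc k))"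
      unfolding confined_def
    proof (intro ball_cong refl conj_cong ord)
      fix t assume "t \<in> {1..T}"
      then have t: "t \<le> T" by simp
      show "position (\<lambda>k. x (Suc k)) (?X \<omega>) t k = walk X x t \<omega> (Suc k)" if "k < d" for k by (rule pos[OF t that])
      show "position (\<lambda>k. x (Suc k)) (?X \<omega>) t c \<in> C t \<longleftrightarrow> walk X x t \<omega> (Suc c) \<in> C t"
        by (simp only: pos[OF t \<open>c < d\<close>])
    qed
    fix k l assume "k \<in> {..<d}"
    then show "(exp_step ^^ k) (\<lambda>u. u ^ l) (position (\<lambda>k. x (Suc k)) (?X \<omega>) T k) =
       (exp_step ^^ k) (\<lambda>u. u ^ l) (walk X x T \<omega> (Suc k))"
      using pos[of T k \<omega>] by simp
  qed
  finally show "measure N ?E * h_fun d x = (\<integral>\<omega>. ?g \<omega> \<partial>step_law ?I)" unfolding 1 by simp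
qed

section \<open>The atom in the kernel of the largest particle\<close>

lemma sigma_finite_atomic_lborel: "sigma_finite_measure (atomic_lborel P)"
proof
  have "emeasure (atomic_lborel P) {- real k..real k} \<noteq> \<infinity>" for k
  proof -
    have "(\<Sum>a\<in>P. of_bool (Q a) :: ennreal) \<noteq> \<top>" for Q
      by (induction P rule: infinite_finite_induct) auto
    then show ?thesis by (simp add: emeasure_atomic_lborel indicator_def)
  qed
  moreover have "(\<Union>k. {- real k..real k}) = UNIV"
  proof -
    have "\<exists>k. u \<in> {- real k..real k}" for u :: real
    proof -
      obtain k where "\<bar>u\<bar> \<le> real k" using real_arch_simple by blast
      then have "u \<in> {- real k..real k}" by auto
      then show ?thesis by blast
    qed
    then show ?thesis by auto
  qed
  ultimately show "\<exists>A. countable A \<and> A \<subseteq> sets (atomic_lborel P) \<and> \<Union> A = space (atomic_lborel P) \<and>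
      (\<forall>a\<in>A. emeasure (atomic_lborel P) a \<noteq> \<infinity>)"
    by (intro exI[of _ "range (\<lambda>k. {- real k..real k})"]) auto
qed

lemma atomic_lborel_empty: "atomic_lborel {} = lborel"
  by (rule measure_eqI) (simp_all add: emeasure_atomic_lborel)

text \<open>
  The measure agrees with Lebesgue measure off the atom, and there the mass is 1.
\<close>

lemma integral_atomic_lborel:
  assumes f: "integrable lborel f"
  shows "integrable (atomic_lborel {a}) f"
    and "(\<integral>z. f z \<partial>atomic_lborel {a}) = (\<integral>z. f z \<partial>lborel) + (f a :: real)"
proof -
  let ?M = "atomic_lborel {a}"
  let ?R = "\<lambda>z. if z = a then 0 else f z"
  have fm [measurable]: "f \<in> borel_measurable borel" using borel_measurable_integrable[OF f] by simp
  have R_meas [measurable]: "?R \<in> borel_measurable borel" by measurable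
  have restrict: "restrict_space ?M (- {a}) = restrict_space lborel (- {a})"
  proof (rule measure_eqI)
    show "sets (restrict_space ?M (- {a})) = sets (restrict_space lborel (- {a}))"
      by (simp add: sets_restrict_space)
    fix B assume "B \<in> sets (restrict_space ?M (- {a}))"
    then have B: "B \<in> sets borel" "B \<subseteq> - {a}" by (auto simp: sets_restrict_space)
    then show "emeasure (restrict_space ?M (- {a})) B = emeasure (restrict_space lborel (- {a})) B"
      by (simp add: emeasure_restrict_space emeasure_atomic_lborel indicator_def)
  qed
  have RI: "?R z = indicator (- {a}) z *\<^sub>R f z" for z by (simp add: indicator_def)
  have intR: "integrable lborel ?R"
    unfolding RI by (intro integrable_mult_indicator f) auto
  have intR': "integrable ?M ?R"
  proof -
    have "integrable (restrict_space lborel (- {a})) f"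
      using intR unfolding RI by (subst integrable_restrict_space) auto
    then have "integrable (restrict_space ?M (- {a})) f" by (simp only: restrict)
    then show ?thesis unfolding RI by (subst (asm) integrable_restrict_space) auto
  qed
  have eqR: "(\<integral>z. ?R z \<partial>?M) = (\<integral>z. ?R z \<partial>lborel)"
  proof -
    have "(\<integral>z. ?R z \<partial>?M) = integral\<^sup>L (restrict_space ?M (- {a})) f"
      unfolding RI by (subst integral_restrict_space) auto
    also have "\<dots> = integral\<^sup>L (restrict_space lborel (- {a})) f" by (simp only: restrict)
    also have "\<dots> = (\<integral>z. ?R z \<partial>lborel)"
      unfolding RI by (subst integral_restrict_space) auto
    finally show ?thesis .
  qed
  have atom: "emeasure ?M {a} = 1" by (simp add: emeasure_atomic_lborel)
  have split: "f z = ?R z + f a * indicator {a} z" for z by (simp add: indicator_def)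
  have int_atom: "integrable ?M (\<lambda>z. f a * indicator {a} z)" using atom by (intro integrable_mult_right) auto
  have f_split: "f = (\<lambda>z. ?R z + f a * indicator {a} z)" by (rule ext) (rule split)
  show "integrable ?M f"
    by (subst f_split) (rule Bochner_Integration.integrable_add[OF intR' int_atom])
  have "(\<integral>z. f z \<partial>?M) = (\<integral>z. ?R z + f a * indicator {a} z \<partial>?M)"
    by (intro Bochner_Integration.integral_cong refl split)
  also have "\<dots> = (\<integral>z. ?R z \<partial>?M) + (\<integral>z. f a * indicator {a} z \<partial>?M)"
    by (rule Bochner_Integration.integral_add[OF intR' int_atom])
  also have "(\<integral>z. f a * indicator {a} z \<partial>?M) = f a"
    using atom by (simp add: measure_def)
  also have "(\<integral>z. ?R z \<partial>?M) = (\<integral>z. f z \<partial>lborel)"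
    unfolding eqR
  proof (rule integral_cong_AE)
    show "AE z in lborel. ?R z = f z" using AE_lborel_singleton[of a] by eventually_elim simp
  qed (use fm in auto)
  finally show "(\<integral>z. f z \<partial>?M) = (\<integral>z. f z \<partial>lborel) + f a" .
qed

lemma integrable_exp_right:
  assumes "0 < (\<delta> :: real)"
  shows "integrable lborel (\<lambda>z. indicator {a..} z * exp (- \<delta> * z))"
proof -
  interpret prob_space "density lborel (\<lambda>s. ennreal (erlang_density 0 \<delta> s))"
    by (rule prob_space_erlang_density[OF assms])
  have "integrable (density lborel (\<lambda>s. ennreal (erlang_density 0 \<delta> s))) (\<lambda>_. 1 :: real)" by simp
  then have "integrable lborel (\<lambda>s. erlang_density 0 \<delta> s)"
    using assms by (subst (asm) integrable_density) auto
  then have "integrable lborel (\<lambda>z. erlang_density 0 \<delta> (- a + 1 * z))"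
    by (rule lborel_integrable_real_affine) simp
  then have "integrable lborel (\<lambda>z. exp (- \<delta> * a) / \<delta> * erlang_density 0 \<delta> (- a + 1 * z))"
    by (rule integrable_mult_right)
  also have "(\<lambda>z. exp (- \<delta> * a) / \<delta> * erlang_density 0 \<delta> (- a + 1 * z)) = (\<lambda>z. indicator {a..} z * exp (- \<delta> * z))"
    using assms by (auto simp: fun_eq_iff erlang_density_def indicator_def algebra_simps simp flip: exp_add)
  finally show ?thesis .
qed

lemma integrable_exp_left:
  assumes "0 < (\<delta> :: real)"
  shows "integrable lborel (\<lambda>z. indicator {..a} z * exp (\<delta> * z))"
proof -
  have "integrable lborel (\<lambda>z. indicator {- a..} (0 + - 1 * z) * exp (- \<delta> * (0 + - 1 * z)))"
    using integrable_exp_right[OF assms, of "- a"] by (rule lborel_integrable_real_affine) simp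
  also have "(\<lambda>z. indicator {- a..} (0 + - 1 * z) * exp (- \<delta> * (0 + - 1 * z))) = (\<lambda>z. indicator {..a} z * exp (\<delta> * z))"
    by (auto simp: fun_eq_iff indicator_def)
  finally show ?thesis .
qed

text \<open>
  For $N = d - 1$ the density of the first row lives on the atom alone, whereas those of the other rows
  vanish at the atom, which is the lowest starting point.
\<close>

lemma gamma_density_integral_largest:
  assumes v: "half_exp_bounded v" and N: "d - 1 \<le> N" and r: "r < d" and x: "\<And>r. r < d \<Longrightarrow> x 1 \<le> x (Suc r)"
  shows "(\<integral>z. gamma_density (int N - int d + int (Suc r)) (z - x (Suc r)) * v z \<partial>largest_measure d x N) =
     (exp_step ^^ (N + Suc r - d)) v (x (Suc r))"
proof -
  have e: "int N - int d + int (Suc r) = int (N + Suc r - d)" using N r by simp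
  show ?thesis
  proof (cases "N = d - 1")
    case False
    then have "{l \<in> {1..d}. int N - int d + int l = 0} = {}" using N by auto
    then have M: "largest_measure d x N = lborel" unfolding largest_measure_def by (simp only: image_empty atomic_lborel_empty)
    obtain k where k: "N + Suc r - d = Suc k" using False N by (cases "N + Suc r - d") auto
    show ?thesis unfolding M e k by (rule gamma_density_integral[OF v])
  next
    case True
    then have "{l \<in> {1..d}. int N - int d + int l = 0} = {1}" using r by auto
    then have M: "largest_measure d x N = atomic_lborel {x 1}" unfolding largest_measure_def by simp
    show ?thesis
    proof (cases r)
      case 0
      let ?f = "\<lambda>z. gamma_density 0 (z - x 1) * v z"
      have f: "?f = (\<lambda>z. indicator {x 1} z * v (x 1))" by (auto simp: gamma_density_def fun_eq_iff indicator_def)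
      have "integrable lborel ?f" unfolding f by (intro integrable_mult_left) auto
      then have "(\<integral>z. ?f z \<partial>atomic_lborel {x 1}) = (\<integral>z. ?f z \<partial>lborel) + ?f (x 1)" by (rule integral_atomic_lborel(2))
      also have "(\<integral>z. ?f z \<partial>lborel) = 0" unfolding f by simp
      also have "0 + ?f (x 1) = v (x 1)" by (simp add: gamma_density_def)
      finally show ?thesis unfolding M e using 0 True r by simp
    next
      case (Suc k)
      then have k: "N + Suc r - d = Suc k" using True r by simp
      let ?f = "\<lambda>z. gamma_density (int (Suc k)) (z - x (Suc r)) * v z"
      have "(\<integral>z. ?f z \<partial>atomic_lborel {x 1}) = (\<integral>z. ?f z \<partial>lborel) + ?f (x 1)"
        by (rule integral_atomic_lborel(2)[OF gamma_density_integrable[OF v]])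
      also have "?f (x 1) = 0" using x[OF r] by (simp add: gamma_density_def)
      finally show ?thesis unfolding M e k using gamma_density_integral[OF v, of k "x (Suc r)"] by simp
    qed
  qed
qed

section \<open>Weights that dominate the kernel\<close>

text \<open>
  For the largest particle the forbidden positions are bounded below. The weights are $w_j(y) = e^{\alpha_j y}$ and
  $G_j(z) = e^{-(\alpha_j + \delta) z}$, so that $w_j G_j$ decays to the right. The exponents lie between the
  growth rate 1/2 of averaged polynomials and the rate 3/4 of \<open>gamma_density_bound\<close>. They decrease by
  $\delta$ from each label to the next, since $U$ alone has no decay along the diagonal.
\<close>

lemma weighted_inequality_right:
  fixes b0 :: real
  assumes m: "1 \<le> m" and b0: "0 \<le> b0"
  defines "\<delta> \<equiv> 1 / (4 * (real m + 2))"
  defines "\<alpha> \<equiv> \<lambda>j. 1 / 2 + \<delta> * (real (m + 1) - real j)"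
  shows "0 < \<delta>"
    and "j \<in> {1..m} \<Longrightarrow> - b0 \<le> y \<Longrightarrow> \<bar>y\<bar> / 2 \<le> 2 * b0 + \<alpha> j * y"
    and "j \<in> {1..m} \<Longrightarrow> - b0 \<le> z \<Longrightarrow> - 3 / 4 * z \<le> b0 - (\<alpha> j + \<delta>) * z"
    and "i \<in> {1..m} \<Longrightarrow> j \<in> {1..m} \<Longrightarrow> i < j \<Longrightarrow> - b0 \<le> z \<Longrightarrow> y \<le> z \<Longrightarrow>
      - 3 / 4 * (z - y) \<le> b0 + \<alpha> i * y - (\<alpha> j + \<delta>) * z"
proof -
  show \<delta>: "0 < \<delta>" by (simp add: \<delta>_def)
  have \<delta>m: "\<delta> * (real m + 1) \<le> 1 / 4" by (simp add: \<delta>_def field_simps)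
  have \<alpha>: "1 / 2 \<le> \<alpha> j" "\<alpha> j + \<delta> \<le> 3 / 4" if "j \<in> {1..m}" for j
  proof -
    have "0 \<le> \<delta> * (real (m + 1) - real j)" using that \<delta> by (intro mult_nonneg_nonneg) auto
    then show "1 / 2 \<le> \<alpha> j" by (simp add: \<alpha>_def)
    have "\<delta> * (real (m + 1) - real j) \<le> \<delta> * real m" using that \<delta> by (intro mult_left_mono) auto
    then show "\<alpha> j + \<delta> \<le> 3 / 4" using \<delta>m by (simp add: \<alpha>_def algebra_simps)
  qed
  show "\<bar>y\<bar> / 2 \<le> 2 * b0 + \<alpha> j * y" if "j \<in> {1..m}" "- b0 \<le> y"
  proof (cases "0 \<le> y")
    case True
    then have "1 / 2 * y \<le> \<alpha> j * y" using \<alpha>(1)[OF that(1)] by (intro mult_right_mono) auto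
    then show ?thesis using True b0 by simp
  next
    case False
    then have "1 * y \<le> \<alpha> j * y" using \<alpha>(2)[OF that(1)] \<delta> by (intro mult_right_mono_neg) auto
    moreover have "\<bar>y\<bar> = - y" using False by simp
    ultimately show ?thesis using that(2) b0 by linarith
  qed
  show "- 3 / 4 * z \<le> b0 - (\<alpha> j + \<delta>) * z" if "j \<in> {1..m}" "- b0 \<le> z"
  proof -
    have "(3 / 4 - (\<alpha> j + \<delta>)) * (- z) \<le> (3 / 4 - (\<alpha> j + \<delta>)) * b0"
      using \<alpha>[OF that(1)] that by (intro mult_left_mono) auto
    also have "\<dots> \<le> 1 * b0" using \<alpha>[OF that(1)] b0 \<delta> by (intro mult_right_mono) auto
    finally show ?thesis by (simp add: algebra_simps)
  qed
  show "- 3 / 4 * (z - y) \<le> b0 + \<alpha> i * y - (\<alpha> j + \<delta>) * z"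
    if "i \<in> {1..m}" "j \<in> {1..m}" "i < j" "- b0 \<le> z" "y \<le> z"
  proof -
    have "\<alpha> i * (z - y) \<le> 3 / 4 * (z - y)" using \<alpha>[OF that(1)] that \<delta> by (intro mult_right_mono) auto
    moreover have "\<delta> * 1 \<le> \<delta> * (real j - real i)" using that \<delta> by (intro mult_left_mono) auto
    then have gap: "0 \<le> \<alpha> i - \<alpha> j - \<delta>" by (simp add: \<alpha>_def algebra_simps)
    have "(\<alpha> i - \<alpha> j - \<delta>) * (- z) \<le> (\<alpha> i - \<alpha> j - \<delta>) * b0" using gap that by (intro mult_left_mono) auto
    moreover have "(\<alpha> i - \<alpha> j - \<delta>) * b0 \<le> 1 * b0"
      using \<alpha>[OF that(1)] \<alpha>[OF that(2)] \<delta> b0 by (intro mult_right_mono) auto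
    ultimately show ?thesis by (simp add: algebra_simps diff_divide_distrib)
  qed
qed

text \<open>
  For the smallest particle the forbidden positions are bounded above, and the signs of the exponents are
  reversed: $w_j G_j$ decays to the left, with $G_j(z) = e^{(\delta - \alpha_j) z}$. To the left of the lowest starting
  point $\phi$ vanishes, which replaces its decay.
\<close>

lemma weighted_inequality_left:
  fixes b0 :: real
  assumes m: "1 \<le> m" and b0: "0 \<le> b0"
  defines "\<delta> \<equiv> 1 / (4 * (real m + 2))"
  defines "\<alpha> \<equiv> \<lambda>j. - (1 / 2 + \<delta> * (real (m + 1) - real j))"
  shows "j \<in> {1..m} \<Longrightarrow> y \<le> b0 \<Longrightarrow> \<bar>y\<bar> / 2 \<le> 2 * b0 + \<alpha> j * y"
    and "j \<in> {1..m} \<Longrightarrow> a \<le> z \<Longrightarrow> - 3 / 4 * z \<le> 2 * \<bar>a\<bar> + (\<delta> - \<alpha> j) * z"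
    and "i \<in> {1..m} \<Longrightarrow> j \<in> {1..m} \<Longrightarrow> i < j \<Longrightarrow> z \<le> b0 \<Longrightarrow> y \<le> z \<Longrightarrow>
      - 3 / 4 * (z - y) \<le> b0 + \<alpha> i * y + (\<delta> - \<alpha> j) * z"
proof -
  note right = weighted_inequality_right[OF m b0, folded \<delta>_def]
  have \<delta>: "0 < \<delta>" by (simp add: \<delta>_def)
  have \<delta>m: "\<delta> * (real m + 1) \<le> 1 / 4" by (simp add: \<delta>_def field_simps)
  have \<alpha>: "\<alpha> j \<le> - 1 / 2" "- 3 / 4 \<le> \<alpha> j - \<delta>" if "j \<in> {1..m}" for j
  proof -
    have "0 \<le> \<delta> * (real (m + 1) - real j)" using that \<delta> by (intro mult_nonneg_nonneg) auto
    then show "\<alpha> j \<le> - 1 / 2" by (simp add: \<alpha>_def)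
    have "\<delta> * (real (m + 1) - real j) \<le> \<delta> * real m" using that \<delta> by (intro mult_left_mono) auto
    then show "- 3 / 4 \<le> \<alpha> j - \<delta>" using \<delta>m by (simp add: \<alpha>_def algebra_simps)
  qed
  show "\<bar>y\<bar> / 2 \<le> 2 * b0 + \<alpha> j * y" if "j \<in> {1..m}" "y \<le> b0"
    using right(2)[OF that(1), of "- y"] that(2) by (simp add: \<alpha>_def algebra_simps)
  show "- 3 / 4 * z \<le> 2 * \<bar>a\<bar> + (\<delta> - \<alpha> j) * z" if "j \<in> {1..m}" "a \<le> z"
  proof -
    have "(3 / 4 + \<delta> - \<alpha> j) * (- z) \<le> (3 / 4 + \<delta> - \<alpha> j) * \<bar>a\<bar>"
      using \<alpha>[OF that(1)] \<delta> that by (intro mult_left_mono) auto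
    also have "\<dots> \<le> 2 * \<bar>a\<bar>" using \<alpha>[OF that(1)] \<delta> by (intro mult_right_mono) auto
    finally show ?thesis by (simp add: algebra_simps)
  qed
  show "- 3 / 4 * (z - y) \<le> b0 + \<alpha> i * y + (\<delta> - \<alpha> j) * z"
    if "i \<in> {1..m}" "j \<in> {1..m}" "i < j" "z \<le> b0" "y \<le> z"
  proof -
    have "(- \<alpha> i) * y \<le> (- \<alpha> i) * z" using \<alpha>[OF that(1)] that by (intro mult_left_mono) auto
    moreover have "\<delta> * 1 \<le> \<delta> * (real j - real i)" using that \<delta> by (intro mult_left_mono) auto
    then have gap: "0 \<le> \<alpha> j - \<alpha> i - \<delta>" by (simp add: \<alpha>_def algebra_simps)
    have "(\<alpha> j - \<alpha> i - \<delta>) * z \<le> (\<alpha> j - \<alpha> i - \<delta>) * b0" using gap that by (intro mult_left_mono) auto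
    moreover have "(\<alpha> j - \<alpha> i - \<delta>) * b0 \<le> 1 * b0"
      using \<alpha>[OF that(1)] \<alpha>[OF that(2)] \<delta> b0 by (intro mult_right_mono) auto
    ultimately show ?thesis using that by (simp add: algebra_simps diff_divide_distrib)
  qed
qed

section \<open>Levels at the observation times\<close>

lemma increasing_le:
  fixes n :: "nat \<Rightarrow> nat"
  assumes "strict_mono_on {1..m} n" "i \<in> {1..m}" "j \<in> {1..m}" "i \<le> j"
  shows "n i \<le> n j"
  using strict_mono_onD[OF assms(1-3)] assms(4) by (cases "i = j") auto

text \<open>
  The levels are given at the times \<open>n j\<close> only; at all other times every position is allowed.
\<close>

definition allowed :: "nat \<Rightarrow> (nat \<Rightarrow> nat) \<Rightarrow> (nat \<Rightarrow> real set) \<Rightarrow> nat \<Rightarrow> real set" where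
  "allowed m n D t = {y. \<forall>j\<in>{1..m}. n j = t \<longrightarrow> y \<in> D j}"

text \<open>
  The functions \<open>Q\<close> of the locale \<open>walk_fredholm\<close>.
\<close>

definition stage :: "nat \<Rightarrow> (nat \<Rightarrow> nat) \<Rightarrow> (nat \<Rightarrow> real set) \<Rightarrow> nat \<Rightarrow> nat \<Rightarrow> real \<Rightarrow> real" where
  "stage m n D i l = survive (allowed m n D) (n i) (n m - n i) (\<lambda>u. u ^ l)"

lemma allowed_measurable:
  assumes "\<And>j. D j \<in> sets borel"
  shows "allowed m n D t \<in> sets borel"
proof -
  have "allowed m n D t = (\<Inter>j\<in>{j\<in>{1..m}. n j = t}. D j)" by (auto simp: allowed_def)
  moreover have "(\<Inter>j\<in>{j\<in>{1..m}. n j = t}. D j) \<in> sets borel"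
  proof (cases "{j\<in>{1..m}. n j = t} = {}")
    case True
    then show ?thesis by (simp only: INT_empty) simp
  next
    case False
    then show ?thesis using assms by (intro sets.finite_INT) auto
  qed
  ultimately show ?thesis by simp
qed

lemma allowed_at:
  fixes n :: "nat \<Rightarrow> nat"
  assumes "strict_mono_on {1..m} n" "j \<in> {1..m}"
  shows "allowed m n D (n j) = D j"
proof -
  have "n i = n j \<longleftrightarrow> i = j" if "i \<in> {1..m}" for i
    using strict_mono_on_imp_inj_on[OF assms(1)] that assms(2) by (auto dest: inj_onD)
  then show ?thesis using assms(2) by (auto simp: allowed_def)
qed

lemma allowed_free: "t \<notin> n ` {1..m} \<Longrightarrow> allowed m n D t = UNIV"
  by (auto simp: allowed_def)

lemma time_between:
  fixes n :: "nat \<Rightarrow> nat"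
  assumes n: "strict_mono_on {1..m} n" and "1 \<le> i" "i < m" "n i < t" "t < n (Suc i)"
  shows "t \<notin> n ` {1..m}"
proof
  assume "t \<in> n ` {1..m}"
  then obtain j where j: "j \<in> {1..m}" "t = n j" by blast
  have "i < j" using increasing_le[OF n, of j i] j assms by (force simp: not_le[symmetric])
  moreover have "j < Suc i" using increasing_le[OF n, of "Suc i" j] j assms by (force simp: not_le[symmetric])
  ultimately show False by simp
qed

lemma time_before_first:
  fixes n :: "nat \<Rightarrow> nat"
  assumes n: "strict_mono_on {1..m} n" and "t < n 1"
  shows "t \<notin> n ` {1..m}"
proof
  assume "t \<in> n ` {1..m}"
  then obtain j where j: "j \<in> {1..m}" "t = n j" by blast
  then have "n 1 \<le> n j" by (intro increasing_le[OF n]) auto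
  then show False using j assms by simp
qed

lemma time_after_last:
  fixes n :: "nat \<Rightarrow> nat"
  assumes n: "strict_mono_on {1..m} n" and "n m < t"
  shows "t \<notin> n ` {1..m}"
proof
  assume "t \<in> n ` {1..m}"
  then obtain j where j: "j \<in> {1..m}" "t = n j" by blast
  then have "n j \<le> n m" by (intro increasing_le[OF n]) auto
  then show False using j assms by simp
qed

lemma stage_bounded: "(\<And>j. D j \<in> sets borel) \<Longrightarrow> half_exp_bounded (stage m n D i l)"
  unfolding stage_def by (intro half_exp_bounded_survive allowed_measurable half_exp_bounded_power)

lemma stage_last: "stage m n D m l = (\<lambda>u. u ^ l)"
  by (simp add: stage_def)

lemma stage_step:
  fixes n :: "nat \<Rightarrow> nat"
  assumes n: "strict_mono_on {1..m} n" and i: "1 \<le> i" "i < m"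
  shows "stage m n D i l = (exp_step ^^ (n (Suc i) - n i)) (\<lambda>u. (1 - of_bool (u \<notin> D (Suc i))) * stage m n D (Suc i) l u)"
proof -
  have "n i < n (Suc i)" using i by (intro strict_mono_onD[OF n]) auto
  moreover have "n (Suc i) \<le> n m" using i by (intro increasing_le[OF n]) auto
  ultimately have "stage m n D i l =
     (exp_step ^^ (n (Suc i) - n i)) (\<lambda>u. indicator (allowed m n D (n (Suc i))) u * stage m n D (Suc i) l u)"
    unfolding stage_def using time_between[OF n i] allowed_free by (intro survive_next) blast+
  moreover have "indicator (allowed m n D (n (Suc i))) u = (1 - of_bool (u \<notin> D (Suc i)) :: real)" for u
    using i by (simp add: allowed_at[OF n] indicator_def)
  ultimately show ?thesis by simp
qed

lemma survive_to_first:
  fixes n :: "nat \<Rightarrow> nat"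
  assumes n: "strict_mono_on {1..m} n" and m: "1 \<le> m" and s: "s < n 1"
  shows "survive (allowed m n D) s (n m - s) (\<lambda>u. u ^ l) =
    (exp_step ^^ (n 1 - s)) (\<lambda>u. (1 - of_bool (u \<notin> D 1)) * stage m n D 1 l u)"
proof -
  have "n 1 \<le> n m" using m by (intro increasing_le[OF n]) auto
  then have "survive (allowed m n D) s (n m - s) (\<lambda>u. u ^ l) =
     (exp_step ^^ (n 1 - s)) (\<lambda>u. indicator (allowed m n D (n 1)) u * stage m n D 1 l u)"
    unfolding stage_def using s time_before_first[OF n] allowed_free by (intro survive_next) blast+
  moreover have "indicator (allowed m n D (n 1)) u = (1 - of_bool (u \<notin> D 1) :: real)" for u
    using m by (simp add: allowed_at[OF n] indicator_def)
  ultimately show ?thesis by simp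
qed

lemma confined_probability:
  assumes iid: "iid_exponential M d X" and Z: "ordered_exponential_walk M X d x N Z"
    and "1 \<le> d" and m: "1 \<le> m" and n1: "1 \<le> n 1" and n: "strict_mono_on {1..m} n"
    and "c < d" and D: "\<And>j. D j \<in> sets borel"
  shows "h_fun d x \<noteq> 0"
    and "measure N {\<omega>\<in>space N. \<forall>j\<in>{1..m}. Z (n j) \<omega> (Suc c) \<in> D j} * h_fun d x =
      (\<integral>\<omega>. of_bool (confined d c (allowed m n D) (n m) (position (\<lambda>k. x (Suc k)) \<omega>)) *
         pdet {..<d} (\<lambda>k l. (exp_step ^^ k) (\<lambda>u. u ^ l) (position (\<lambda>k. x (Suc k)) \<omega> (n m) k))
         \<partial>step_law ({1..n m} \<times> {..<d}))"
proof -
  have nj: "1 \<le> n j" "n j \<le> n m" if "j \<in> {1..m}" for j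
  proof -
    have "n 1 \<le> n j" using that by (intro increasing_le[OF n]) auto
    then show "1 \<le> n j" using n1 by simp
    show "n j \<le> n m" using that by (intro increasing_le[OF n]) auto
  qed
  have "1 \<le> n m" using nj(1)[of m] m by simp
  note doob = doob_transform_probability[OF iid Z \<open>1 \<le> d\<close> this \<open>c < d\<close>, of "allowed m n D", OF allowed_measurable[OF D]]
  show "h_fun d x \<noteq> 0" by (rule doob(1))
  have "(\<forall>t\<in>{1..n m}. Z t \<omega> (Suc c) \<in> allowed m n D t) \<longleftrightarrow> (\<forall>j\<in>{1..m}. Z (n j) \<omega> (Suc c) \<in> D j)" for \<omega>
    using nj unfolding allowed_def by auto
  then show "measure N {\<omega>\<in>space N. \<forall>j\<in>{1..m}. Z (n j) \<omega> (Suc c) \<in> D j} * h_fun d x =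
      (\<integral>\<omega>. of_bool (confined d c (allowed m n D) (n m) (position (\<lambda>k. x (Suc k)) \<omega>)) *
         pdet {..<d} (\<lambda>k l. (exp_step ^^ k) (\<lambda>u. u ^ l) (position (\<lambda>k. x (Suc k)) \<omega> (n m) k))
         \<partial>step_law ({1..n m} \<times> {..<d}))"
    using doob(2) by simp
qed

lemma moment_mat_facts:
  assumes c: "c \<le> N + 1" and h: "h_fun d x \<noteq> 0"
  shows "invertible_mat (moment_mat c d N x)"
    and "\<forall>k\<in>{1..d}. \<forall>l\<in>{1..d}. moment_mat c d N x $$ (k - 1, l - 1) =
          (\<integral>\<zeta>. (x k + \<zeta>) ^ (l - 1) \<partial>gamma_measure (int N - int c + int k) 0)"
proof -
  have "moment_mat c d N x \<in> carrier_mat d d" by (simp add: moment_mat_def)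
  then show "invertible_mat (moment_mat c d N x)"
    by (rule invertible_mat_det) (simp add: det_moment_mat[OF c] h)
  show "\<forall>k\<in>{1..d}. \<forall>l\<in>{1..d}. moment_mat c d N x $$ (k - 1, l - 1) =
          (\<integral>\<zeta>. (x k + \<zeta>) ^ (l - 1) \<partial>gamma_measure (int N - int c + int k) 0)"
  proof (intro ballI)
    fix k l assume kl: "k \<in> {1..d}" "l \<in> {1..d}"
    then have "int N - int c + int k = int (N + k - c)" using c by simp
    then have "gamma_moment (int N - int c + int k) (x k) (l - 1) =
        (\<integral>\<zeta>. (x k + \<zeta>) ^ (l - 1) \<partial>gamma_measure (int N - int c + int k) 0)"
      by (simp only: gamma_moment_centred)
    moreover have "k - 1 < d" "l - 1 < d" "Suc (k - 1) = k" using kl by auto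
    ultimately show "moment_mat c d N x $$ (k - 1, l - 1) =
          (\<integral>\<zeta>. (x k + \<zeta>) ^ (l - 1) \<partial>gamma_measure (int N - int c + int k) 0)"
      unfolding moment_mat_def by simp
  qed
qed

section \<open>The two distribution functions\<close>

lemma weyl_chamber_first:
  assumes "x \<in> weyl_chamber d" "r < d"
  shows "x 1 \<le> x (Suc r)"
  using ordered_mono[of d "\<lambda>k. x (Suc k)" 0 r] assms by (simp add: weyl_chamber_iff_ordered)

lemma abs_level_le:
  fixes \<xi> :: "nat \<Rightarrow> real"
  assumes "j \<in> {1..m}"
  shows "\<bar>\<xi> j\<bar> \<le> (\<Sum>j=1..m. \<bar>\<xi> j\<bar>)"
  using assms by (intro member_le_sum) auto

text \<open>
  The rows of \<open>largest_walk_determinant\<close> and of \<open>fredholm_det_walk_kernel\<close> differ at most in the first row, if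
  $n_1 = d - 1$ and $x_1$ lies above the first level. Then $x_d$ does so too, and both determinants have a zero
  row.
\<close>

lemma largest_particle:
  assumes d: "1 \<le> d" and m: "1 \<le> m" and iid: "iid_exponential M d X"
    and weyl: "x \<in> weyl_chamber d" and Z: "ordered_exponential_walk M X d x N Z"
    and n1: "1 \<le> n 1" and n: "strict_mono_on {1..m} n" and dn: "d - 1 \<le> n 1"
  shows "fredholm_convergent m (\<lambda>j. largest_measure d x (n j)) (\<lambda>j y. of_bool (y > \<xi> j)) (walk_kernel d d m n x)"
    and "measure N {\<omega>\<in>space N. \<forall>j\<in>{1..m}. Z (n j) \<omega> d \<le> \<xi> j} =
         fredholm_det m (\<lambda>j. largest_measure d x (n j)) (\<lambda>j y. of_bool (y > \<xi> j)) (walk_kernel d d m n x)"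
proof -
  define D where "D j = {..\<xi> j}" for j
  have Dm: "D j \<in> sets borel" for j by (simp add: D_def)
  let ?C = "allowed m n D"
  define b0 where "b0 = (\<Sum>j=1..m. \<bar>\<xi> j\<bar>)"
  have b0: "0 \<le> b0" unfolding b0_def by (rule sum_nonneg) simp
  define \<delta> where "\<delta> = 1 / (4 * (real m + 2))"
  define \<alpha> where "\<alpha> j = 1 / 2 + \<delta> * (real (m + 1) - real j)" for j
  note ineq = weighted_inequality_right[OF m b0, folded \<delta>_def, folded \<alpha>_def]
  define w where "w j y = exp (\<alpha> j * y)" for j y
  define G where "G j z = indicator {- b0..} z * exp (- (\<alpha> j + \<delta>) * z)" for j z
  have region: "- b0 \<le> y" if "j \<in> {1..m}" "of_bool (\<not> y \<le> \<xi> j) = (1 :: real)" for j y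
  proof -
    have "\<xi> j < y" using that(2) by (cases "y \<le> \<xi> j") auto
    then show ?thesis using abs_level_le[OF that(1), of \<xi>] unfolding b0_def by linarith
  qed
  have later: "d \<le> n j" if "i \<in> {1..m}" "j \<in> {1..m}" "i < j" for i j
  proof -
    have "n i < n j" using that by (intro strict_mono_onD[OF n]) auto
    moreover have "n 1 \<le> n i" using that by (intro increasing_le[OF n]) auto
    ultimately show ?thesis using dn by simp
  qed
  have n_first: "n 1 \<le> n j" if "j \<in> {1..m}" for j using that by (intro increasing_le[OF n]) auto
  have measure_late: "largest_measure d x k = lborel" if "d \<le> k" for k
  proof -
    have "{l \<in> {1..d}. int k - int d + int l = 0} = {}" using that by auto
    then show ?thesis unfolding largest_measure_def by (simp only: image_empty atomic_lborel_empty)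
  qed
  interpret walk_fredholm d m d n x "\<lambda>j. largest_measure d x (n j)" "\<lambda>j y. of_bool (\<not> y \<le> \<xi> j)"
    w G "exp (2 * b0)" "exp b0" "exp b0" "stage m n D"
  proof (rule walk_fredholm.intro)
    show "d \<le> n 1 + 1" using dn by simp
    show "x 1 \<le> x (Suc r)" if "r < d" for r by (rule weyl_chamber_first[OF weyl that])
    show "(\<lambda>y. of_bool (\<not> y \<le> \<xi> j)) \<in> borel_measurable borel" for j by measurable
    show "of_bool (\<not> y \<le> \<xi> j) = (0 :: real) \<or> of_bool (\<not> y \<le> \<xi> j) = (1 :: real)" for j y by simp
    show "sigma_finite_measure (largest_measure d x (n j))" for j
      unfolding largest_measure_def by (rule sigma_finite_atomic_lborel)
    show "sets (largest_measure d x (n j)) = sets borel" for j by (simp add: largest_measure_def)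
    show "(\<integral>z. gamma_density (int (n j) - int d + int (Suc r)) (z - x (Suc r)) * g z \<partial>largest_measure d x (n j)) =
       (exp_step ^^ (n j + Suc r - d)) g (x (Suc r))" if "j \<in> {1..m}" "r < d" "half_exp_bounded g" for j r g
      using that dn n_first[of j] weyl_chamber_first[OF weyl] by (intro gamma_density_integral_largest) auto
    show "(\<integral>z. gamma_density (int (n j) - int (n i)) (z - y) * g z \<partial>largest_measure d x (n j)) = (exp_step ^^ (n j - n i)) g y"
      if ij: "i \<in> {1..m}" "j \<in> {1..m}" "i < j" and g: "half_exp_bounded g" for i j y g
    proof -
      have "n i < n j" using ij by (intro strict_mono_onD[OF n]) auto
      then obtain k where k: "n j - n i = Suc k" "int (n j) - int (n i) = int (Suc k)"
        by (metis Suc_diff_Suc of_nat_diff less_imp_le)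
      show ?thesis unfolding measure_late[OF later[OF ij]] k by (rule gamma_density_integral[OF g])
    qed
    show "exp (\<bar>y\<bar> / 2) \<le> exp (2 * b0) * w j y" if "j \<in> {1..m}" "of_bool (\<not> y \<le> \<xi> j) = (1 :: real)" for j y
      using ineq(2)[OF that(1) region[OF that]] by (simp add: w_def flip: exp_add)
    show "exp (- 3 / 4 * z) \<le> exp b0 * G j z" if "j \<in> {1..m}" "of_bool (\<not> z \<le> \<xi> j) = (1 :: real)" "x 1 \<le> z" for j z
      using ineq(3)[OF that(1) region[OF that(1,2)]] region[OF that(1,2)] by (simp add: G_def algebra_simps flip: exp_add)
    show "exp (- 3 / 4 * (z - y)) \<le> exp b0 * w i y * G j z"
      if "i \<in> {1..m}" "j \<in> {1..m}" "i < j" "of_bool (\<not> y \<le> \<xi> i) = (1 :: real)"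
        "of_bool (\<not> z \<le> \<xi> j) = (1 :: real)" "y \<le> z" for i j y z
      using ineq(4)[OF that(1-3) region[OF that(2,5)] that(6)] region[OF that(2,5)]
      by (simp add: w_def G_def algebra_simps flip: exp_add)
    show "integrable (largest_measure d x (n j)) (\<lambda>y. w j y * G j y)" if "j \<in> {1..m}" for j
    proof -
      have wG: "(\<lambda>y. w j y * G j y) = (\<lambda>y. indicator {- b0..} y * exp (- \<delta> * y))"
        by (auto simp: w_def G_def fun_eq_iff algebra_simps indicator_def simp flip: exp_add)
      have int: "integrable lborel (\<lambda>y. w j y * G j y)"
        unfolding wG by (rule integrable_exp_right[OF ineq(1)])
      show ?thesis
      proof (cases "d \<le> n j")
        case True
        then show ?thesis using int measure_late by simp
      next
        case False
        then have "n j = d - 1" using n_first[OF that] dn by simp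
        then have "{l \<in> {1..d}. int (n j) - int d + int l = 0} = {1}" using d by auto
        then show ?thesis using integral_atomic_lborel(1)[OF int] by (simp add: largest_measure_def)
      qed
    qed
    show "half_exp_bounded (stage m n D i l)" for i l by (rule stage_bounded[OF Dm])
    show "stage m n D m l = (\<lambda>u. u ^ l)" for l by (rule stage_last)
    show "stage m n D i l = (exp_step ^^ (n (Suc i) - n i)) (\<lambda>u. (1 - of_bool (\<not> u \<le> \<xi> (Suc i))) * stage m n D (Suc i) l u)"
      if "1 \<le> i" "i < m" for i l
      using stage_step[OF n that, of D l] by (simp add: D_def)
  qed (use d m n in \<open>simp_all add: w_def G_def\<close>)
  note prob = confined_probability[OF iid Z d m n1 n, where c="d - 1" and D=D]
  have h: "h_fun d x \<noteq> 0" by (rule prob(1)) (use d Dm in auto)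
  have c: "d \<le> n m + 1" using dn n_first[of m] m by simp
  have det: "Determinant.det (moment_mat d d (n m) x) \<noteq> 0" using h by (simp add: det_moment_mat[OF c])
  have \<theta>_eq: "(\<lambda>j y. of_bool (y > \<xi> j) :: real) = (\<lambda>j y. of_bool (\<not> y \<le> \<xi> j))" by (simp add: not_le)
  show "fredholm_convergent m (\<lambda>j. largest_measure d x (n j)) (\<lambda>j y. of_bool (y > \<xi> j)) (walk_kernel d d m n x)"
    unfolding \<theta>_eq by (rule fredholm_det_walk_kernel(1)[OF det])
  let ?T = "\<lambda>k l. survive ?C (d - 1 - k) (n m - (d - 1 - k)) (\<lambda>u. u ^ l) (x (Suc k))"
  let ?R = "\<lambda>r l. (exp_step ^^ (n 1 + Suc r - d)) (\<lambda>u. (1 - of_bool (\<not> u \<le> \<xi> 1)) * stage m n D 1 l u) (x (Suc r))"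
  have down: "u \<in> ?C t" if "v \<in> ?C t" "u \<le> v" for t u v
    using that by (auto simp: allowed_def D_def intro: order_trans)
  have prob_T: "measure N {\<omega>\<in>space N. \<forall>j\<in>{1..m}. Z (n j) \<omega> (Suc (d - 1)) \<in> D j} * h_fun d x = pdet {..<d} ?T"
  proof -
    have "measure N {\<omega>\<in>space N. \<forall>j\<in>{1..m}. Z (n j) \<omega> (Suc (d - 1)) \<in> D j} * h_fun d x =
      (\<integral>\<omega>. of_bool (confined d (d - 1) ?C (n m) (position (\<lambda>k. x (Suc k)) \<omega>)) *
         pdet {..<d} (\<lambda>k l. (exp_step ^^ k) (\<lambda>u. u ^ l) (position (\<lambda>k. x (Suc k)) \<omega> (n m) k))
         \<partial>step_law ({1..n m} \<times> {..<d}))"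
      by (rule prob(2)) (use d Dm in auto)
    also have "\<dots> = pdet {..<d} ?T"
    proof (rule largest_walk_determinant[OF d])
      show "d - 1 \<le> n m" using c by simp
      show "ordered d (\<lambda>k. x (Suc k))" using weyl by (simp add: weyl_chamber_iff_ordered)
      show "?C t \<in> sets borel" for t by (rule allowed_measurable[OF Dm])
      show "?C t = UNIV" if "n m < t" for t by (rule allowed_free[OF time_after_last[OF n that]])
    qed (rule down)
    finally show ?thesis .
  qed
  have T_R: "pdet {..<d} ?T = pdet {..<d} ?R"
  proof -
    have entry: "?T k l = ?R k l" if "k < d" "d - 1 - k < n 1" for k l
    proof -
      have "n 1 + Suc k - d = n 1 - (d - 1 - k)" using that by simp
      then show ?thesis by (simp only: survive_to_first[OF n m that(2)] D_def atMost_iff)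
    qed
    show ?thesis
    proof (cases "x 1 \<le> \<xi> 1")
      case True
      have "?T k l = ?R k l" if "k < d" for k l
      proof (cases "d - 1 - k < n 1")
        case False
        then have "k = 0" "d - 1 = n 1" using that dn n1 by auto
        then have "n 1 + Suc k - d = 0" using d by simp
        moreover have "survive ?C (d - 1 - k) (n m - (d - 1 - k)) (\<lambda>u. u ^ l) = stage m n D 1 l" for l
          using \<open>k = 0\<close> \<open>d - 1 = n 1\<close> by (simp only: stage_def diff_zero)
        ultimately show ?thesis using True \<open>k = 0\<close> by simp
      qed (rule entry[OF that])
      then show ?thesis by (intro pdet_cong) (simp only: lessThan_iff)
    next
      case False
      have last: "?T (d - 1) l = 0" for l
      proof -
        have "x (Suc (d - 1)) \<notin> D 1"
          using False weyl_chamber_first[OF weyl, of "d - 1"] d by (simp add: D_def)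
        then have "x (Suc (d - 1)) \<notin> ?C (n 1)" using m by (simp add: allowed_at[OF n])
        moreover have "n 1 \<le> n m" using n_first[of m] m by simp
        ultimately have "survive ?C 0 (n m) (\<lambda>u. u ^ l) (x (Suc (d - 1))) = 0"
          using n1 by (intro survive_vanish[where C="?C" and j="n 1", OF allowed_measurable[OF Dm] half_exp_bounded_power down])
            simp_all
        then show ?thesis by (simp only: diff_self_eq_0 diff_zero)
      qed
      have dd: "d - 1 < d" using d by simp
      then have "d - 1 - (d - 1) < n 1" using n1 by simp
      then have "?R (d - 1) l = 0" for l using entry[OF dd, of l] last[of l] by (simp only:)
      then have "pdet {..<d} ?R = 0" using dd by (intro pdet_row_zero[of _ "d - 1"]) simp_all
      moreover have "pdet {..<d} ?T = 0"
      proof (rule pdet_row_zero)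
        show "finite {..<d}" "d - 1 \<in> {..<d}" using dd by simp_all
      qed (rule last)
      ultimately show ?thesis by (simp only:)
    qed
  qed
  have fredholm_R: "fredholm_det m (\<lambda>j. largest_measure d x (n j)) (\<lambda>j y. of_bool (y > \<xi> j)) (walk_kernel d d m n x) =
      pdet {..<d} ?R / h_fun d x"
    unfolding \<theta>_eq fredholm_det_walk_kernel(2)[OF det] det_moment_mat[OF c] by (rule refl)
  have "measure N {\<omega>\<in>space N. \<forall>j\<in>{1..m}. Z (n j) \<omega> (Suc (d - 1)) \<in> D j} =
     fredholm_det m (\<lambda>j. largest_measure d x (n j)) (\<lambda>j y. of_bool (y > \<xi> j)) (walk_kernel d d m n x)"
    by (rule trans[OF eq_divide_imp[OF h trans[OF prob_T T_R]] fredholm_R[symmetric]])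
  moreover have "Suc (d - 1) = d" using d by simp
  ultimately show "measure N {\<omega>\<in>space N. \<forall>j\<in>{1..m}. Z (n j) \<omega> d \<le> \<xi> j} =
         fredholm_det m (\<lambda>j. largest_measure d x (n j)) (\<lambda>j y. of_bool (y > \<xi> j)) (walk_kernel d d m n x)"
    by (simp only: D_def atMost_iff)
qed

text \<open>
  As each row carries at least one averaging step before the first time, no atom occurs, and the rows of
  \<open>smallest_walk_determinant\<close> are those of \<open>fredholm_det_walk_kernel\<close>.
\<close>

lemma smallest_particle:
  assumes d: "1 \<le> d" and m: "1 \<le> m" and iid: "iid_exponential M d X"
    and weyl: "x \<in> weyl_chamber d" and Z: "ordered_exponential_walk M X d x N Z"
    and n1: "1 \<le> n 1" and n: "strict_mono_on {1..m} n"
  shows "fredholm_convergent m (\<lambda>_. lborel) (\<lambda>j y. of_bool (y < \<xi> j)) (walk_kernel 1 d m n x)"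
    and "measure N {\<omega>\<in>space N. \<forall>j\<in>{1..m}. Z (n j) \<omega> 1 \<ge> \<xi> j} =
         fredholm_det m (\<lambda>_. lborel) (\<lambda>j y. of_bool (y < \<xi> j)) (walk_kernel 1 d m n x)"
proof -
  define D where "D j = {\<xi> j..}" for j
  have Dm: "D j \<in> sets borel" for j by (simp add: D_def)
  let ?C = "allowed m n D"
  define b0 where "b0 = (\<Sum>j=1..m. \<bar>\<xi> j\<bar>)"
  have b0: "0 \<le> b0" unfolding b0_def by (rule sum_nonneg) simp
  define \<delta> where "\<delta> = 1 / (4 * (real m + 2))"
  have \<delta>: "0 < \<delta>" by (simp add: \<delta>_def)
  define \<alpha> where "\<alpha> j = - (1 / 2 + \<delta> * (real (m + 1) - real j))" for j
  note ineq = weighted_inequality_left[OF m b0, folded \<delta>_def, folded \<alpha>_def]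
  define w where "w j y = exp (\<alpha> j * y)" for j y
  define G where "G j z = indicator {..b0} z * exp ((\<delta> - \<alpha> j) * z)" for j z
  have region: "y \<le> b0" if "j \<in> {1..m}" "of_bool (\<not> \<xi> j \<le> y) = (1 :: real)" for j y
  proof -
    have "y < \<xi> j" using that(2) by (cases "\<xi> j \<le> y") auto
    then show ?thesis using abs_level_le[OF that(1), of \<xi>] unfolding b0_def by linarith
  qed
  have n_first: "n 1 \<le> n j" if "j \<in> {1..m}" for j using that by (intro increasing_le[OF n]) auto
  interpret walk_fredholm d m 1 n x "\<lambda>_. lborel" "\<lambda>j y. of_bool (\<not> \<xi> j \<le> y)"
    w G "exp (2 * b0)" "exp (2 * \<bar>x 1\<bar>)" "exp b0" "stage m n D"
  proof (rule walk_fredholm.intro)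
    show "x 1 \<le> x (Suc r)" if "r < d" for r by (rule weyl_chamber_first[OF weyl that])
    show "(\<lambda>y. of_bool (\<not> \<xi> j \<le> y)) \<in> borel_measurable borel" for j by measurable
    show "of_bool (\<not> \<xi> j \<le> y) = (0 :: real) \<or> of_bool (\<not> \<xi> j \<le> y) = (1 :: real)" for j y by simp
    show "sigma_finite_measure (lborel :: real measure)" by (rule sigma_finite_lborel)
    show "(\<integral>z. gamma_density (int (n j) - int 1 + int (Suc r)) (z - x (Suc r)) * g z \<partial>lborel) =
       (exp_step ^^ (n j + Suc r - 1)) g (x (Suc r))" if "j \<in> {1..m}" "half_exp_bounded g" for j r g
    proof -
      have "1 \<le> n j" using n_first[OF that(1)] n1 by simp
      then have k: "n j + Suc r - 1 = Suc (n j - 1 + r)" "int (n j) - int 1 + int (Suc r) = int (Suc (n j - 1 + r))"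
        by simp_all
      show ?thesis unfolding k by (rule gamma_density_integral[OF that(2)])
    qed
    show "(\<integral>z. gamma_density (int (n j) - int (n i)) (z - y) * g z \<partial>lborel) = (exp_step ^^ (n j - n i)) g y"
      if ij: "i \<in> {1..m}" "j \<in> {1..m}" "i < j" and g: "half_exp_bounded g" for i j y g
    proof -
      have "n i < n j" using ij by (intro strict_mono_onD[OF n]) auto
      then obtain k where k: "n j - n i = Suc k" "int (n j) - int (n i) = int (Suc k)"
        by (metis Suc_diff_Suc of_nat_diff less_imp_le)
      show ?thesis unfolding k by (rule gamma_density_integral[OF g])
    qed
    show "exp (\<bar>y\<bar> / 2) \<le> exp (2 * b0) * w j y" if "j \<in> {1..m}" "of_bool (\<not> \<xi> j \<le> y) = (1 :: real)" for j y
      using ineq(1)[OF that(1) region[OF that]] by (simp add: w_def flip: exp_add)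
    show "exp (- 3 / 4 * z) \<le> exp (2 * \<bar>x 1\<bar>) * G j z" if "j \<in> {1..m}" "of_bool (\<not> \<xi> j \<le> z) = (1 :: real)" "x 1 \<le> z" for j z
      using ineq(2)[OF that(1,3)] region[OF that(1,2)] by (simp add: G_def algebra_simps flip: exp_add)
    show "exp (- 3 / 4 * (z - y)) \<le> exp b0 * w i y * G j z"
      if "i \<in> {1..m}" "j \<in> {1..m}" "i < j" "of_bool (\<not> \<xi> i \<le> y) = (1 :: real)"
        "of_bool (\<not> \<xi> j \<le> z) = (1 :: real)" "y \<le> z" for i j y z
      using ineq(3)[OF that(1-3) region[OF that(2,5)] that(6)] region[OF that(2,5)]
      by (simp add: w_def G_def algebra_simps flip: exp_add)
    show "integrable lborel (\<lambda>y. w j y * G j y)" for j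
    proof -
      have "(\<lambda>y. w j y * G j y) = (\<lambda>y. indicator {..b0} y * exp (\<delta> * y))"
        by (auto simp: w_def G_def fun_eq_iff algebra_simps indicator_def simp flip: exp_add)
      then show ?thesis by (simp add: integrable_exp_left[OF \<delta>])
    qed
    show "half_exp_bounded (stage m n D i l)" for i l by (rule stage_bounded[OF Dm])
    show "stage m n D m l = (\<lambda>u. u ^ l)" for l by (rule stage_last)
    show "stage m n D i l = (exp_step ^^ (n (Suc i) - n i)) (\<lambda>u. (1 - of_bool (\<not> \<xi> (Suc i) \<le> u)) * stage m n D (Suc i) l u)"
      if "1 \<le> i" "i < m" for i l
      using stage_step[OF n that, of D l] by (simp add: D_def)
  qed (use d m n in \<open>simp_all add: w_def G_def\<close>)
  note prob = confined_probability[OF iid Z d m n1 n, where c=0 and D=D]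
  have h: "h_fun d x \<noteq> 0" by (rule prob(1)) (use d Dm in auto)
  have c: "1 \<le> n m + 1" by simp
  have det: "Determinant.det (moment_mat 1 d (n m) x) \<noteq> 0" using h by (simp only: det_moment_mat[OF c] not_False_eq_True)
  have \<theta>_eq: "(\<lambda>j y. of_bool (y < \<xi> j) :: real) = (\<lambda>j y. of_bool (\<not> \<xi> j \<le> y))" by (simp add: not_le)
  show "fredholm_convergent m (\<lambda>_. lborel) (\<lambda>j y. of_bool (y < \<xi> j)) (walk_kernel 1 d m n x)"
    unfolding \<theta>_eq by (rule fredholm_det_walk_kernel(1)[OF det])
  let ?R = "\<lambda>r l. (exp_step ^^ (n 1 + Suc r - 1)) (\<lambda>u. (1 - of_bool (\<not> \<xi> 1 \<le> u)) * stage m n D 1 l u) (x (Suc r))"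
  have half_line: "?C t = UNIV \<or> (\<exists>a. ?C t = {a..})" for t
  proof (cases "t \<in> n ` {1..m}")
    case True
    then obtain j where "j \<in> {1..m}" "t = n j" by blast
    then have "?C t = {\<xi> j..}" by (simp only: allowed_at[OF n] D_def)
    then show ?thesis by blast
  qed (simp add: allowed_free)
  have "measure N {\<omega>\<in>space N. \<forall>j\<in>{1..m}. Z (n j) \<omega> (Suc 0) \<in> D j} * h_fun d x =
      (\<integral>\<omega>. of_bool (confined d 0 ?C (n m) (position (\<lambda>k. x (Suc k)) \<omega>)) *
         pdet {..<d} (\<lambda>k l. (exp_step ^^ k) (\<lambda>u. u ^ l) (position (\<lambda>k. x (Suc k)) \<omega> (n m) k))
         \<partial>step_law ({1..n m} \<times> {..<d}))"
    by (rule prob(2)) (use d Dm in auto)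
  also have "\<dots> = pdet {..<d} (\<lambda>k l. (exp_step ^^ k) (survive ?C 0 (n m) (\<lambda>u. u ^ l)) (x (Suc k)))"
    using weyl by (intro smallest_walk_determinant d half_line) (simp add: weyl_chamber_iff_ordered)
  also have "\<dots> = pdet {..<d} ?R"
  proof (rule pdet_cong)
    fix r l
    have "n 1 + Suc r - 1 = r + n 1" by simp
    moreover have "survive ?C 0 (n m) (\<lambda>u. u ^ l) = (exp_step ^^ n 1) (\<lambda>u. (1 - of_bool (\<not> \<xi> 1 \<le> u)) * stage m n D 1 l u)"
      using survive_to_first[OF n m, of 0 D l] n1 by (simp add: D_def)
    ultimately show "(exp_step ^^ r) (survive ?C 0 (n m) (\<lambda>u. u ^ l)) (x (Suc r)) = ?R r l"
      by (simp only: funpow_add o_apply)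
  qed
  finally have prob_R: "measure N {\<omega>\<in>space N. \<forall>j\<in>{1..m}. Z (n j) \<omega> (Suc 0) \<in> D j} * h_fun d x = pdet {..<d} ?R" .
  have fredholm_R: "fredholm_det m (\<lambda>_. lborel) (\<lambda>j y. of_bool (y < \<xi> j)) (walk_kernel 1 d m n x) =
      pdet {..<d} ?R / h_fun d x"
    unfolding \<theta>_eq fredholm_det_walk_kernel(2)[OF det] det_moment_mat[OF c] by (rule refl)
  have "measure N {\<omega>\<in>space N. \<forall>j\<in>{1..m}. Z (n j) \<omega> (Suc 0) \<in> D j} =
     fredholm_det m (\<lambda>_. lborel) (\<lambda>j y. of_bool (y < \<xi> j)) (walk_kernel 1 d m n x)"
    by (rule trans[OF eq_divide_imp[OF h prob_R] fredholm_R[symmetric]])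
  then show "measure N {\<omega>\<in>space N. \<forall>j\<in>{1..m}. Z (n j) \<omega> 1 \<ge> \<xi> j} =
         fredholm_det m (\<lambda>_. lborel) (\<lambda>j y. of_bool (y < \<xi> j)) (walk_kernel 1 d m n x)"
    by (simp only: D_def atLeast_iff One_nat_def)
qed

theorem theorem4:
  fixes M :: "'a measure" and X :: "nat \<Rightarrow> nat \<Rightarrow> 'a \<Rightarrow> real"
    and N :: "'b measure" and Z :: "nat \<Rightarrow> 'b \<Rightarrow> nat \<Rightarrow> real"
    and d m :: nat and x \<xi> :: "nat \<Rightarrow> real" and n :: "nat \<Rightarrow> nat"
  assumes "1 \<le> d" and "1 \<le> m"
    and "iid_exponential M d X"
    and "x \<in> weyl_chamber d"
    and "ordered_exponential_walk M X d x N Z"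
    and "n 0 = 0" and "1 \<le> n 1" and "strict_mono_on {1..m} n"
  shows
    "(d - 1 \<le> n 1 \<longrightarrow>
       (\<forall>k\<in>{1..d}. \<forall>l\<in>{1..d}. moment_mat d d (n m) x $$ (k - 1, l - 1) =
          (\<integral>\<zeta>. (x k + \<zeta>) ^ (l - 1) \<partial>gamma_measure (int (n m) - int d + int k) 0)) \<and>
       invertible_mat (moment_mat d d (n m) x) \<and>
       fredholm_convergent m (\<lambda>j. largest_measure d x (n j))
         (\<lambda>j y. of_bool (y > \<xi> j)) (walk_kernel d d m n x) \<and>
       measure N {\<omega>\<in>space N. \<forall>j\<in>{1..m}. Z (n j) \<omega> d \<le> \<xi> j} =
         fredholm_det m (\<lambda>j. largest_measure d x (n j))
           (\<lambda>j y. of_bool (y > \<xi> j)) (walk_kernel d d m n x)) \<and>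
     (d - 1 \<le> n m - n (m - 1) \<longrightarrow>
       (\<forall>k\<in>{1..d}. \<forall>l\<in>{1..d}. moment_mat 1 d (n m) x $$ (k - 1, l - 1) =
          (\<integral>\<zeta>. (x k + \<zeta>) ^ (l - 1) \<partial>gamma_measure (int (n m) - 1 + int k) 0)) \<and>
       invertible_mat (moment_mat 1 d (n m) x) \<and>
       fredholm_convergent m (\<lambda>_. lborel)
         (\<lambda>j y. of_bool (y < \<xi> j)) (walk_kernel 1 d m n x) \<and>
       measure N {\<omega>\<in>space N. \<forall>j\<in>{1..m}. Z (n j) \<omega> 1 \<ge> \<xi> j} =
         fredholm_det m (\<lambda>_. lborel)
           (\<lambda>j y. of_bool (y < \<xi> j)) (walk_kernel 1 d m n x))"
proof -
  have h: "h_fun d x \<noteq> 0"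
    using assms by (intro confined_probability(1)[where c=0 and D="\<lambda>_. UNIV"]) auto
  have "n 1 \<le> n m" using assms(2) by (intro increasing_le[OF assms(8)]) auto
  then have c: "d \<le> n m + 1" if "d - 1 \<le> n 1" using that by simp
  have small: "int (n m) - 1 = int (n m) - int 1" by simp
  show ?thesis
  proof (intro conjI impI)
    assume dn: "d - 1 \<le> n 1"
    show "\<forall>k\<in>{1..d}. \<forall>l\<in>{1..d}. moment_mat d d (n m) x $$ (k - 1, l - 1) =
          (\<integral>\<zeta>. (x k + \<zeta>) ^ (l - 1) \<partial>gamma_measure (int (n m) - int d + int k) 0)"
      by (rule moment_mat_facts(2)[OF c[OF dn] h])
    show "invertible_mat (moment_mat d d (n m) x)"
      by (rule moment_mat_facts(1)[OF c[OF dn] h])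
    show "fredholm_convergent m (\<lambda>j. largest_measure d x (n j))
         (\<lambda>j y. of_bool (y > \<xi> j)) (walk_kernel d d m n x)"
      by (rule largest_particle(1)[OF assms(1-5,7,8) dn])
    show "measure N {\<omega>\<in>space N. \<forall>j\<in>{1..m}. Z (n j) \<omega> d \<le> \<xi> j} =
         fredholm_det m (\<lambda>j. largest_measure d x (n j))
           (\<lambda>j y. of_bool (y > \<xi> j)) (walk_kernel d d m n x)"
      by (rule largest_particle(2)[OF assms(1-5,7,8) dn])
  next
    show "\<forall>k\<in>{1..d}. \<forall>l\<in>{1..d}. moment_mat 1 d (n m) x $$ (k - 1, l - 1) =
          (\<integral>\<zeta>. (x k + \<zeta>) ^ (l - 1) \<partial>gamma_measure (int (n m) - 1 + int k) 0)"
      unfolding small by (rule moment_mat_facts(2)[OF le_add2 h])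
    show "invertible_mat (moment_mat 1 d (n m) x)"
      by (rule moment_mat_facts(1)[OF le_add2 h])
    show "fredholm_convergent m (\<lambda>_. lborel) (\<lambda>j y. of_bool (y < \<xi> j)) (walk_kernel 1 d m n x)"
      by (rule smallest_particle(1)[OF assms(1-5,7,8)])
    show "measure N {\<omega>\<in>space N. \<forall>j\<in>{1..m}. Z (n j) \<omega> 1 \<ge> \<xi> j} =
         fredholm_det m (\<lambda>_. lborel) (\<lambda>j y. of_bool (y < \<xi> j)) (walk_kernel 1 d m n x)"
      by (rule smallest_particle(2)[OF assms(1-5,7,8)])
  qed
qed

end
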